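(* Let $p$ be a prime, let $n\ge 1$, let $F_q$ be the finite field with $q=p^n$ elements, and let $QD_{32}=\langle a,x \mid a^{16}=x^2=1,\ xax=a^{7}\rangle$ be the quasidihedral group of order $32$. Let $U(F_q[QD_{32}])$ be the unit group of the group algebra $F_q[QD_{32}]$, and let $V_1=1+J(F_q[QD_{32}])$, where $J(F_q[QD_{32}])$ is the Jacobson radical of $F_q[QD_{32}]$. 1. If $p=2$, i.e. $|F_q|=2^n$, then: (a) $U(F_q[QD_{32}])/V_1\cong C_{q-1}$; (b) $V_1$ is a $2$-group of order $2^{31n}$ and exponent $16$. 2. If $p>2$, then: (a) if $q\equiv 1$ or $7 \pmod{16}$, then $U(F_q[QD_{32}])\cong C_{q-1}^{4}\times GL(2,F_q)^{7}$; (b) if $q\equiv -1$ or $-7 \pmod{16}$, then $U(F_q[QD_{32}])\cong C_{q-1}^{4}\times GL(2,F_q)^{3}\times GL(2,F_{q^2})^{2}$; (c) if $q\equiv \pm 3$ or $\pm 5 \pmod{16}$, then $U(F_q[QD_{32}])\cong C_{q-1}^{4}\times GL(2,F_q)\times GL(2,F_{q^2})\times GL(2,F_{q^4})$.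
   Context: $C_m$ denotes the cyclic group of order $m$, $GL(2,K)$ the general linear group of degree $2$ over the field $K$, and for a group $H$, $H^{k}$ (also written $C_m^{k}$ for $H=C_m$) denotes the direct product of $k$ copies of $H$. The set $V_1=1+J(F_q[QD_{32}])$ is a normal subgroup of $U(F_q[QD_{32}])$. *)

theory Defs
  imports
    "HOL-Algebra.Coset"
    "HOL-Algebra.Elementary_Groups"
    "HOL-Algebra.Product_Groups"
    "HOL-Algebra.Ideal"
    "HOL-Library.Cardinality"
    "HOL-Number_Theory.Cong"
    "Jordan_Normal_Form.Matrix"
begin

text \<open>Words over the letters \<open>s\<close> and \<open>s\<close> inverse: \<open>(s, True)\<close> stands for the generator \<open>s\<close>
  and \<open>(s, False)\<close> for its formal inverse.\<close>

type_synonym 's word = "('s \<times> bool) list"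

inductive word_equiv :: "('s word \<times> 's word) set \<Rightarrow> 's word \<Rightarrow> 's word \<Rightarrow> bool"
  for R :: "('s word \<times> 's word) set" where
  relation: "(u, v) \<in> R \<Longrightarrow> word_equiv R u v"
| cancel: "word_equiv R [(s, b), (s, \<not> b)] []"
| append: "word_equiv R u u' \<Longrightarrow> word_equiv R v v' \<Longrightarrow> word_equiv R (u @ v) (u' @ v')"
| refl: "word_equiv R u u"
| sym: "word_equiv R u v \<Longrightarrow> word_equiv R v u"
| trans: "word_equiv R u v \<Longrightarrow> word_equiv R v w \<Longrightarrow> word_equiv R u w"

text \<open>The group presented by the generators \<open>UNIV :: 's set\<close> and the relations \<open>u = v\<close> for
  \<open>(u, v) \<in> R\<close>.\<close>

definition presented_group :: "('s word \<times> 's word) set \<Rightarrow> 's word set monoid" where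
  "presented_group R =
    \<lparr>carrier = UNIV // {(u, v). word_equiv R u v},
     monoid.mult = (\<lambda>X Y. {w. \<exists>u\<in>X. \<exists>v\<in>Y. word_equiv R w (u @ v)}),
     one = {w. word_equiv R w []}\<rparr>"

datatype qd_gen = gen_a | gen_x

definition QD32 :: "qd_gen word set monoid" where
  "QD32 = presented_group
    (let a = (gen_a, True); x = (gen_x, True) in
      {(replicate 16 a, []),
       ([x, x], []),
       ([x, a, x], replicate 7 a)})"

text \<open>Elements are the finitely supported functions on \<open>carrier G\<close>, extended by 0; multiplication
  is convolution.\<close>

definition group_algebra ::
    "'k::field itself \<Rightarrow> ('g, 'm) monoid_scheme \<Rightarrow> ('g \<Rightarrow> 'k) ring" where
  "group_algebra ty G =
    \<lparr>carrier = {f. finite {g. f g \<noteq> 0} \<and> {g. f g \<noteq> 0} \<subseteq> carrier G},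
     monoid.mult = (\<lambda>f h g. if g \<in> carrier G
        then (\<Sum>u | u \<in> carrier G \<and> f u \<noteq> 0. f u * h (inv\<^bsub>G\<^esub> u \<otimes>\<^bsub>G\<^esub> g)) else 0),
     one = (\<lambda>g. if g = \<one>\<^bsub>G\<^esub> then 1 else 0),
     zero = (\<lambda>g. 0),
     add = (\<lambda>f h g. f g + h g)\<rparr>"

text \<open>HOL-Algebra only has two-sided ideals. Over a noncommutative ring the Jacobson radical is the
  intersection of the maximal left ideals.\<close>

locale left_ideal = additive_subgroup I R + ring R for I and R (structure) +
  assumes I_l_closed: "\<lbrakk>a \<in> I; r \<in> carrier R\<rbrakk> \<Longrightarrow> r \<otimes> a \<in> I"

locale maximal_left_ideal = left_ideal +
  assumes I_notcarr: "carrier R \<noteq> I"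
    and I_maximal: "\<lbrakk>left_ideal J R; I \<subseteq> J; J \<subseteq> carrier R\<rbrakk> \<Longrightarrow> J = I \<or> J = carrier R"

definition jacobson_radical :: "('a, 'm) ring_scheme \<Rightarrow> 'a set" where
  "jacobson_radical R = carrier R \<inter> \<Inter>{I. maximal_left_ideal I R}"

definition GL :: "nat \<Rightarrow> 'k::field itself \<Rightarrow> 'k mat monoid" where
  "GL n ty = units_of (ring_mat ty n ())"

definition group_power :: "('a, 'm) monoid_scheme \<Rightarrow> nat \<Rightarrow> (nat \<Rightarrow> 'a) monoid" where
  "group_power G k = product_group {..<k} (\<lambda>_. G)"

definition p_group :: "nat \<Rightarrow> ('a, 'm) monoid_scheme \<Rightarrow> bool" where
  "p_group p G \<longleftrightarrow> group G \<and> (\<forall>g\<in>carrier G. \<exists>k::nat. g [^]\<^bsub>G\<^esub> (p ^ k) = \<one>\<^bsub>G\<^esub>)"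

text \<open>Meaningful for groups of finite exponent, in particular for finite groups.\<close>

definition group_exponent :: "('a, 'm) monoid_scheme \<Rightarrow> nat" where
  "group_exponent G = (LEAST m. 0 < m \<and> (\<forall>g\<in>carrier G. g [^]\<^bsub>G\<^esub> m = \<one>\<^bsub>G\<^esub>))"

end

theory Submission
  imports
    "HOL-Algebra.Algebraic_Closure_Type"
    "Jordan_Normal_Form.Char_Poly"
    Defs
begin

text \<open>The group has the normal form \<open>a^i x^b\<close> with \<open>i < 16\<close> and \<open>b \<le> 1\<close>, so an element of the algebra \<open>A\<close> is
\<open>u(a) + v(a) x\<close> for a unique pair of polynomials \<open>u\<close>, \<open>v\<close> of degree less than 16. As
\<open>x p(a) x = p(a^7)\<close>, the product of two pairs is
\<open>(u u' + v \<sigma>(v'), u v' + v \<sigma>(u'))\<close> modulo \<open>X^16 - 1\<close>, where \<open>\<sigma>\<close> (\<open>twist\<close> below) substitutes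
\<open>X^7\<close> for \<open>X\<close> (lemma \<open>qd_poly_mult\<close>). Everything else is a computation with such pairs.

In characteristic 2, \<open>X^16 - 1 = (X - 1)^16\<close>. Pairs divisible by \<open>(X - 1)^k\<close> form a filtration
in which squaring doubles \<open>k\<close>, and the square of an element of augmentation 0 is divisible by
\<open>(X - 1)^2\<close>, because \<open>\<sigma>(p) - p\<close> always is. Four squarings therefore give \<open>\<alpha>^16 = 0\<close> for every
\<open>\<alpha>\<close> of augmentation 0. Hence the units are the elements of nonzero augmentation, the
augmentation ideal is the only maximal left ideal, and \<open>V1\<close> is the kernel of the augmentation on
units: this yields the quotient, the order \<open>q^31\<close>, and the exponent, since \<open>a\<close> itself has order 16.

In odd characteristic, \<open>X^16 - 1\<close> is the separable product
\<open>(X - 1)(X + 1)(X^2 + 1)(X^4 + 1)(X^8 + 1)\<close>. The two linear factors carry four linear characters.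
A quadratic divisor \<open>m = X^2 - t X + d\<close> over an extension \<open>E\<close>, whose two roots \<open>\<omega>\<close> and \<open>\<omega>^7\<close> are
exchanged by \<open>\<sigma>\<close>, gives a homomorphism from \<open>A\<close> to the \<open>2\<close> by \<open>2\<close> matrices over \<open>E\<close>: let \<open>a\<close> act on \<open>E[X]/(m)\<close>
as multiplication by \<open>X\<close> and \<open>x\<close> as \<open>\<sigma>\<close> (locale \<open>qd_block\<close>). This block vanishes on \<open>(u, v)\<close> only
if \<open>m\<close> divides \<open>u\<close> and \<open>v\<close>, and then so do all conjugates of \<open>m\<close> over the ground field. The
quadratic factors of \<open>X^8 + 1\<close> are \<open>X^2 - t X - 1\<close> with \<open>t^4 + 4 t^2 + 2 = 0\<close>, that is, with
\<open>t = \<zeta> + \<zeta>^7\<close> for a primitive 16th root of unity \<open>\<zeta>\<close>; those of \<open>X^4 + 1\<close> are \<open>X^2 - s X + 1\<close> with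
\<open>s^2 = 2\<close>; and \<open>X^2 + 1\<close> is the case \<open>t = 0\<close>, \<open>d = 1\<close>. The residue of \<open>q\<close> modulo 16 determines how the Frobenius map permutes the four \<open>t\<close> and
the two \<open>s\<close>, hence which fields the blocks need and how many blocks there are. In each of the three cases the
characters together with one block for each orbit are jointly injective, and source and target
both have \<open>q^32\<close> elements, so they form an isomorphism of \<open>A\<close> with a product of matrix rings.
Passing to units gives the claim.

The larger fields are only given by their cardinality. Roots \<open>t\<close> and \<open>s\<close> are found in them by
testing the equation \<open>y^Q = y\<close> in an algebraic closure, and the ground field is embedded into them
by transporting a primitive element along an integral lift of its minimal polynomial.\<close>

hide_const (open) Divisibility.prime Polynomial.order

section \<open>Normal forms in the quasidihedral group\<close>

text \<open>The multiplication of the concrete group on pairs \<open>(i, b)\<close>, standing for \<open>a^i x^b\<close>. It serves as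
a model of the presentation in which distinct normal forms are visibly distinct.\<close>

definition qd_mult :: "nat \<times> bool \<Rightarrow> nat \<times> bool \<Rightarrow> nat \<times> bool" where
  "qd_mult g h = ((fst g + (if snd g then 7 else 1) * fst h) mod 16, snd g \<noteq> snd h)"

fun qd_letter :: "qd_gen \<times> bool \<Rightarrow> nat \<times> bool" where
  "qd_letter (gen_a, True) = (1, False)"
| "qd_letter (gen_a, False) = (15, False)"
| "qd_letter (gen_x, _) = (0, True)"

definition qd_eval :: "qd_gen word \<Rightarrow> nat \<times> bool" where
  "qd_eval w = foldr (\<lambda>s. qd_mult (qd_letter s)) w (0, False)"

definition qd_relations :: "(qd_gen word \<times> qd_gen word) set" where
  "qd_relations =
    (let a = (gen_a, True); x = (gen_x, True) in
      {(replicate 16 a, []), ([x, x], []), ([x, a, x], replicate 7 a)})"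

lemma QD32_eq: "QD32 = presented_group qd_relations"
  by (simp add: QD32_def qd_relations_def)

abbreviation "qd_equiv \<equiv> word_equiv qd_relations"

lemma qd_mult_mod: "((i + c * (j mod 16)) mod 16 :: nat) = (i + c * j) mod 16"
proof -
  have "(i + c * (j mod 16)) mod 16 = (i + (c * (j mod 16)) mod 16) mod 16" by (simp only: mod_add_right_eq)
  also have "\<dots> = (i + c * j) mod 16" by (simp only: mod_add_right_eq mod_mult_right_eq)
  finally show ?thesis .
qed

lemma qd_mult_assoc: "qd_mult (qd_mult g h) k = qd_mult g (qd_mult h k)"
proof -
  have *: "((i + (7 * j + 49 * l)) mod 16 :: nat) = (i + (7 * j + l)) mod 16" for i j l
  proof -
    have "i + (7 * j + 49 * l) = (i + (7 * j + l)) + 16 * (3 * l)" by simp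
    thus ?thesis by (simp only: mod_mult_self2)
  qed
  obtain i b j c l d where "g = (i, b)" "h = (j, c)" "k = (l, d)" by (metis surj_pair)
  thus ?thesis
    by (cases b; cases c) (simp_all add: qd_mult_def mod_simps qd_mult_mod distrib_left * add.assoc)
qed

lemma qd_eval_Nil [simp]: "qd_eval [] = (0, False)"
  by (simp add: qd_eval_def)

lemma qd_eval_Cons: "qd_eval (s # w) = qd_mult (qd_letter s) (qd_eval w)"
  by (simp add: qd_eval_def)

lemma fst_qd_eval_less [simp]: "fst (qd_eval w) < 16"
  by (cases w) (auto simp: qd_eval_Cons qd_mult_def)

lemma qd_eval_append: "qd_eval (u @ v) = qd_mult (qd_eval u) (qd_eval v)"
proof (induction u)
  case Nil
  show ?case by (simp add: qd_mult_def prod_eq_iff)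
qed (simp add: qd_eval_Cons qd_mult_assoc)

lemma qd_eval_replicate: "qd_eval (replicate n (gen_a, True)) = (n mod 16, False)"
  by (induction n) (auto simp: qd_eval_Cons qd_mult_def mod_Suc_eq)

lemma qd_equiv_imp_eval_eq:
  assumes "qd_equiv u v" shows "qd_eval u = qd_eval v"
  using assms
proof induction
  case (relation u v)
  then consider "u = replicate 16 (gen_a, True)" "v = []"
    | "u = [(gen_x, True), (gen_x, True)]" "v = []"
    | "u = [(gen_x, True), (gen_a, True), (gen_x, True)]" "v = replicate 7 (gen_a, True)"
    unfolding qd_relations_def Let_def by blast
  thus ?case
    by cases (simp_all only: qd_eval_replicate, simp_all add: qd_eval_Cons qd_mult_def)
next
  case (cancel s b)
  show ?case by (cases s; cases b) (auto simp: qd_eval_Cons qd_mult_def)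
qed (auto simp: qd_eval_append)

definition qd_word :: "nat \<times> bool \<Rightarrow> qd_gen word" where
  "qd_word g = replicate (fst g) (gen_a, True) @ (if snd g then [(gen_x, True)] else [])"

lemma qd_eval_word: "qd_eval (qd_word g) = (fst g mod 16, snd g)"
  by (simp add: qd_word_def qd_eval_append qd_eval_replicate) (auto simp: qd_eval_Cons qd_mult_def)

lemma qd_equiv_rel:
  "qd_equiv (replicate 16 (gen_a, True)) []"
  "qd_equiv [(gen_x, True), (gen_x, True)] []"
  "qd_equiv [(gen_x, True), (gen_a, True), (gen_x, True)] (replicate 7 (gen_a, True))"
  by (rule word_equiv.relation, simp add: qd_relations_def Let_def)+

lemma qd_equiv_replicate_mod:
  "qd_equiv (replicate n (gen_a, True)) (replicate (n mod 16) (gen_a, True))"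
proof (induction n rule: less_induct)
  case (less n)
  show ?case
  proof (cases "n < 16")
    case False
    have "qd_equiv (replicate 16 (gen_a, True) @ replicate (n - 16) (gen_a, True))
        ([] @ replicate ((n - 16) mod 16) (gen_a, True))"
      using less[of "n - 16"] False by (intro word_equiv.append qd_equiv_rel) auto
    thus ?thesis using False by (simp add: replicate_add[symmetric] le_mod_geq)
  qed (auto intro: word_equiv.refl)
qed

lemma qd_equiv_pref: "qd_equiv v v' \<Longrightarrow> qd_equiv (u @ v) (u @ v')"
  by (intro word_equiv.append word_equiv.refl)
lemma qd_equiv_suff: "qd_equiv v v' \<Longrightarrow> qd_equiv (v @ u) (v' @ u)"
  by (intro word_equiv.append word_equiv.refl)

text \<open>Each time \<open>x\<close> moves past an \<open>a\<close> it turns it into \<open>a^7\<close>: \<open>x a = x a x x\<close>.\<close>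

lemma qd_equiv_xa: "qd_equiv ((gen_x, True) # replicate n (gen_a, True))
    (replicate (7 * n) (gen_a, True) @ [(gen_x, True)])"
proof (induction n)
  case 0 thus ?case by (auto intro: word_equiv.refl)
next
  case (Suc n)
  let ?a = "(gen_a, True)" and ?x = "(gen_x, True)"
  have 1: "qd_equiv ([?x, ?a] @ []) ([?x, ?a] @ [?x, ?x])"
    by (rule qd_equiv_pref[OF word_equiv.sym[OF qd_equiv_rel(2)]])
  have 2: "qd_equiv ([?x, ?a, ?x] @ [?x]) (replicate 7 ?a @ [?x])"
    by (rule qd_equiv_suff[OF qd_equiv_rel(3)])
  have "qd_equiv [?x, ?a] (replicate 7 ?a @ [?x])"
    using word_equiv.trans[OF 1, of "replicate 7 ?a @ [?x]"] 2 by simp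
  hence "qd_equiv ([?x, ?a] @ replicate n ?a) ((replicate 7 ?a @ [?x]) @ replicate n ?a)"
    by (rule qd_equiv_suff)
  hence 3: "qd_equiv (?x # replicate (Suc n) ?a) (replicate 7 ?a @ (?x # replicate n ?a))" by simp
  have 4: "qd_equiv (replicate 7 ?a @ (?x # replicate n ?a))
      (replicate 7 ?a @ (replicate (7 * n) ?a @ [?x]))"
    by (rule qd_equiv_pref[OF Suc])
  have 5: "replicate (7 * Suc n) ?a = replicate 7 ?a @ replicate (7*n) ?a"
    by (simp add: replicate_add[symmetric])
  show ?case unfolding 5 using word_equiv.trans[OF 3 4] by simp
qed

text \<open>Inverse letters are eliminated here, using \<open>a^16 = 1\<close> and \<open>x^2 = 1\<close>.\<close>

lemma qd_equiv_letter: "qd_equiv [s] (qd_word (qd_letter s))"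
proof -
  have inv: "qd_equiv [(g, False)] v" if "qd_equiv ((g, True) # v) []" for g v
  proof -
    have "qd_equiv ([(g, False)] @ []) ([(g, False)] @ (g, True) # v)"
      by (rule qd_equiv_pref[OF word_equiv.sym[OF that]])
    moreover have "qd_equiv ([(g, False), (g, \<not> False)] @ v) ([] @ v)"
      by (rule qd_equiv_suff[OF word_equiv.cancel])
    ultimately show ?thesis using word_equiv.trans by fastforce
  qed
  show ?thesis
  proof (cases s rule: qd_letter.cases)
    case 2
    have "qd_equiv ((gen_a, True) # replicate 15 (gen_a, True)) []"
      using qd_equiv_rel(1) by (simp add: eval_nat_numeral)
    from inv[OF this] show ?thesis using 2 by (simp add: qd_word_def)
  next
    case (3 b)
    show ?thesis
      using inv[OF qd_equiv_rel(2)] 3 by (cases b) (auto simp: qd_word_def intro: word_equiv.refl)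
  qed (auto simp: qd_word_def intro: word_equiv.refl)
qed

lemma qd_equiv_word_mult: "qd_equiv (qd_word g @ qd_word h) (qd_word (qd_mult g h))"
proof -
  let ?a = "(gen_a, True)" and ?x = "(gen_x, True)"
  obtain i b where g: "g = (i, b)" by (cases g)
  obtain k c where h: "h = (k, c)" by (cases h)
  show ?thesis
  proof (cases b)
    case False
    have "qd_equiv (replicate (i + k) ?a @ (if c then [?x] else []))
       (replicate ((i + k) mod 16) ?a @ (if c then [?x] else []))"
      by (rule qd_equiv_suff[OF qd_equiv_replicate_mod])
    thus ?thesis using False by (simp add: g h qd_word_def qd_mult_def replicate_add)
  next
    case True
    have 1: "qd_equiv (replicate i ?a @ (?x # replicate k ?a) @ (if c then [?x] else []))
        (replicate i ?a @ (replicate (7 * k) ?a @ [?x]) @ (if c then [?x] else []))"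
      by (rule qd_equiv_pref[OF qd_equiv_suff[OF qd_equiv_xa]])
    have 2: "qd_equiv (replicate (i + 7 * k) ?a @ ([?x] @ (if c then [?x] else [])))
       (replicate ((i + 7 * k) mod 16) ?a @ (if c then [] else [?x]))"
      by (intro word_equiv.append qd_equiv_replicate_mod)
         (use qd_equiv_rel(2) in \<open>auto intro: word_equiv.refl\<close>)
    have "qd_equiv (replicate i ?a @ (?x # replicate k ?a) @ (if c then [?x] else []))
       (replicate ((i + 7 * k) mod 16) ?a @ (if c then [] else [?x]))"
      by (rule word_equiv.trans[OF 1]) (use 2 in \<open>simp add: replicate_add\<close>)
    thus ?thesis using True by (cases c) (simp_all add: g h qd_word_def qd_mult_def)
  qed
qed

lemma qd_equiv_normal_form: "qd_equiv w (qd_word (qd_eval w))"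
proof (induction w)
  case Nil thus ?case by (auto simp: qd_word_def intro: word_equiv.refl)
next
  case (Cons s w)
  have "qd_equiv ([s] @ w) (qd_word (qd_letter s) @ qd_word (qd_eval w))"
    by (intro word_equiv.append qd_equiv_letter Cons)
  from word_equiv.trans[OF this qd_equiv_word_mult] show ?case by (simp add: qd_eval_Cons)
qed

text \<open>The word problem: evaluation in the model separates exactly the elements of the presented group,
because every word can be rewritten to the normal form of its value.\<close>

lemma qd_equiv_iff: "qd_equiv u v \<longleftrightarrow> qd_eval u = qd_eval v"
  by (metis qd_equiv_imp_eval_eq qd_equiv_normal_form word_equiv.sym word_equiv.trans)

text \<open>The class of \<open>a^i x^b\<close>. The exponent is reduced modulo 16, so that products need no case
distinction.\<close>

definition qd_elem :: "nat \<Rightarrow> bool \<Rightarrow> qd_gen word set" where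
  "qd_elem i b = {w. qd_eval w = (i mod 16, b)}"

lemma qd_word_in_elem [simp]: "qd_word (i, b) \<in> qd_elem i b"
  by (simp add: qd_elem_def qd_eval_word)

lemma qd_elem_eq_iff: "qd_elem i b = qd_elem k c \<longleftrightarrow> i mod 16 = k mod 16 \<and> b = c"
proof
  assume "qd_elem i b = qd_elem k c"
  hence "qd_word (i, b) \<in> qd_elem k c" using qd_word_in_elem[of i b] by simp
  thus "i mod 16 = k mod 16 \<and> b = c" by (simp add: qd_elem_def qd_eval_word)
qed (simp add: qd_elem_def)

lemma carrier_QD32: "carrier QD32 = (\<lambda>(i, b). qd_elem i b) ` ({..<16} \<times> UNIV)"
proof -
  have "{v. qd_equiv u v} = qd_elem (fst (qd_eval u)) (snd (qd_eval u))" for u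
    by (auto simp: qd_elem_def qd_equiv_iff)
  hence "carrier QD32 = range (\<lambda>u. qd_elem (fst (qd_eval u)) (snd (qd_eval u)))"
    by (auto simp: QD32_eq presented_group_def quotient_def)
  also have "\<dots> = (\<lambda>(i, b). qd_elem i b) ` ({..<16} \<times> UNIV)"
  proof (safe)
    fix u show "qd_elem (fst (qd_eval u)) (snd (qd_eval u)) \<in> (\<lambda>(i, b). qd_elem i b) ` ({..<16} \<times> UNIV)"
      by (intro image_eqI[of _ _ "qd_eval u"]) (auto simp: case_prod_beta mem_Times_iff)
  next
    fix i b assume "i < (16::nat)"
    thus "qd_elem i b \<in> range (\<lambda>u. qd_elem (fst (qd_eval u)) (snd (qd_eval u)))"
      by (intro image_eqI[of _ _ "qd_word (i, b)"]) (auto simp: qd_eval_word)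
  qed
  finally show ?thesis .
qed

lemma qd_elem_closed [simp]: "qd_elem i b \<in> carrier QD32"
  unfolding carrier_QD32
  by (intro image_eqI[of _ _ "(i mod 16, b)"]) (auto simp: qd_elem_def)

lemma one_QD32: "\<one>\<^bsub>QD32\<^esub> = qd_elem 0 False"
  by (auto simp: QD32_eq presented_group_def qd_elem_def qd_equiv_iff)

lemma mult_QD32: "qd_elem i b \<otimes>\<^bsub>QD32\<^esub> qd_elem k c = qd_elem (i + (if b then 7 else 1) * k) (b \<noteq> c)"
proof -
  have "qd_elem i b \<otimes>\<^bsub>QD32\<^esub> qd_elem k c
      = {w. \<exists>u\<in>qd_elem i b. \<exists>v\<in>qd_elem k c. qd_eval w = qd_mult (qd_eval u) (qd_eval v)}"
    by (simp add: QD32_eq presented_group_def qd_equiv_iff qd_eval_append)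
  also have "\<dots> = {w. qd_eval w = qd_mult (i mod 16, b) (k mod 16, c)}"
    using qd_word_in_elem[of i b] qd_word_in_elem[of k c] by (auto simp: qd_elem_def)
  also have "\<dots> = qd_elem (i + (if b then 7 else 1) * k) (b \<noteq> c)"
    by (auto simp: qd_elem_def qd_mult_def mod_simps qd_mult_mod)
  finally show ?thesis .
qed

lemma bij_betw_qd_elem:
  "bij_betw (\<lambda>(i, b). qd_elem i b) ({..<16} \<times> UNIV) (carrier QD32)"
  unfolding carrier_QD32 by (intro inj_on_imp_bij_betw inj_onI) (auto simp: qd_elem_eq_iff)

lemma finite_QD32 [simp]: "finite (carrier QD32)"
  unfolding carrier_QD32 by auto

lemma card_QD32: "card (carrier QD32) = 32"
  using bij_betw_same_card[OF bij_betw_qd_elem] by (simp add: card_cartesian_product)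

lemma group_QD32: "group QD32"
proof (rule groupI)
  fix x y z assume "x \<in> carrier QD32" "y \<in> carrier QD32" "z \<in> carrier QD32"
  then obtain i b j c k d where xyz: "x = qd_elem i b" "y = qd_elem j c" "z = qd_elem k d"
    unfolding carrier_QD32 by auto
  have *: "((i + (7 * j + 49 * k)) mod 16 :: nat) = (i + (7 * j + k)) mod 16" for i j k
  proof -
    have "i + (7 * j + 49 * k) = (i + (7 * j + k)) + 16 * (3 * k)" by simp
    thus ?thesis by (simp only: mod_mult_self2)
  qed
  show "x \<otimes>\<^bsub>QD32\<^esub> y \<in> carrier QD32" unfolding xyz by (simp add: mult_QD32)
  show "x \<otimes>\<^bsub>QD32\<^esub> y \<otimes>\<^bsub>QD32\<^esub> z = x \<otimes>\<^bsub>QD32\<^esub> (y \<otimes>\<^bsub>QD32\<^esub> z)"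
    unfolding xyz by (simp add: mult_QD32 qd_elem_eq_iff) (auto simp: distrib_left add.assoc *)
next
  fix x assume "x \<in> carrier QD32"
  then obtain i b where x: "x = qd_elem i b" "i < 16" unfolding carrier_QD32 by auto
  show "\<one>\<^bsub>QD32\<^esub> \<otimes>\<^bsub>QD32\<^esub> x = x" unfolding x by (simp add: one_QD32 mult_QD32)
  have "qd_elem (if b then 9 * i else 15 * i) b \<otimes>\<^bsub>QD32\<^esub> x = \<one>\<^bsub>QD32\<^esub>"
    unfolding x by (simp add: one_QD32 mult_QD32 qd_elem_eq_iff)
  thus "\<exists>y\<in>carrier QD32. y \<otimes>\<^bsub>QD32\<^esub> x = \<one>\<^bsub>QD32\<^esub>" by (intro bexI[of _ "qd_elem (if b then 9 * i else 15 * i) b"]) auto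
qed (auto simp: one_QD32)

section \<open>Group algebras of finite groups\<close>

lemma group_algebra_carrier:
  assumes "finite (carrier G)"
  shows "carrier (group_algebra ty G) = {f. \<forall>g. g \<notin> carrier G \<longrightarrow> f g = 0}"
  using assms by (auto simp: group_algebra_def intro: finite_subset)

lemma group_algebra_simps:
  "\<zero>\<^bsub>group_algebra ty G\<^esub> = (\<lambda>g. 0)"
  "\<one>\<^bsub>group_algebra ty G\<^esub> = (\<lambda>g. if g = \<one>\<^bsub>G\<^esub> then 1 else 0)"
  "f \<oplus>\<^bsub>group_algebra ty G\<^esub> h = (\<lambda>g. f g + h g)"
  by (simp_all add: group_algebra_def)

lemma group_algebra_mult_apply:
  assumes "finite (carrier G)" "g \<in> carrier G"
  shows "(f \<otimes>\<^bsub>group_algebra ty G\<^esub> h) g = (\<Sum>u\<in>carrier G. f u * h (inv\<^bsub>G\<^esub> u \<otimes>\<^bsub>G\<^esub> g))"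
  using assms by (auto simp: group_algebra_def intro!: sum.mono_neutral_left)

lemma group_algebra_mult_outside:
  "g \<notin> carrier G \<Longrightarrow> (f \<otimes>\<^bsub>group_algebra ty G\<^esub> h) g = 0"
  by (simp add: group_algebra_def)

text \<open>A function \<open>\<phi>\<close> on the group extends linearly to the group algebra; on a product of two elements the
extension is the double sum over \<open>\<phi> (u \<otimes> w)\<close>. With indicator functions for \<open>\<phi>\<close> this yields the ring
axioms, with powers of \<open>X\<close> it yields the polynomial description of the product.\<close>

lemma group_algebra_pairing:
  fixes \<iota> :: "'k::field \<Rightarrow> 'r::comm_ring_1" and G (structure)
  assumes "group G" and fin: "finite (carrier G)" and "comm_ring_hom \<iota>"
  shows "(\<Sum>g\<in>carrier G. \<iota> ((f \<otimes>\<^bsub>group_algebra TYPE('k) G\<^esub> h) g) * \<phi> g)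
       = (\<Sum>u\<in>carrier G. \<Sum>w\<in>carrier G. \<iota> (f u) * \<iota> (h w) * \<phi> (u \<otimes> w))"
proof -
  interpret group G by fact
  interpret comm_ring_hom \<iota> by fact
  have "(\<Sum>g\<in>carrier G. \<iota> ((f \<otimes>\<^bsub>group_algebra TYPE('k) G\<^esub> h) g) * \<phi> g)
      = (\<Sum>g\<in>carrier G. \<Sum>u\<in>carrier G. \<iota> (f u) * \<iota> (h (inv u \<otimes> g)) * \<phi> g)"
    by (simp add: group_algebra_mult_apply[OF fin] hom_distribs sum_distrib_right)
  also have "\<dots> = (\<Sum>u\<in>carrier G. \<Sum>g\<in>carrier G. \<iota> (f u) * \<iota> (h (inv u \<otimes> g)) * \<phi> g)"
    by (rule sum.swap)
  also have "\<dots> = (\<Sum>u\<in>carrier G. \<Sum>w\<in>carrier G. \<iota> (f u) * \<iota> (h w) * \<phi> (u \<otimes> w))"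
  proof (rule sum.cong[OF HOL.refl])
    fix u assume u: "u \<in> carrier G"
    show "(\<Sum>g\<in>carrier G. \<iota> (f u) * \<iota> (h (inv u \<otimes> g)) * \<phi> g)
        = (\<Sum>w\<in>carrier G. \<iota> (f u) * \<iota> (h w) * \<phi> (u \<otimes> w))"
      by (rule sum.reindex_bij_witness[of _ "\<lambda>w. u \<otimes> w" "\<lambda>g. inv u \<otimes> g"])
         (use u in \<open>auto simp: m_assoc[symmetric]\<close>)
  qed
  finally show ?thesis .
qed

lemma comm_ring_hom_id: "comm_ring_hom (\<lambda>x :: 'a :: comm_ring_1. x)"
  by unfold_locales auto

lemma group_algebra_eqI:
  fixes f f' :: "'g \<Rightarrow> 'k::field"
  assumes fin: "finite (carrier G)"
    and "f \<in> carrier (group_algebra TYPE('k) G)" "f' \<in> carrier (group_algebra TYPE('k) G)"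
    and eq: "\<And>\<phi> :: 'g \<Rightarrow> 'k. (\<Sum>g\<in>carrier G. f g * \<phi> g) = (\<Sum>g\<in>carrier G. f' g * \<phi> g)"
  shows "f = f'"
proof
  fix x show "f x = f' x"
  proof (cases "x \<in> carrier G")
    case True
    thus ?thesis using eq[of "\<lambda>g. if g = x then 1 else 0"] fin
      by (simp add: if_distrib cong: if_cong)
  qed (use assms(2,3) in \<open>auto simp: group_algebra_carrier[OF fin]\<close>)
qed

lemma ring_group_algebra:
  fixes G (structure)
  assumes G: "group G" and fin: "finite (carrier G)"
  shows "ring (group_algebra TYPE('k::field) G)" (is "ring ?A")
proof -
  interpret group G by fact
  note pair = group_algebra_pairing[OF G fin comm_ring_hom_id]
  note carr = group_algebra_carrier[OF fin, where ty = "TYPE('k)"]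
  have closed: "f \<otimes>\<^bsub>?A\<^esub> h \<in> carrier ?A" for f h :: "'a \<Rightarrow> 'k"
    by (simp add: carr group_algebra_mult_outside)
  have one: "\<one>\<^bsub>?A\<^esub> \<in> carrier ?A" by (auto simp: carr group_algebra_simps)
  have if1: "(if P then 1 else 0) * x = (if P then x else (0::'k))"
       "x * (if P then 1 else 0) = (if P then x else (0::'k))" for P x by auto
  have sum_if: "(\<Sum>u\<in>carrier G. if u = \<one> then h u else 0) = h \<one>" for h :: "'a \<Rightarrow> 'k"
    using fin by simp
  show ?thesis
  proof (rule ringI)
    show "abelian_group ?A"
    proof (rule abelian_groupI)
      fix f :: "'a \<Rightarrow> 'k" assume "f \<in> carrier ?A"
      thus "\<exists>y\<in>carrier ?A. y \<oplus>\<^bsub>?A\<^esub> f = \<zero>\<^bsub>?A\<^esub>"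
        by (intro bexI[of _ "\<lambda>g. - f g"]) (auto simp: carr group_algebra_simps)
    qed (auto simp: carr group_algebra_simps add_ac)
    show "monoid ?A"
    proof (rule monoidI)
      fix f h k :: "'a \<Rightarrow> 'k"
      assume f: "f \<in> carrier ?A" and h: "h \<in> carrier ?A" and k: "k \<in> carrier ?A"
      show "f \<otimes>\<^bsub>?A\<^esub> h \<otimes>\<^bsub>?A\<^esub> k = f \<otimes>\<^bsub>?A\<^esub> (h \<otimes>\<^bsub>?A\<^esub> k)"
      proof (rule group_algebra_eqI[OF fin closed closed])
        fix \<phi> :: "'a \<Rightarrow> 'k"
        have "(\<Sum>g\<in>carrier G. (f \<otimes>\<^bsub>?A\<^esub> h \<otimes>\<^bsub>?A\<^esub> k) g * \<phi> g)
            = (\<Sum>u\<in>carrier G. (f \<otimes>\<^bsub>?A\<^esub> h) u * (\<Sum>w\<in>carrier G. k w * \<phi> (u \<otimes> w)))"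
          by (simp only: pair[where f = "f \<otimes>\<^bsub>?A\<^esub> h" and h = k] sum_distrib_left mult.assoc)
        also have "\<dots> = (\<Sum>u\<in>carrier G. \<Sum>v\<in>carrier G. \<Sum>w\<in>carrier G. f u * h v * (k w * \<phi> (u \<otimes> v \<otimes> w)))"
          unfolding pair[where f = f and h = h] by (simp only: sum_distrib_left)
        also have "\<dots> = (\<Sum>u\<in>carrier G. f u * (\<Sum>v\<in>carrier G. \<Sum>w\<in>carrier G. h v * k w * \<phi> (u \<otimes> (v \<otimes> w))))"
          by (simp add: sum_distrib_left mult.assoc m_assoc)
        also have "\<dots> = (\<Sum>u\<in>carrier G. f u * (\<Sum>v\<in>carrier G. (h \<otimes>\<^bsub>?A\<^esub> k) v * \<phi> (u \<otimes> v)))"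
          by (simp only: pair[where f = h and h = k])
        also have "\<dots> = (\<Sum>g\<in>carrier G. (f \<otimes>\<^bsub>?A\<^esub> (h \<otimes>\<^bsub>?A\<^esub> k)) g * \<phi> g)"
          by (simp only: pair[where f = f and h = "h \<otimes>\<^bsub>?A\<^esub> k"] sum_distrib_left mult.assoc)
        finally show "(\<Sum>g\<in>carrier G. (f \<otimes>\<^bsub>?A\<^esub> h \<otimes>\<^bsub>?A\<^esub> k) g * \<phi> g)
            = (\<Sum>g\<in>carrier G. (f \<otimes>\<^bsub>?A\<^esub> (h \<otimes>\<^bsub>?A\<^esub> k)) g * \<phi> g)" .
      qed
    next
      fix f :: "'a \<Rightarrow> 'k" assume f: "f \<in> carrier ?A"
      have "(\<Sum>g\<in>carrier G. (\<one>\<^bsub>?A\<^esub> \<otimes>\<^bsub>?A\<^esub> f) g * \<phi> g) = (\<Sum>g\<in>carrier G. f g * \<phi> g)" for \<phi> :: "'a \<Rightarrow> 'k"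
      proof -
        have "(\<Sum>g\<in>carrier G. (\<one>\<^bsub>?A\<^esub> \<otimes>\<^bsub>?A\<^esub> f) g * \<phi> g)
            = (\<Sum>u\<in>carrier G. if u = \<one> then (\<Sum>w\<in>carrier G. f w * \<phi> (u \<otimes> w)) else 0)"
          unfolding pair by (intro sum.cong) (auto simp: group_algebra_simps)
        thus ?thesis unfolding sum_if by simp
      qed
      thus "\<one>\<^bsub>?A\<^esub> \<otimes>\<^bsub>?A\<^esub> f = f" by (intro group_algebra_eqI[OF fin closed f])
      have "(\<Sum>g\<in>carrier G. (f \<otimes>\<^bsub>?A\<^esub> \<one>\<^bsub>?A\<^esub>) g * \<phi> g) = (\<Sum>g\<in>carrier G. f g * \<phi> g)" for \<phi> :: "'a \<Rightarrow> 'k"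
      proof -
        have "(\<Sum>g\<in>carrier G. (f \<otimes>\<^bsub>?A\<^esub> \<one>\<^bsub>?A\<^esub>) g * \<phi> g)
            = (\<Sum>u\<in>carrier G. \<Sum>w\<in>carrier G. if w = \<one> then f u * \<phi> (u \<otimes> w) else 0)"
          unfolding pair by (intro sum.cong) (auto simp: group_algebra_simps)
        thus ?thesis unfolding sum_if by simp
      qed
      thus "f \<otimes>\<^bsub>?A\<^esub> \<one>\<^bsub>?A\<^esub> = f" by (intro group_algebra_eqI[OF fin closed f])
    qed (use closed one in auto)
  next
    fix f h k :: "'a \<Rightarrow> 'k"
    assume f: "f \<in> carrier ?A" and h: "h \<in> carrier ?A" and k: "k \<in> carrier ?A"
    show "(f \<oplus>\<^bsub>?A\<^esub> h) \<otimes>\<^bsub>?A\<^esub> k = f \<otimes>\<^bsub>?A\<^esub> k \<oplus>\<^bsub>?A\<^esub> h \<otimes>\<^bsub>?A\<^esub> k"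
    proof
      fix g show "((f \<oplus>\<^bsub>?A\<^esub> h) \<otimes>\<^bsub>?A\<^esub> k) g = (f \<otimes>\<^bsub>?A\<^esub> k \<oplus>\<^bsub>?A\<^esub> h \<otimes>\<^bsub>?A\<^esub> k) g"
        by (cases "g \<in> carrier G") (simp_all add: group_algebra_simps group_algebra_mult_apply[OF fin]
          group_algebra_mult_outside distrib_right sum.distrib)
    qed
    show "k \<otimes>\<^bsub>?A\<^esub> (f \<oplus>\<^bsub>?A\<^esub> h) = k \<otimes>\<^bsub>?A\<^esub> f \<oplus>\<^bsub>?A\<^esub> k \<otimes>\<^bsub>?A\<^esub> h"
    proof
      fix g show "(k \<otimes>\<^bsub>?A\<^esub> (f \<oplus>\<^bsub>?A\<^esub> h)) g = (k \<otimes>\<^bsub>?A\<^esub> f \<oplus>\<^bsub>?A\<^esub> k \<otimes>\<^bsub>?A\<^esub> h) g"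
        by (cases "g \<in> carrier G") (simp_all add: group_algebra_simps group_algebra_mult_apply[OF fin]
          group_algebra_mult_outside distrib_left sum.distrib)
    qed
  qed
qed

lemma card_group_algebra:
  assumes fin: "finite (carrier G)"
  shows "card (carrier (group_algebra TYPE('k::{field,finite}) G)) = CARD('k) ^ card (carrier G)"
proof -
  have "bij_betw (\<lambda>f. restrict f (carrier G)) (carrier (group_algebra TYPE('k) G))
      (carrier G \<rightarrow>\<^sub>E (UNIV :: 'k set))"
  proof (rule bij_betw_byWitness[where f' = "\<lambda>f g. if g \<in> carrier G then f g else 0"])
    show "(\<lambda>f g. if g \<in> carrier G then f g else 0) ` (carrier G \<rightarrow>\<^sub>E (UNIV :: 'k set))
        \<subseteq> carrier (group_algebra TYPE('k) G)"
      unfolding group_algebra_carrier[OF fin] by auto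
    show "\<forall>f\<in>carrier G \<rightarrow>\<^sub>E (UNIV :: 'k set).
        restrict (\<lambda>g. if g \<in> carrier G then f g else 0) (carrier G) = f"
      by (auto simp: restrict_def fun_eq_iff PiE_def extensional_def)
  qed (auto simp: group_algebra_carrier[OF fin] fun_eq_iff)
  from bij_betw_same_card[OF this] show ?thesis by (simp add: card_PiE fin)
qed

section \<open>Elements of the algebra as pairs of polynomials\<close>

abbreviation qd_algebra :: "'k::field itself \<Rightarrow> (qd_gen word set \<Rightarrow> 'k) ring" where
  "qd_algebra ty \<equiv> group_algebra ty QD32"

text \<open>The two polynomials \<open>u\<close> (for \<open>b = False\<close>) and \<open>v\<close> (for \<open>b = True\<close>) in \<open>f = u(a) + v(a) x\<close>.\<close>

definition qd_poly :: "bool \<Rightarrow> (qd_gen word set \<Rightarrow> 'k::field) \<Rightarrow> 'k poly" where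
  "qd_poly b f = (\<Sum>i<16. monom (f (qd_elem i b)) i)"

text \<open>Conjugation by \<open>x\<close> on polynomials in \<open>a\<close>.\<close>

definition twist :: "'k::comm_ring_1 poly \<Rightarrow> 'k poly" where
  "twist p = p \<circ>\<^sub>p monom 1 7"

definition unity_poly :: "nat \<Rightarrow> 'k::comm_ring_1 poly" where "unity_poly n = monom 1 n - 1"

lemma twist_simps [simp]:
  "twist 0 = 0" "twist 1 = 1" "twist (p + q) = twist p + twist q" "twist (p - q) = twist p - twist q"
  "twist (p * q) = twist p * twist q" "twist (- p) = - twist p"
  by (simp_all add: twist_def pcompose_add pcompose_diff pcompose_mult pcompose_uminus pcompose_1)

lemma twist_monom [simp]: "twist (monom c n) = monom c (7 * n)"
proof -
  have "twist (monom c n) = smult c (twist (monom 1 1) ^ n)"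
    by (induction n) (auto simp: twist_def pcompose_smult pcompose_mult monom_Suc pcompose_pCons monom_0)
  also have "twist (monom 1 1) = (monom 1 7 :: 'a poly)"
    by (simp add: twist_def pcompose_pCons monom_Suc[of 1 0] monom_0)
  finally show ?thesis by (simp add: monom_power smult_monom)
qed

lemma cong_unity_poly: "[monom 1 n = 1] (mod unity_poly n :: 'k::field poly)"
  by (simp add: cong_iff_dvd_diff unity_poly_def)

lemma cong_monom_mod: "[monom c m = monom c (m mod n)] (mod unity_poly n :: 'k::field poly)"
proof -
  have "monom c m = monom c (m mod n) * monom 1 n ^ (m div n)"
    by (simp add: monom_power mult_monom mult.commute)
  also have "[\<dots> = monom c (m mod n) * 1 ^ (m div n)] (mod unity_poly n)"
    by (intro cong_mult cong_pow cong_unity_poly cong_refl)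
  finally show ?thesis by simp
qed

lemma cong_monom: "k mod n = m mod n \<Longrightarrow> [monom c k = monom c m] (mod unity_poly n :: 'k::field poly)"
  using cong_monom_mod[of c k n] cong_monom_mod[of c m n] by (metis cong_sym cong_trans)

lemma twist_sum: "twist (sum f A) = (\<Sum>i\<in>A. twist (f i))"
  by (induction A rule: infinite_finite_induct) auto

lemma degree_unity_poly: "n > 0 \<Longrightarrow> degree (unity_poly n :: 'k::field poly) = n"
  using degree_add_eq_left[of "-1" "monom 1 n :: 'k poly"] by (simp add: unity_poly_def degree_monom_eq)

lemma unity_poly_dvd_imp_0: "n > 0 \<Longrightarrow> unity_poly n dvd (p :: 'k::field poly) \<Longrightarrow> degree p < n \<Longrightarrow> p = 0"
  using dvd_imp_degree_le[of "unity_poly n" p] by (auto simp: degree_unity_poly)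

lemma degree_qd_poly: "degree (qd_poly b f) < 16"
proof -
  have "degree (qd_poly b f) \<le> 15"
    unfolding qd_poly_def by (intro degree_sum_le) (auto intro: order.trans[OF degree_monom_le])
  thus ?thesis by simp
qed

lemma coeff_qd_poly: "coeff (qd_poly b f) i = (if i < 16 then f (qd_elem i b) else 0)"
  by (simp add: qd_poly_def coeff_sum if_distrib cong: if_cong)

lemma carrier_qd_algebra: "carrier (qd_algebra TYPE('k::field)) = {f. \<forall>g. g \<notin> carrier QD32 \<longrightarrow> f g = 0}"
  by (rule group_algebra_carrier) simp

lemma ring_qd_algebra: "ring (qd_algebra TYPE('k::field))"
  by (rule ring_group_algebra[OF group_QD32 finite_QD32])

lemma qd_algebra_eqI:
  assumes "f \<in> carrier (qd_algebra TYPE('k::field))" "h \<in> carrier (qd_algebra TYPE('k))"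
    and "\<And>b. qd_poly b f = qd_poly b h"
  shows "f = h"
proof
  fix g show "f g = h g"
  proof (cases "g \<in> carrier QD32")
    case True
    then obtain i b where "g = qd_elem i b" "i < 16" by (auto simp: carrier_QD32)
    thus ?thesis using arg_cong[OF assms(3)[of b], of "\<lambda>p. coeff p i"] by (simp add: coeff_qd_poly)
  qed (use assms in \<open>auto simp: carrier_qd_algebra\<close>)
qed

lemma qd_poly_add: "qd_poly b (f \<oplus>\<^bsub>qd_algebra TYPE('k::field)\<^esub> h) = qd_poly b f + qd_poly b h"
  by (simp add: qd_poly_def group_algebra_simps sum.distrib flip: add_monom)

lemma qd_poly_zero: "qd_poly b \<zero>\<^bsub>qd_algebra TYPE('k::field)\<^esub> = 0"
  by (simp add: qd_poly_def group_algebra_simps)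

lemma qd_poly_one: "qd_poly b \<one>\<^bsub>qd_algebra TYPE('k::field)\<^esub> = (if b then 0 else 1)"
  by (rule poly_eqI) (auto simp: coeff_qd_poly group_algebra_simps one_QD32 qd_elem_eq_iff coeff_1)

lemma sum_carrier_QD32:
  "(\<Sum>g\<in>carrier QD32. F g) = (\<Sum>i<16. F (qd_elem i False)) + (\<Sum>i<16. F (qd_elem i True))"
proof -
  have "(\<Sum>g\<in>carrier QD32. F g) = (\<Sum>z\<in>{..<16} \<times> UNIV. F (case z of (i, b) \<Rightarrow> qd_elem i b))"
    by (rule sum.reindex_bij_betw[OF bij_betw_qd_elem, symmetric])
  also have "\<dots> = (\<Sum>i<16. \<Sum>b\<in>UNIV. F (qd_elem i b))"
    by (simp add: sum.cartesian_product case_prod_unfold)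
  finally show ?thesis by (simp add: UNIV_bool sum.distrib)
qed

text \<open>The linear extension of this function to the algebra is \<open>qd_poly b\<close>.\<close>

definition qd_exponent :: "bool \<Rightarrow> qd_gen word set \<Rightarrow> 'k::field poly" where
  "qd_exponent b g = (\<Sum>i<16. if g = qd_elem i b then monom 1 i else 0)"

lemma qd_exponent_elem: "qd_exponent b (qd_elem k c) = (if b = c then monom 1 (k mod 16) else 0)"
proof (cases "b = c")
  case True
  have "qd_exponent b (qd_elem k c) = (\<Sum>i<16. if i = k mod 16 then monom 1 i else (0 :: 'a poly))"
    unfolding qd_exponent_def using True by (intro sum.cong) (auto simp: qd_elem_eq_iff)
  thus ?thesis using True by simp
qed (auto simp: qd_exponent_def qd_elem_eq_iff)

lemma comm_ring_hom_const_poly: "comm_ring_hom (\<lambda>c :: 'k::comm_ring_1. [:c:])"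
  by unfold_locales (auto simp: one_pCons)

text \<open>In a product, \<open>a^i x\<close> followed by \<open>a^j x^b\<close> becomes \<open>a^(i + 7 j) x^(1 + b)\<close>: the part of \<open>f\<close> that
contains \<open>x\<close> twists the polynomials of \<open>h\<close> and exchanges them.\<close>

lemma qd_poly_mult:
  fixes f h :: "qd_gen word set \<Rightarrow> 'k::field"
  shows "[qd_poly b (f \<otimes>\<^bsub>qd_algebra TYPE('k)\<^esub> h)
      = qd_poly False f * qd_poly b h + qd_poly True f * twist (qd_poly (\<not> b) h)] (mod unity_poly 16)"
proof -
  let ?fh = "f \<otimes>\<^bsub>qd_algebra TYPE('k)\<^esub> h"
  let ?c = "\<lambda>c i d j. f (qd_elem i c) * h (qd_elem j d)"
  have 1: "(\<Sum>i<16. \<Sum>j<16. monom (?c False i b j) (i + j)) = qd_poly False f * qd_poly b h"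
    unfolding qd_poly_def sum_product mult_monom ..
  have 2: "(\<Sum>i<16. \<Sum>j<16. monom (?c True i (\<not> b) j) (i + 7 * j))
      = qd_poly True f * twist (qd_poly (\<not> b) h)"
    unfolding qd_poly_def twist_sum twist_monom sum_product mult_monom ..
  have "qd_poly b ?fh = (\<Sum>g\<in>carrier QD32. [:?fh g:] * qd_exponent b g)"
    by (cases b) (simp_all add: sum_carrier_QD32 qd_exponent_elem qd_poly_def smult_monom)
  also have "\<dots> = (\<Sum>u\<in>carrier QD32. \<Sum>w\<in>carrier QD32. [:f u:] * [:h w:] * qd_exponent b (u \<otimes>\<^bsub>QD32\<^esub> w))"
    by (rule group_algebra_pairing[OF group_QD32 finite_QD32 comm_ring_hom_const_poly])
  also have "\<dots> = (\<Sum>i<16. \<Sum>j<16. monom (?c False i b j) ((i + j) mod 16))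
                + (\<Sum>i<16. \<Sum>j<16. monom (?c True i (\<not> b) j) ((i + 7 * j) mod 16))"
    by (cases b) (simp_all add: sum_carrier_QD32 mult_QD32 qd_exponent_elem smult_monom mult.commute)
  finally have 3: "qd_poly b ?fh = (\<Sum>i<16. \<Sum>j<16. monom (?c False i b j) ((i + j) mod 16))
                + (\<Sum>i<16. \<Sum>j<16. monom (?c True i (\<not> b) j) ((i + 7 * j) mod 16))" .
  have "[(\<Sum>i<16. \<Sum>j<16. monom (?c False i b j) ((i + j) mod 16))
                + (\<Sum>i<16. \<Sum>j<16. monom (?c True i (\<not> b) j) ((i + 7 * j) mod 16))
      = (\<Sum>i<16. \<Sum>j<16. monom (?c False i b j) (i + j))
                + (\<Sum>i<16. \<Sum>j<16. monom (?c True i (\<not> b) j) (i + 7 * j))] (mod unity_poly 16)"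
    by (intro cong_add cong_sum cong_sym[OF cong_monom_mod])
  thus ?thesis unfolding 1 2 3 .
qed

section \<open>Embeddings of finite fields\<close>

text \<open>Cyclicity of the multiplicative group, transferred from ring records to the type class.\<close>

lemma field_mult_generator:
  "\<exists>g :: 'f::finite_field. g \<noteq> 0 \<and> (\<forall>x. x \<noteq> 0 \<longrightarrow> (\<exists>n. x = g ^ n))"
proof -
  let ?R = "ring_of_type_algebra :: 'f ring"
  interpret R: field ?R by (rule field_from_type_algebra)
  have "finite (carrier ?R)" by (simp add: ring_of_type_algebra_def)
  obtain g where g: "g \<in> carrier (Multiplicative_Group.mult_of ?R)"
      "carrier (Multiplicative_Group.mult_of ?R) = {g [^]\<^bsub>?R\<^esub> i | i::nat. i \<in> UNIV}"
    by (rule bexE[OF R.finite_field_mult_group_has_gen[OF \<open>finite (carrier ?R)\<close>]])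
  have pow: "g [^]\<^bsub>?R\<^esub> n = g ^ n" for n :: nat
    by (induction n) (simp_all add: ring_of_type_algebra_def mult.commute)
  have carr: "carrier (Multiplicative_Group.mult_of ?R) = UNIV - {0}"
    by (simp add: carrier_mult_of ring_of_type_algebra_def)
  have "\<exists>n. x = g ^ n" if "x \<noteq> 0" for x
  proof -
    have "x \<in> {g ^ i | i::nat. i \<in> UNIV}" using g(2) that unfolding carr pow by auto
    thus ?thesis by auto
  qed
  thus ?thesis using g(1) unfolding carr by blast
qed

text \<open>Translation by 1 permutes the field, so the sum of all elements shows that the cardinality is a
multiple of the characteristic.\<close>

lemma CHAR_eq_prime:
  assumes "prime p" "CARD('f::finite_field) = p ^ n" shows "CHAR('f) = p"
proof -
  have "(\<Sum>x\<in>UNIV. x + 1) = (\<Sum>x\<in>UNIV. x :: 'f)"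
    by (rule sum.reindex_bij_witness[of _ "\<lambda>x. x - 1" "\<lambda>x. x + 1"]) auto
  hence "of_nat CARD('f) = (0 :: 'f)" by (simp add: sum.distrib)
  hence "CHAR('f) dvd p ^ n" using assms by (simp add: of_nat_eq_0_iff_char_dvd del: of_nat_power)
  thus ?thesis using assms(1) by (metis CHAR_prime prime_dvd_power primes_dvd_imp_eq)
qed

lemma CARD_field_gt_1: "CARD('e::finite_field) > 1"
proof -
  have "card {0, 1 :: 'e} \<le> CARD('e)" by (rule card_mono) auto
  thus ?thesis by simp
qed

text \<open>The polynomial \<open>X^Q - X\<close> has at most \<open>Q\<close> roots in the closure, and the \<open>Q\<close> elements of the field
already are roots.\<close>

lemma to_ac_surj:
  fixes y :: "'e::finite_field alg_closure"
  assumes "y ^ CARD('e) = y"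
  obtains x where "y = to_ac x"
proof -
  let ?p = "monom 1 CARD('e) - [:0, 1:] :: 'e alg_closure poly"
  have Q: "CARD('e) > 1" by (rule CARD_field_gt_1)
  have "degree ?p = CARD('e)"
    using degree_add_eq_left[of "- [:0, 1:]" "monom 1 CARD('e) :: 'e alg_closure poly"] Q
    by (simp add: degree_monom_eq del: minus_pCons)
  hence p0: "?p \<noteq> 0" and deg: "degree ?p \<le> CARD('e)" using Q by auto
  have roots: "poly ?p z = z ^ CARD('e) - z" for z by (simp add: poly_monom)
  have sub: "range to_ac \<subseteq> {z. poly ?p z = 0}"
  proof
    fix z :: "'e alg_closure" assume "z \<in> range to_ac"
    then obtain x where "z = to_ac x" by blast
    hence "z ^ CARD('e) = to_ac (x ^ CARD('e))" by simp
    hence "z ^ CARD('e) = z" using \<open>z = to_ac x\<close> by (simp only: finite_field_power_card_eq_same)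
    thus "z \<in> {z. poly ?p z = 0}" unfolding mem_Collect_eq roots by simp
  qed
  have fin: "finite {z. poly ?p z = 0}" by (rule poly_roots_finite[OF p0])
  have "card {z. poly ?p z = 0} \<le> CARD('e)"
    using card_poly_roots_bound[OF p0] deg by linarith
  also have "\<dots> = card (range (to_ac :: 'e \<Rightarrow> _))" by (simp add: card_image inj_to_ac)
  finally have "range to_ac = {z. poly ?p z = 0}" using card_seteq[OF fin sub] by simp
  moreover have "y \<in> {z. poly ?p z = 0}" unfolding mem_Collect_eq roots using assms by simp
  ultimately have "y \<in> range to_ac" by simp
  thus ?thesis using that by auto
qed


text \<open>An integral lift \<open>m\<close> of the minimal polynomial of \<open>g\<close> over the prime field: the integer polynomials
that vanish at \<open>g\<close> form the ideal generated by \<open>m\<close> and the characteristic. Working over the integers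
makes it possible to evaluate the same polynomial in two different fields.\<close>

lemma ex_monic_int_poly_min:
  fixes g :: "'f::finite_field"
  defines "ev \<equiv> (\<lambda>k. poly (map_poly of_int k) g)"
  shows "\<exists>m. lead_coeff m = 1 \<and> ev m = 0 \<and>
    (\<forall>k. ev k = 0 \<longrightarrow> (\<exists>s r. k = m * s + r \<and> map_poly of_int r = (0 :: 'f poly)))"
proof -
  interpret h: map_poly_comm_ring_hom "of_int :: int \<Rightarrow> 'f" ..
  define P where "P = (\<lambda>k :: int poly. ev k = 0 \<and> map_poly of_int k \<noteq> (0 :: 'f poly))"
  have of_int_0: "(of_int c = (0 :: 'f)) \<longleftrightarrow> int CHAR('f) dvd c" for c
    by (rule of_int_eq_0_iff_char_dvd)
  have "P (monom 1 CARD('f) - monom 1 1)"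
  proof -
    have "coeff (monom 1 CARD('f) - monom 1 1 :: 'f poly) 1 \<noteq> 0"
      using CARD_field_gt_1[where ?'e = 'f] by simp
    hence "(monom 1 CARD('f) - monom 1 1 :: 'f poly) \<noteq> 0" by (metis coeff_0)
    thus ?thesis
      by (simp add: P_def ev_def hom_distribs poly_monom finite_field_power_card_eq_same)
  qed
  then obtain f where f: "P f" and min: "\<And>k. P k \<Longrightarrow> degree f \<le> degree k"
    using ex_has_least_nat[of P _ degree] by blast
  define d where "d = degree f"
  define c where "c = lead_coeff f"
  define f' where "f' = f - monom c d"
  have f_eq: "f = monom c d + f'" by (simp add: f'_def)
  have deg_f': "degree f' < d \<or> f' = 0"
  proof (cases "d = 0")
    case True
    thus ?thesis using degree_0_id[of f] by (simp add: f'_def c_def d_def monom_0)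
  next
    case False
    have "coeff f' i = 0" if "i \<ge> d" for i
      using that by (auto simp: f'_def c_def d_def coeff_eq_0)
    hence "degree f' \<le> d - 1" using False by (intro degree_le) auto
    thus ?thesis using False by auto
  qed
  have c: "\<not> int CHAR('f) dvd c"
  proof
    assume "int CHAR('f) dvd c"
    hence "map_poly of_int f = (map_poly of_int f' :: 'f poly)"
      using of_int_0[of c] by (simp add: f_eq hom_distribs)
    hence "P f'" using f by (simp add: P_def ev_def)
    hence "f' \<noteq> 0" "d \<le> degree f'" using min[of f'] by (auto simp: P_def d_def)
    thus False using deg_f' by auto
  qed
  have "coprime (int CHAR('f)) c"
    using c by (intro prime_imp_coprime) auto
  then obtain c' where c': "[c * c' = 1] (mod int CHAR('f))"
    using cong_solve_coprime_int[of c "int CHAR('f)"] by (auto simp: coprime_commute)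
  \<comment> \<open>replace the leading coefficient, which is invertible modulo the characteristic, by 1\<close>
  define m where "m = monom 1 d + smult c' f'"
  have of_cc': "of_int c' * of_int c = (1 :: 'f)"
  proof -
    have "of_int (c * c' - 1) = (0 :: 'f)" unfolding of_int_0 using c' by (simp add: cong_iff_dvd_diff)
    thus ?thesis by (simp add: mult.commute)
  qed
  have deg_sm: "degree (smult c' f') < d \<or> smult c' f' = 0"
    using deg_f' degree_smult_le[of c' f'] by auto
  have deg_m: "degree m = d \<and> lead_coeff m = 1"
  proof (cases "smult c' f' = 0")
    case False
    hence "degree (smult c' f') < degree (monom (1::int) d)" using deg_sm by (simp add: degree_monom_eq)
    hence "degree m = d" by (simp add: m_def degree_add_eq_left degree_monom_eq)
    moreover have "coeff (smult c' f') d = 0" using deg_sm False by (intro coeff_eq_0) auto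
    ultimately show ?thesis by (simp add: m_def)
  next
    case True
    thus ?thesis unfolding m_def True by (simp add: degree_monom_eq)
  qed
  have map_m: "map_poly of_int m = (smult (of_int c') (map_poly of_int f) :: 'f poly)"
    by (simp add: m_def f_eq hom_distribs smult_add_right smult_monom of_cc')
  have ev_m: "ev m = 0" using f by (simp add: ev_def map_m P_def)
  show ?thesis
  proof (rule exI[of _ m], intro conjI allI impI)
    fix k assume k: "ev k = 0"
    obtain s r where sr: "pseudo_divmod k m = (s, r)" by (cases "pseudo_divmod k m")
    have m0: "m \<noteq> 0" using deg_m by auto
    have k_eq: "k = m * s + r" using pseudo_divmod(1)[OF m0 sr] conjunct2[OF deg_m] by (simp only: power_one smult_1_left)
    have "ev r = 0" using k ev_m by (simp add: k_eq ev_def hom_distribs)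
    moreover have "\<not> P r"
    proof
      assume "P r"
      hence "r \<noteq> 0" "d \<le> degree r" using min[of r] by (auto simp: P_def d_def)
      thus False using pseudo_divmod(2)[OF m0 sr] deg_m by auto
    qed
    ultimately show "\<exists>s r. k = m * s + r \<and> map_poly of_int r = (0 :: 'f poly)"
      using k_eq by (auto simp: P_def)
  qed (use deg_m ev_m in auto)
qed

text \<open>A primitive element \<open>g\<close> of the small field is a root of \<open>m\<close> and of \<open>X^q - X\<close>. Any root \<open>y\<close> of \<open>m\<close> in
the closure of the large field satisfies every integral relation that \<open>g\<close> satisfies; in particular
\<open>y^q = y\<close>, so that \<open>y\<close> lies in the large field, and \<open>k(g) \<mapsto> k(y)\<close> is well defined on integer
polynomials \<open>k\<close>.\<close>

lemma finite_field_embedding: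
  assumes "CHAR('e::finite_field) = CHAR('f::finite_field)" "CARD('e) = CARD('f) ^ k"
  obtains \<iota> :: "'f::finite_field \<Rightarrow> 'e::finite_field" where "field_hom \<iota>"
proof -
  interpret hf: map_poly_comm_ring_hom "of_int :: int \<Rightarrow> 'f" ..
  interpret he: map_poly_comm_ring_hom "of_int :: int \<Rightarrow> 'e" ..
  interpret ha: map_poly_comm_ring_hom "of_int :: int \<Rightarrow> 'e alg_closure" ..
  let ?q = "CARD('f)"
  obtain g :: 'f where g: "g \<noteq> 0" "\<forall>x. x \<noteq> 0 \<longrightarrow> (\<exists>n. x = g ^ n)"
    using field_mult_generator[where ?'f = 'f] by (elim exE conjE)
  define ev where "ev = (\<lambda>k. poly (map_poly of_int k) g)"
  obtain m :: "int poly" where m: "lead_coeff m = 1" "ev m = 0"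
    "\<forall>k. ev k = 0 \<longrightarrow> (\<exists>s r. k = m * s + r \<and> map_poly of_int r = (0 :: 'f poly))"
    using ex_monic_int_poly_min[of g] unfolding ev_def by (elim exE conjE)
  have map_0: "map_poly of_int r = (0 :: 'e alg_closure poly)" if "map_poly of_int r = (0 :: 'f poly)" for r
  proof (rule poly_eqI)
    fix i
    have "of_int (coeff r i) = (0 :: 'f)" using arg_cong[OF that, of "\<lambda>p. coeff p i"] by simp
    thus "coeff (map_poly of_int r) i = coeff (0 :: 'e alg_closure poly) i"
      using assms(1) by (simp add: of_int_eq_0_iff_char_dvd)
  qed
  let ?m = "map_poly of_int m :: 'e alg_closure poly"
  have deg_m: "degree m > 0"
  proof (rule ccontr)
    assume "\<not> degree m > 0"
    hence "m = 1" using m(1) by (metis degree_0_id gr0I one_pCons)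
    thus False using m(2) by (simp add: ev_def)
  qed
  have "coeff ?m (degree m) = 1" using m(1) by simp
  hence "degree ?m > 0" using deg_m le_degree[of ?m "degree m"] by simp
  then obtain y where y: "poly ?m y = 0" using alg_closed_imp_poly_has_root by blast
  have kill: "poly (map_poly of_int k) y = 0" if "ev k = 0" for k
  proof -
    obtain s r where "k = m * s + r" "map_poly of_int r = (0 :: 'f poly)" using m(3)[rule_format, OF \<open>ev k = 0\<close>] by (elim exE conjE)
    thus ?thesis using map_0[of r] y by (simp add: hom_distribs)
  qed
  have "ev (monom 1 ?q - monom 1 1) = 0"
    by (simp add: ev_def hom_distribs poly_monom finite_field_power_card_eq_same)
  from kill[OF this] have yq: "y ^ ?q = y" by (simp add: hom_distribs poly_monom)
  have "y ^ (?q ^ k) = y" by (induction k) (simp_all add: power_mult yq mult.commute[of ?q])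
  then obtain h where h: "y = to_ac h" using to_ac_surj[of y] assms(2) by metis
  define ew where "ew = (\<lambda>k. poly (map_poly of_int k) h)"
  have ew: "to_ac (ew k) = poly (map_poly of_int k) y" for k
    by (induction k) (auto simp: ew_def h)
  have kill': "ew k = ew k'" if "ev k = ev k'" for k k'
  proof -
    have "ev (k - k') = 0" using that by (simp add: ev_def hom_distribs)
    from kill[OF this] have "to_ac (ew k) = to_ac (ew k')" by (simp add: ew hom_distribs)
    thus ?thesis by simp
  qed
  have "\<exists>k. ev k = x" for x
  proof (cases "x = 0")
    case True thus ?thesis by (intro exI[of _ 0]) (simp add: ev_def)
  next
    case False
    then obtain n where "x = g ^ n" using g by blast
    thus ?thesis by (intro exI[of _ "monom 1 n"]) (simp add: ev_def poly_monom)
  qed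
  then obtain rep where rep: "\<And>x. ev (rep x) = x" by metis
  define \<iota> where "\<iota> = (\<lambda>x. ew (rep x))"
  have \<iota>_ev: "\<iota> (ev k) = ew k" for k unfolding \<iota>_def by (rule kill') (simp add: rep)
  have "\<iota> (x + y) = \<iota> x + \<iota> y" for x y
    using \<iota>_ev[of "rep x + rep y"] by (simp add: ev_def[THEN fun_cong] ew_def \<iota>_def hom_distribs rep[unfolded ev_def])
  moreover have "\<iota> (x * y) = \<iota> x * \<iota> y" for x y
    using \<iota>_ev[of "rep x * rep y"] by (simp add: ev_def[THEN fun_cong] ew_def \<iota>_def hom_distribs rep[unfolded ev_def])
  moreover have "\<iota> 1 = 1" using \<iota>_ev[of 1] by (simp add: ev_def ew_def)
  moreover have "\<iota> 0 = 0" using \<iota>_ev[of 0] by (simp add: ev_def ew_def)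
  ultimately have "field_hom \<iota>"
    by unfold_locales (auto simp: ) 
  thus ?thesis by (rule that)
qed

section \<open>Traces of sixteenth roots of unity\<close>

lemma mod_16_of_mod_8: "(x :: nat) mod 16 = x mod 8 \<or> x mod 16 = x mod 8 + 8"
proof -
  have "x mod (8 * 2) = 8 * (x div 8 mod 2) + x mod 8" by (rule mod_mult2_eq)
  moreover have "x div 8 mod 2 = 0 \<or> x div 8 mod 2 = 1" by auto
  ultimately show ?thesis by auto
qed

lemma power_mod_16:
  fixes z :: "'a::comm_ring_1"
  assumes "z ^ 8 = -1" shows "z ^ n = z ^ (n mod 16)"
proof -
  have "z ^ 16 = (z ^ 8) ^ 2" by (simp flip: power_mult)
  hence z16: "z ^ 16 = 1" using assms by simp
  have "z ^ n = z ^ (16 * (n div 16) + n mod 16)" by simp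
  also have "\<dots> = z ^ (n mod 16)" by (simp only: power_add power_mult z16 power_one mult_1)
  finally show ?thesis .
qed

text \<open>The quartic equation of \<open>t = z + z^7\<close> for an element \<open>z\<close> with \<open>z^8 = -1\<close>, the expression of its
conjugate \<open>z^3 + z^5\<close> in terms of \<open>t\<close>, and the square root of 2 obtained from \<open>z^2\<close>.\<close>

lemma trace_relation:
  fixes z :: "'a::comm_ring_1"
  assumes z: "z ^ 8 = -1"
  shows "(z + z ^ 7) ^ 4 + 4 * (z + z ^ 7)\<^sup>2 + 2 = 0"
    and "(z + z ^ 7) ^ 3 + 3 * (z + z ^ 7) = z ^ 3 + z ^ 5"
    and "(z\<^sup>2 + z ^ 14)\<^sup>2 = 2"
proof -
  have red: "z ^ (8 + n) = - (z ^ n)" for n by (simp add: power_add z)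
  have red': "z ^ 14 = - (z ^ 6)" "z ^ 12 = - (z ^ 4)" "z ^ 9 = - z" "z ^ 13 = - (z ^ 5)"
    using red[of 6] red[of 4] red[of 1] red[of 5] by simp_all
  have "(z + z ^ 7)\<^sup>2 = z ^ 2 + 2 * z ^ 8 + z ^ 14" by (simp add: numeral_eq_Suc algebra_simps)
  hence sq: "(z + z ^ 7)\<^sup>2 = z ^ 2 - 2 - z ^ 6" unfolding red' by (simp add: z)
  have "(z ^ 2 - z ^ 6)\<^sup>2 = z ^ 4 - 2 * z ^ 8 + z ^ 12" by (simp add: numeral_eq_Suc algebra_simps)
  hence s: "(z ^ 2 - z ^ 6)\<^sup>2 = 2" unfolding red' by (simp add: z)
  have "t ^ 4 + 4 * t\<^sup>2 + 2 = (t\<^sup>2 + 2)\<^sup>2 - 2" "t ^ 3 + 3 * t = t * (t\<^sup>2 + 3)" for t :: 'a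
    by (simp_all add: numeral_eq_Suc algebra_simps)
  note id = this[of "z + z ^ 7"]
  have "(z + z ^ 7) ^ 4 + 4 * (z + z ^ 7)\<^sup>2 + 2 = ((z + z ^ 7)\<^sup>2 + 2)\<^sup>2 - 2" by (rule id)
  also have "\<dots> = 0" unfolding sq using s by simp
  finally show "(z + z ^ 7) ^ 4 + 4 * (z + z ^ 7)\<^sup>2 + 2 = 0" .
  have "(z + z ^ 7) ^ 3 + 3 * (z + z ^ 7) = (z + z ^ 7) * ((z + z ^ 7)\<^sup>2 + 3)" by (rule id)
  also have "\<dots> = z + z ^ 3 + z ^ 7 + (z ^ 9 - z ^ 7 - z ^ 13)" unfolding sq by (simp add: numeral_eq_Suc algebra_simps)
  also have "\<dots> = z ^ 3 + z ^ 5" unfolding red' by simp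
  finally show "(z + z ^ 7) ^ 3 + 3 * (z + z ^ 7) = z ^ 3 + z ^ 5" .
  show "(z\<^sup>2 + z ^ 14)\<^sup>2 = 2" unfolding red' using s by simp
qed

lemma frobenius_add:
  assumes "CHAR('e::finite_field) = p" "Q = p ^ n"
  shows "(x + y :: 'e) ^ Q = x ^ Q + y ^ Q" "(u + v :: 'e alg_closure) ^ Q = u ^ Q + v ^ Q"
proof -
  have p: "prime CHAR('e)" by simp
  show "(x + y :: 'e) ^ Q = x ^ Q + y ^ Q"
    by (rule freshmans_dream'[of Q n]) (use p assms in auto)
  show "(u + v :: 'e alg_closure) ^ Q = u ^ Q + v ^ Q"
    by (rule freshmans_dream'[of Q n]) (use p assms in auto)
qed

lemma trace_power:
  fixes z :: "'e::finite_field alg_closure"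
  assumes z: "z ^ 8 = -1" and p: "CHAR('e) = p" "Q = p ^ n"
  shows "(z ^ i + z ^ j) ^ Q = z ^ ((i * Q) mod 16) + z ^ ((j * Q) mod 16)"
  unfolding frobenius_add(2)[OF p] power_mult[symmetric]
  by (subst (1 2) power_mod_16[OF z]) (rule HOL.refl)

lemma ex_primitive_16th_root: "\<exists>z :: 'e::field alg_closure. z ^ 8 = -1"
  by (rule nth_root_exists) simp

text \<open>In the closure, \<open>t = z + z^7\<close> satisfies \<open>t^Q = z^Q + z^(7 Q)\<close>, which is \<open>t\<close> again when \<open>Q\<close> is
congruent to 1 or 7, as 49 is congruent to 1.\<close>

lemma ex_trace16:
  assumes "prime p" "CARD('e::finite_field) = p ^ n" "p ^ n mod 16 \<in> {1, 7}"
  shows "\<exists>t :: 'e. t ^ 4 + 4 * t\<^sup>2 + 2 = 0"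
proof -
  obtain z :: "'e alg_closure" where z: "z ^ 8 = -1" using ex_primitive_16th_root by metis
  note p = CHAR_eq_prime[OF assms(1,2)] assms(2)
  define m where "m = CARD('e) mod 16"
  have m: "m \<in> {1, 7}" using assms(2,3) by (simp add: m_def)
  have c: "(1 * CARD('e)) mod 16 = m" "(7 * CARD('e)) mod 16 = (7 * m) mod 16"
    by (simp_all add: m_def mod_mult_right_eq)
  have "(z ^ 1 + z ^ 7) ^ CARD('e) = z ^ 1 + z ^ 7"
    unfolding trace_power[OF z p] c using m by (auto simp: add.commute simp del: One_nat_def)
  then obtain t where t: "z + z ^ 7 = to_ac t" using to_ac_surj[of "z ^ 1 + z ^ 7"] by auto
  have "to_ac (t ^ 4 + 4 * t\<^sup>2 + 2) = 0" using trace_relation(1)[OF z] by (simp add: t)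
  thus ?thesis by (intro exI[of _ t]) (simp only: to_ac_eq_0_iff)
qed

text \<open>The square root \<open>z^2 + z^14\<close> of 2 is fixed by the \<open>Q\<close>-th power map if \<open>Q\<close> is congruent to 1 or \<open>-1\<close>
modulo 8, because \<open>z^2\<close> is a primitive 8th root of unity with inverse \<open>z^14\<close>.\<close>

lemma ex_sqrt2:
  assumes "prime p" "CARD('e::finite_field) = p ^ n" "p ^ n mod 8 \<in> {1, 7}"
  shows "\<exists>s :: 'e. s\<^sup>2 = 2"
proof -
  obtain z :: "'e alg_closure" where z: "z ^ 8 = -1" using ex_primitive_16th_root by metis
  note p = CHAR_eq_prime[OF assms(1,2)] assms(2)
  define m where "m = CARD('e) mod 16"
  have m: "m \<in> {1, 7, 9, 15}"
    using assms(3) mod_16_of_mod_8[of "p ^ n"] unfolding m_def assms(2) by auto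
  have c: "(2 * CARD('e)) mod 16 = (2 * m) mod 16" "(14 * CARD('e)) mod 16 = (14 * m) mod 16"
    by (simp_all add: m_def mod_mult_right_eq)
  have "(z ^ 2 + z ^ 14) ^ CARD('e) = z ^ 2 + z ^ 14"
    unfolding trace_power[OF z p] c using m by (auto simp: add.commute simp del: One_nat_def)
  then obtain s where s: "z ^ 2 + z ^ 14 = to_ac s" using to_ac_surj[of "z ^ 2 + z ^ 14"] by auto
  have "to_ac (s\<^sup>2) = to_ac 2" using trace_relation(3)[OF z] by (simp add: s)
  thus ?thesis by (intro exI[of _ s]) (simp only: to_ac_eq_iff)
qed

text \<open>A root \<open>z\<close> of \<open>X^2 - t X - 1\<close> has \<open>t z = z^2 - 1\<close>; multiplying the equation of \<open>t\<close> by \<open>z^4\<close> turns it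
into \<open>z^8 + 1 = 0\<close>.\<close>

lemma trace16_root:
  fixes t :: "'e::finite_field"
  assumes t: "t ^ 4 + 4 * t\<^sup>2 + 2 = 0"
  obtains z :: "'e alg_closure" where "z ^ 8 = -1" "to_ac t = z + z ^ 7"
proof -
  let ?t = "to_ac t"
  have "degree [:-1, -?t, 1:] > 0" by simp
  then obtain z where "poly [:-1, -?t, 1:] z = 0" using alg_closed_imp_poly_has_root by blast
  hence z: "z * (z - ?t) = 1" by (simp add: algebra_simps)
  have "to_ac (t ^ 4 + 4 * t\<^sup>2 + 2) = 0" by (simp only: t to_ac_0)
  hence t': "?t ^ 4 + 4 * ?t\<^sup>2 + 2 = 0" by simp
  have tz: "?t * z = z\<^sup>2 - 1" using z by (simp add: algebra_simps power2_eq_square)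
  have "z ^ 8 + 1 = (z\<^sup>2 - 1) ^ 4 + 4 * (z\<^sup>2 - 1)\<^sup>2 * z\<^sup>2 + 2 * z ^ 4"
    by (simp add: numeral_eq_Suc algebra_simps)
  also have "\<dots> = (?t ^ 4 + 4 * ?t\<^sup>2 + 2) * z ^ 4" unfolding tz[symmetric] by (simp add: numeral_eq_Suc algebra_simps)
  finally have "z ^ 8 + 1 = 0" unfolding t' by simp
  hence z8: "z ^ 8 = -1" by (rule eq_neg_iff_add_eq_0[THEN iffD2])
  have "z \<noteq> 0" using z8 by auto
  \<comment> \<open>\<open>z^7\<close> is the second root, since the product of the roots is \<open>-1 = z^8\<close>\<close>
  have "z * (z ^ 7) = z * (?t - z)" using z z8 by (simp add: algebra_simps flip: power_Suc)
  hence "?t = z + z ^ 7" using \<open>z \<noteq> 0\<close> by simp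
  with z8 that show ?thesis by blast
qed

text \<open>The \<open>Q\<close>-th power map acts on \<open>t = z + z^7\<close> through the exponents of \<open>z\<close> modulo 16, with
\<open>z^(8 + k) = - z^k\<close>. This is what distinguishes the residue classes of the theorem.\<close>

lemma trace16_frobenius:
  fixes t :: "'e::finite_field"
  assumes t: "t ^ 4 + 4 * t\<^sup>2 + 2 = 0" and p: "CHAR('e) = p" "Q = p ^ n"
  shows "Q mod 16 \<in> {9, 15} \<Longrightarrow> t ^ Q = - t"
    and "Q mod 16 \<in> {3, 5} \<Longrightarrow> t ^ Q = t ^ 3 + 3 * t"
    and "Q mod 16 \<in> {11, 13} \<Longrightarrow> t ^ Q = - (t ^ 3 + 3 * t)"
proof -
  obtain z where z: "z ^ 8 = -1" "to_ac t = z ^ 1 + z ^ 7" using trace16_root[OF t] by auto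
  have red: "z ^ (8 + n) = - (z ^ n)" for n by (simp add: power_add z)
  have m: "(7 * Q) mod 16 = (7 * (Q mod 16)) mod 16" by (simp add: mod_mult_right_eq)
  have tQ: "to_ac (t ^ Q) = z ^ (Q mod 16) + z ^ ((7 * (Q mod 16)) mod 16)"
    unfolding to_ac_power z(2) trace_power[OF z(1) p] m by simp
  have t3: "to_ac (t ^ 3 + 3 * t) = z ^ 3 + z ^ 5"
    using trace_relation(2)[OF z(1)] z(2) by simp
  have pw: "z ^ 9 = - z" "z ^ 15 = - (z ^ 7)" "z ^ 11 = - (z ^ 3)" "z ^ 13 = - (z ^ 5)"
    using red[of 1] red[of 7] red[of 3] red[of 5] by simp_all
  show "t ^ Q = - t" if "Q mod 16 \<in> {9, 15}"
  proof -
    have "to_ac (t ^ Q) = to_ac (- t)" unfolding tQ using that by (auto simp: z(2) pw)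
    thus ?thesis by (simp only: to_ac_eq_iff)
  qed
  show "t ^ Q = t ^ 3 + 3 * t" if "Q mod 16 \<in> {3, 5}"
  proof -
    have "to_ac (t ^ Q) = to_ac (t ^ 3 + 3 * t)" unfolding tQ t3 using that by auto
    thus ?thesis by (simp only: to_ac_eq_iff)
  qed
  show "t ^ Q = - (t ^ 3 + 3 * t)" if "Q mod 16 \<in> {11, 13}"
  proof -
    have "to_ac (t ^ Q) = to_ac (- (t ^ 3 + 3 * t))" unfolding tQ to_ac_minus t3 using that by (auto simp: pw)
    thus ?thesis by (simp only: to_ac_eq_iff)
  qed
qed

text \<open>If \<open>Q\<close> is congruent to 3 or 5 modulo 8, then \<open>z^2 + z^14\<close> is sent to \<open>z^6 + z^10\<close>, which is its negative.\<close>

lemma sqrt2_frobenius: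
  fixes s :: "'e::finite_field"
  assumes s: "s\<^sup>2 = 2" and p: "CHAR('e) = p" "Q = p ^ n" and Q: "Q mod 8 \<in> {3, 5}"
  shows "s ^ Q = - s"
proof -
  obtain z :: "'e alg_closure" where z: "z ^ 8 = -1" using ex_primitive_16th_root by metis
  have "to_ac (s\<^sup>2) = to_ac 2" using s by simp
  hence "(to_ac s)\<^sup>2 = (z ^ 2 + z ^ 14)\<^sup>2" using trace_relation(3)[OF z] by simp
  hence *: "to_ac s = z ^ 2 + z ^ 14 \<or> to_ac s = - (z ^ 2 + z ^ 14)" by (simp only: power2_eq_iff)
  have red: "z ^ (8 + n) = - (z ^ n)" for n by (simp add: power_add z)
  have pw: "z ^ 10 = - (z ^ 2)" "z ^ 14 = - (z ^ 6)" using red[of 2] red[of 6] by simp_all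
  have Q': "Q mod 16 \<in> {3, 5, 11, 13}" using Q mod_16_of_mod_8[of Q] by auto
  have "odd Q"
  proof
    assume "even Q"
    hence "even (Q mod 8)" by (simp add: dvd_mod_iff)
    thus False using Q by auto
  qed
  define m where "m = Q mod 16"
  have c: "(2 * Q) mod 16 = (2 * m) mod 16" "(14 * Q) mod 16 = (14 * m) mod 16"
    by (simp_all add: m_def mod_mult_right_eq)
  have "(z ^ 2 + z ^ 14) ^ Q = - (z ^ 2 + z ^ 14)"
    unfolding trace_power[OF z p] c using Q'[folded m_def] by (auto simp: pw)
  moreover define w where "w = z ^ 2 + z ^ 14"
  ultimately have w: "w ^ Q = - w" by simp
  have "to_ac (s ^ Q) = to_ac (- s)"
    using *[folded w_def] \<open>odd Q\<close> w by (elim disjE) simp_all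
  thus ?thesis by (simp only: to_ac_eq_iff)
qed

section \<open>Linear characters and two-dimensional blocks\<close>

text \<open>For \<open>e\<close> and \<open>d\<close> equal to \<open>1\<close> or \<open>-1\<close>, the linear character that sends \<open>a\<close> to \<open>e\<close> and \<open>x\<close> to \<open>d\<close>. The
augmentation is \<open>chi 1 1\<close>.\<close>

definition chi :: "'k::field \<Rightarrow> 'k \<Rightarrow> (qd_gen word set \<Rightarrow> 'k) \<Rightarrow> 'k" where
  "chi e d f = poly (qd_poly False f) e + d * poly (qd_poly True f) e"

lemma poly_cong_eval:
  assumes "[p = r] (mod m :: 'k::field poly)" "poly m e = 0" shows "poly p e = poly r e"
proof -
  obtain s where "p - r = m * s" using assms(1) by (auto simp: cong_iff_dvd_diff dvd_def)
  hence "poly (p - r) e = poly (m * s) e" by simp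
  thus ?thesis using assms(2) by simp
qed

lemma poly_twist: "poly (twist p) x = poly p (x ^ 7)"
  by (simp add: twist_def poly_pcompose poly_monom)

lemma chi_mult:
  assumes e: "e = 1 \<or> e = -1" and d: "d = 1 \<or> d = (-1 :: 'k::field)"
  shows "chi e d (f \<otimes>\<^bsub>qd_algebra TYPE('k)\<^esub> h) = chi e d f * chi e d h"
proof -
  have "poly (unity_poly 16) e = 0" using e by (auto simp: unity_poly_def poly_monom)
  note ev = poly_cong_eval[OF qd_poly_mult this]
  have e7: "e ^ 7 = e" using e by auto
  have dd: "d * d = 1" using d by auto
  show ?thesis unfolding chi_def ev using dd
    by (simp add: poly_twist e7 algebra_simps)
qed

lemma chi_one: "chi e d \<one>\<^bsub>qd_algebra TYPE('k::field)\<^esub> = 1"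
  by (simp add: chi_def qd_poly_one)

lemma map_poly_twist: "comm_ring_hom \<iota> \<Longrightarrow> map_poly \<iota> (twist p) = twist (map_poly \<iota> p)"
proof -
  assume "comm_ring_hom \<iota>"
  then interpret comm_ring_hom \<iota> .
  show ?thesis by (simp add: twist_def map_poly_pcompose)
qed

lemma poly_mod_quadratic:
  "(p :: 'e::field poly) mod [:d, - t, 1:] = [:coeff (p mod [:d, - t, 1:]) 0, coeff (p mod [:d, - t, 1:]) 1:]"
proof (rule poly_eqI)
  fix i
  let ?r = "p mod [:d, - t, 1:]"
  have "?r = 0 \<or> degree ?r < degree [:d, - t, 1:]" by (rule degree_mod_less) auto
  hence "degree ?r \<le> 1" by auto
  thus "coeff ?r i = coeff [:coeff ?r 0, coeff ?r 1:] i"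
    by (auto simp: coeff_pCons coeff_eq_0 split: nat.splits)
qed

text \<open>The hypotheses say that \<open>m = X^2 - t X + d\<close> has roots \<open>\<omega>\<close> with \<open>\<omega>^8 = d\<close> and \<open>d = \<plusminus>1\<close>, and that the
two roots are different. As their product is \<open>d\<close>, the other root is \<open>d / \<omega> = \<omega>^7\<close>, so substituting
\<open>X^7\<close> for \<open>X\<close> is an automorphism of \<open>E[X]/(m)\<close> that exchanges the roots.\<close>

locale qd_block = field_hom \<iota> for \<iota> :: "'f::field \<Rightarrow> 'e::field" +
  fixes t d :: 'e
  assumes d_sq: "d * d = 1"
    and X8: "[:d, - t, 1:] dvd monom 1 8 - [:d:]"
    and disc: "t\<^sup>2 \<noteq> 4 * d"
begin

sublocale poly_hom: map_poly_idom_hom \<iota> ..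

abbreviation "m \<equiv> [:d, - t, 1:]"

lemma X7: "[monom 1 7 = [:t, -1:]] (mod m)"
proof -
  let ?r = "monom 1 7 - [:t, -1:]"
  \<comment> \<open>\<open>X r\<close> is divisible by \<open>m\<close>, and \<open>X\<close> is invertible modulo \<open>m\<close> because \<open>X (t - X) = d\<close> there\<close>
  have "[:0, 1:] * ?r = (monom 1 8 - [:d:]) + m"
    by (simp add: monom_altdef numeral_eq_Suc)
  hence "m dvd [:0, 1:] * ?r" using X8 by simp
  hence "m dvd [:- t, 1:] * ([:0, 1:] * ?r)" by (rule dvd_mult)
  with dvd_triv_left have "m dvd m * ?r - [:- t, 1:] * ([:0, 1:] * ?r)" by (rule dvd_diff)
  also have "m * ?r - [:- t, 1:] * ([:0, 1:] * ?r) = (m - [:- t, 1:] * [:0, 1:]) * ?r"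
    by (simp only: left_diff_distrib mult.assoc)
  also have "m - [:- t, 1:] * [:0, 1:] = [:d:]" by simp
  finally have "m dvd smult d ?r" by simp
  hence "m dvd ?r" using d_sq by (subst (asm) dvd_smult_iff) auto
  thus ?thesis by (simp add: cong_iff_dvd_diff)
qed

lemma dvd_unity_poly_16: "m dvd unity_poly 16"
proof -
  have "unity_poly 16 = (monom 1 8 - [:d:]) * (monom 1 8 + [:d:])"
    using d_sq by (simp add: unity_poly_def algebra_simps mult_monom one_pCons)
  thus ?thesis using X8 by simp
qed

lemma cong_mod_m: "[p = r] (mod unity_poly 16) \<Longrightarrow> [p = r] (mod m)"
  using dvd_unity_poly_16 by (meson cong_dvd_modulus)

lemma twist_cong_m: "[p = r] (mod m) \<Longrightarrow> [twist p = twist r] (mod m)"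
proof -
  assume "[p = r] (mod m)"
  then obtain s where s: "p - r = m * s" by (auto simp: cong_iff_dvd_diff dvd_def)
  have "twist m = monom 1 7 * monom 1 7 - smult t (monom 1 7) + [:d:]"
    by (simp add: twist_def pcompose_pCons mult_monom algebra_simps)
  moreover have "[monom 1 7 * monom 1 7 - smult t (monom 1 7) + [:d:]
      = [:t, -1:] * [:t, -1:] - smult t [:t, -1:] + [:d:]] (mod m)"
    using cong_mult[OF cong_refl[of "[:t:]"] X7]
    by (intro cong_add cong_diff cong_mult X7 cong_refl) simp
  moreover have "[:t, -1:] * [:t, -1:] - smult t [:t, -1:] + [:d:] = m"
    by simp
  ultimately have "m dvd twist m" by (metis cong_0_iff cong_trans cong_iff_dvd_diff diff_0_right dvd_refl cong_dvd_iff)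
  hence "m dvd twist m * twist s" by (rule dvd_mult2)
  moreover have "twist p - twist r = twist m * twist s"
    by (simp only: twist_simps(4)[symmetric] s twist_simps(5))
  ultimately show ?thesis by (simp only: cong_iff_dvd_diff)
qed

definition lift_poly :: "bool \<Rightarrow> (qd_gen word set \<Rightarrow> 'f) \<Rightarrow> 'e poly" where
  "lift_poly b f = map_poly \<iota> (qd_poly b f)"

text \<open>The element \<open>u(a) + v(a) x\<close> acts on \<open>E[X]/(m)\<close> by the \<open>E\<close>-linear map \<open>h \<mapsto> u h + v \<sigma>(h)\<close>. Its value at
\<open>X^s\<close>, for \<open>s = 0\<close> and \<open>s = 1\<close>, is a column of the matrix of this map.\<close>

definition column :: "nat \<Rightarrow> (qd_gen word set \<Rightarrow> 'f) \<Rightarrow> 'e poly" where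
  "column s f = lift_poly False f * monom 1 s + lift_poly True f * monom 1 (7 * s)"

definition block :: "(qd_gen word set \<Rightarrow> 'f) \<Rightarrow> 'e mat" where
  "block f = mat 2 2 (\<lambda>(r, s). coeff (column s f mod m) r)"

lemma lift_poly_mult:
  "[lift_poly b (f \<otimes>\<^bsub>qd_algebra TYPE('f)\<^esub> h)
    = lift_poly False f * lift_poly b h + lift_poly True f * twist (lift_poly (\<not> b) h)] (mod unity_poly 16)"
proof -
  obtain s where s: "qd_poly b (f \<otimes>\<^bsub>qd_algebra TYPE('f)\<^esub> h) - (qd_poly False f * qd_poly b h +
      qd_poly True f * twist (qd_poly (\<not> b) h)) = unity_poly 16 * s"
    using qd_poly_mult[of b f h] by (auto simp: cong_iff_dvd_diff dvd_def)
  have "map_poly \<iota> (unity_poly 16) = unity_poly 16" by (simp add: unity_poly_def hom_distribs)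
  thus ?thesis
    using arg_cong[OF s, of "map_poly \<iota>"]
    by (simp add: hom_distribs cong_iff_dvd_diff lift_poly_def map_poly_twist[OF comm_ring_hom_axioms])
qed

lemma column_mult:
  "[column s (f \<otimes>\<^bsub>qd_algebra TYPE('f)\<^esub> h)
    = lift_poly False f * column s h + lift_poly True f * twist (column s h)] (mod unity_poly 16)"
proof -
  let ?U = "lift_poly False" and ?V = "lift_poly True"
  have s: "[monom 1 s = monom 1 (7 * (7 * s)) :: 'e poly] (mod unity_poly 16)"
  proof (rule cong_monom)
    have "7 * (7 * s) = s + 16 * (3 * s)" by simp
    thus "s mod 16 = 7 * (7 * s) mod 16" by (simp only: mod_mult_self2)
  qed
  have A: "[column s (f \<otimes>\<^bsub>qd_algebra TYPE('f)\<^esub> h)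
    = (?U f * ?U h + ?V f * twist (?V h)) * monom 1 s
      + (?U f * ?V h + ?V f * twist (?U h)) * monom 1 (7 * s)] (mod unity_poly 16)"
    unfolding column_def using lift_poly_mult[of False f h] lift_poly_mult[of True f h]
    by (intro cong_add cong_mult cong_refl) auto
  have B: "(?U f * ?U h + ?V f * twist (?V h)) * monom 1 s
      + (?U f * ?V h + ?V f * twist (?U h)) * monom 1 (7 * s)
      = ?U f * column s h + ?V f * (twist (?U h) * monom 1 (7 * s) + twist (?V h) * monom 1 s)"
    by (simp add: column_def algebra_simps)
  have C: "[?U f * column s h + ?V f * (twist (?U h) * monom 1 (7 * s) + twist (?V h) * monom 1 s)
      = ?U f * column s h + ?V f * (twist (?U h) * monom 1 (7 * s) + twist (?V h) * monom 1 (7 * (7 * s)))] (mod unity_poly 16)"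
    using s by (intro cong_add cong_mult cong_refl)
  have D: "twist (?U h) * monom 1 (7 * s) + twist (?V h) * monom 1 (7 * (7 * s)) = twist (column s h)"
    by (simp add: column_def)
  from cong_trans[OF A[unfolded B] C] show ?thesis unfolding D .
qed

text \<open>A column of the product is \<open>f\<close> applied to the same column of \<open>h\<close>, and \<open>f\<close> acts linearly.\<close>

lemma column_mod_m:
  assumes "column s h mod m = [:h0, h1:]"
  shows "column s (f \<otimes>\<^bsub>qd_algebra TYPE('f)\<^esub> h) mod m
       = smult h0 (column 0 f mod m) + smult h1 (column 1 f mod m)"
proof -
  have h: "[column s h = [:h0, h1:]] (mod m)" using assms by (metis cong_mod_right cong_refl)
  have A: "[column s (f \<otimes>\<^bsub>qd_algebra TYPE('f)\<^esub> h)
      = lift_poly False f * column s h + lift_poly True f * twist (column s h)] (mod m)"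
    by (rule cong_mod_m[OF column_mult])
  have B: "[lift_poly False f * column s h + lift_poly True f * twist (column s h)
      = lift_poly False f * [:h0, h1:] + lift_poly True f * twist [:h0, h1:]] (mod m)"
    by (intro cong_add cong_mult cong_refl h twist_cong_m)
  have C: "lift_poly False f * [:h0, h1:] + lift_poly True f * twist [:h0, h1:]
      = smult h0 (column 0 f) + smult h1 (column 1 f)"
  proof -
    have 1: "[:h0, h1:] = smult h0 1 + smult h1 (monom 1 1)" by (simp add: monom_altdef)
    have 2: "twist [:h0, h1:] = smult h0 1 + smult h1 (monom 1 7)"
      by (simp add: twist_def pcompose_pCons mult.commute)
    show ?thesis unfolding 2 unfolding 1 column_def by (simp add: algebra_simps smult_add_right)
  qed
  have "[column s (f \<otimes>\<^bsub>qd_algebra TYPE('f)\<^esub> h) = smult h0 (column 0 f) + smult h1 (column 1 f)] (mod m)"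
    using cong_trans[OF A B] unfolding C .
  thus ?thesis by (simp add: cong_def poly_mod_add_left mod_smult_left)
qed

lemma block_carrier [simp]: "block f \<in> carrier_mat 2 2" by (simp add: block_def)

lemma block_mult: "block (f \<otimes>\<^bsub>qd_algebra TYPE('f)\<^esub> h) = block f * block h"
proof (rule eq_matI)
  fix r s assume "r < dim_row (block f * block h)" "s < dim_col (block f * block h)"
  hence rs: "r < 2" "s < 2" by (auto simp: block_def)
  show "block (f \<otimes>\<^bsub>qd_algebra TYPE('f)\<^esub> h) $$ (r, s) = (block f * block h) $$ (r, s)"
    using rs column_mod_m[OF poly_mod_quadratic, of s f h]
    by (simp add: block_def scalar_prod_def numeral_2_eq_2 mult.commute)
qed (auto simp: block_def)

lemma block_one: "block \<one>\<^bsub>qd_algebra TYPE('f)\<^esub> = 1\<^sub>m 2"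
proof (rule eq_matI)
  fix r s assume "r < dim_row (1\<^sub>m 2 :: 'e mat)" "s < dim_col (1\<^sub>m 2 :: 'e mat)"
  hence rs: "r < 2" "s < 2" by auto
  have "degree (monom 1 s :: 'e poly) < degree m" using rs by (simp add: degree_monom_eq)
  hence "(monom 1 s :: 'e poly) mod m = monom 1 s" by (rule mod_poly_less)
  thus "block \<one>\<^bsub>qd_algebra TYPE('f)\<^esub> $$ (r, s) = 1\<^sub>m 2 $$ (r, s)"
    using rs by (simp add: block_def column_def lift_poly_def qd_poly_one)
qed (auto simp: block_def)

lemma block_eq_imp_dvd:
  assumes "block f = block h"
  shows "m dvd map_poly \<iota> (qd_poly b f - qd_poly b h)"
proof -
  have mod_eq: "column s f mod m = column s h mod m" if "s < 2" for s
  proof -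
    have "coeff (column s f mod m) r = coeff (column s h mod m) r" if "r < 2" for r
      using arg_cong[OF assms, of "\<lambda>M. M $$ (r, s)"] \<open>r < 2\<close> \<open>s < 2\<close> by (simp add: block_def)
    from this[of 0] this[of 1] show ?thesis
      by (subst poly_mod_quadratic[of "column s f"], subst poly_mod_quadratic[of "column s h"]) simp
  qed
  define D where "D = (\<lambda>b. lift_poly b f - lift_poly b h)"
  have col: "m dvd D False * monom 1 s + D True * monom 1 (7 * s)" if "s < 2" for s
  proof -
    have "m dvd column s f - column s h" using mod_eq[OF that] by (simp add: mod_eq_dvd_iff)
    thus ?thesis by (simp add: column_def D_def algebra_simps)
  qed
  have 0: "m dvd D False + D True" using col[of 0] by simp
  have 1: "m dvd D False * monom 1 1 + D True * monom 1 7" using col[of 1] by simp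
  have "m dvd (D False * monom 1 1 + D True * monom 1 7) - (D False + D True) * monom 1 1"
    by (intro dvd_diff 1 dvd_mult2 0)
  hence "m dvd D True * (monom 1 7 - monom 1 1)" by (simp add: algebra_simps)
  moreover have "m dvd D True * (monom 1 7 - [:t, -1:])"
    using X7 by (intro dvd_mult) (simp add: cong_iff_dvd_diff)
  ultimately have "m dvd D True * (monom 1 7 - monom 1 1) - D True * (monom 1 7 - [:t, -1:])"
    by (rule dvd_diff)
  also have "D True * (monom 1 7 - monom 1 1) - D True * (monom 1 7 - [:t, -1:]) = D True * ([:t, -1:] - monom 1 1)"
    by (simp add: algebra_simps)
  also have "[:t, -1:] - monom 1 1 = [:t, -2:]" by (simp add: monom_altdef)
  finally have "m dvd D True * [:t, -2:]" .
  \<comment> \<open>\<open>t - 2 X\<close> is the difference of the two roots; its square is the discriminant modulo \<open>m\<close>\<close>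
  hence "m dvd D True * [:t, -2:] * [:t, -2:]" by (rule dvd_mult2)
  hence "m dvd D True * [:t, -2:] * [:t, -2:] - m * (smult 4 (D True))"
    by (rule dvd_diff[OF _ dvd_triv_left])
  also have "D True * [:t, -2:] * [:t, -2:] - m * (smult 4 (D True)) = D True * ([:t, -2:] * [:t, -2:] - smult 4 m)"
    by (simp only: right_diff_distrib mult.assoc mult_smult_left mult_smult_right mult.commute[of m])
  also have "[:t, -2:] * [:t, -2:] - smult 4 m = [:t\<^sup>2 - 4 * d:]" by (simp add: power2_eq_square)
  finally have "m dvd smult (t\<^sup>2 - 4 * d) (D True)" by (simp add: mult.commute)
  hence V: "m dvd D True" using disc by (simp add: dvd_smult_iff)
  hence U: "m dvd D False" using 0 by (metis dvd_add_left_iff)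
  have "map_poly \<iota> (qd_poly b f - qd_poly b h) = D b"
    by (simp add: D_def lift_poly_def hom_distribs)
  thus ?thesis using U V by (cases b) auto
qed

end

section \<open>Divisibility by the factors of \<open>X^16 - 1\<close>\<close>

text \<open>The Bezout identity \<open>c a = (c - S) P + S Q\<close> shows that \<open>P\<close> and \<open>Q\<close> are coprime. All coprimality
needed below has this shape, with \<open>R\<close> a power of \<open>X\<close>.\<close>

lemma product_dvd_if_diff:
  fixes P Q R S p :: "'k::field poly"
  assumes "P - Q = smult c R" "P = [:a:] + R * S" "c \<noteq> 0" "a \<noteq> 0" "P dvd p" "Q dvd p"
  shows "P * Q dvd p"
proof -
  have "smult (c * a) 1 = smult c P - S * smult c R" by (simp add: assms(2) smult_add_right mult.commute)
  also have "\<dots> = ([:c:] - S) * P + S * Q" by (simp add: assms(1)[symmetric] algebra_simps)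
  finally have "smult (c * a) p = (([:c:] - S) * P + S * Q) * p" by (metis mult_1 mult_smult_left)
  also have "\<dots> = ([:c:] - S) * (P * p) + S * (Q * p)" by (simp add: algebra_simps)
  finally have *: "smult (c * a) p = ([:c:] - S) * (P * p) + S * (Q * p)" .
  have A: "P * Q dvd P * p" and B: "P * Q dvd Q * p"
    using assms(5,6) by (simp_all add: mult_dvd_mono mult.commute[of P Q])
  have "P * Q dvd smult (c * a) p" unfolding * by (rule dvd_add[OF dvd_mult[OF A] dvd_mult[OF B]])
  thus ?thesis using assms(3,4) by (simp add: dvd_smult_iff)
qed

lemma unity_poly_double:
  assumes "(2 :: 'k::field) \<noteq> 0" "k > 0" "unity_poly k dvd p" "monom 1 k + 1 dvd (p :: 'k poly)"
  shows "unity_poly (2 * k) dvd p"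
proof -
  have "(monom 1 k + 1) * unity_poly k dvd p"
    by (rule product_dvd_if_diff[where c = 2 and a = 1 and R = 1 and S = "monom 1 k"])
       (use assms in \<open>auto simp: unity_poly_def one_pCons\<close>)
  moreover have "(monom 1 k + 1) * unity_poly k = (unity_poly (2 * k) :: 'k poly)"
    by (simp add: unity_poly_def algebra_simps mult_monom mult_2_right)
  ultimately show ?thesis by simp
qed

text \<open>The factors multiply up to \<open>X^16 - 1\<close> by repeated use of \<open>X^(2k) - 1 = (X^k + 1)(X^k - 1)\<close>, whose
factors are coprime as they differ by 2.\<close>

lemma eq_0_by_cyclotomic_factors:
  fixes p :: "'k::field poly"
  assumes 2: "(2 :: 'k) \<noteq> 0" and p: "degree p < 16" "poly p 1 = 0" "poly p (-1) = 0"
    and dvd: "[:1, 0, 1:] dvd p" "monom 1 4 + 1 dvd p" "monom 1 8 + 1 dvd p"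
  shows "p = 0"
proof -
  have "unity_poly 1 dvd p" using p(2) by (simp add: poly_eq_0_iff_dvd unity_poly_def monom_altdef one_pCons)
  hence "unity_poly 2 dvd p" using unity_poly_double[OF 2, of 1 p] p(3)
    by (simp add: poly_eq_0_iff_dvd monom_altdef one_pCons)
  hence "unity_poly 4 dvd p" using unity_poly_double[OF 2, of 2 p] dvd(1)
    by (simp add: monom_altdef one_pCons power2_eq_square del: One_nat_def)
  hence "unity_poly 8 dvd p" using unity_poly_double[OF 2, of 4 p] dvd(2) by simp
  hence "unity_poly 16 dvd p" using unity_poly_double[OF 2, of 8 p] dvd(3) by simp
  thus ?thesis using p(1) by (intro unity_poly_dvd_imp_0[of 16]) auto
qed

lemma trace_quadratics_dvd:
  assumes "(2 :: 'k::field) \<noteq> 0" "t \<noteq> 0" "d \<noteq> (0 :: 'k)" "[:d, t, 1:] dvd p" "[:d, - t, 1:] dvd p"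
  shows "[:d, t, 1:] * [:d, - t, 1:] dvd p"
  by (rule product_dvd_if_diff[where c = "2 * t" and a = d and R = "[:0, 1:]" and S = "[:t, 1:]"])
     (use assms in auto)

text \<open>The four roots of the quartic are \<open>t\<close>, \<open>-t\<close>, \<open>u\<close> and \<open>-u\<close>. Pairing \<open>t\<close> with \<open>-t\<close> gives
\<open>(X^2 - 1)^2 - t^2 X^2\<close>, and \<open>t^2\<close> and \<open>u^2\<close> are the two roots of \<open>Y^2 + 4 Y + 2\<close>.\<close>

lemma trace16_products:
  fixes t :: "'k::field"
  assumes t: "t ^ 4 + 4 * t\<^sup>2 + 2 = 0" and u: "u = t ^ 3 + 3 * t"
  shows "[:-1, t, 1:] * [:-1, - t, 1:] * ([:-1, u, 1:] * [:-1, - u, 1:]) = monom 1 8 + 1"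
    and "u\<^sup>2 = - 4 - t\<^sup>2" "u ^ 4 + 4 * u\<^sup>2 + 2 = 0" "(t\<^sup>2 + 2)\<^sup>2 = 2"
proof -
  define w where "w = t\<^sup>2"
  have "w * w + 4 * w + 2 = 0" using t by (simp add: w_def power2_eq_square numeral_eq_Suc mult.assoc)
  hence "w * w = - (4 * w + 2)" by (simp only: add.assoc eq_neg_iff_add_eq_0)
  hence w: "w * w = - 4 * w - 2" by simp
  hence w': "w * w + w * 4 = - 2" by simp
  have "u\<^sup>2 = w * (w * w) + 6 * (w * w) + 9 * w" by (simp add: u w_def numeral_eq_Suc algebra_simps)
  also have "w * (w * w) = - 4 * (w * w) - 2 * w" by (subst w) (simp add: algebra_simps)
  also have "- 4 * (w * w) - 2 * w + 6 * (w * w) + 9 * w = 2 * (w * w) + 7 * w" by (simp add: algebra_simps)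
  also have "\<dots> = - 4 - w" unfolding w by (simp add: algebra_simps)
  finally show u2: "u\<^sup>2 = - 4 - t\<^sup>2" by (simp add: w_def)
  have "u ^ 4 + 4 * u\<^sup>2 + 2 = u\<^sup>2 * u\<^sup>2 + 4 * u\<^sup>2 + 2" by (simp add: numeral_eq_Suc)
  also have "\<dots> = 0" unfolding u2 w_def[symmetric] by (simp add: left_diff_distrib right_diff_distrib w)
  finally show "u ^ 4 + 4 * u\<^sup>2 + 2 = 0" .
  show "(t\<^sup>2 + 2)\<^sup>2 = 2" unfolding w_def[symmetric] by (simp add: power2_eq_square distrib_left distrib_right w)
  have 1: "[:-1, a, 1:] * [:-1, - a, 1:] = [:1, 0, - 2 - a\<^sup>2, 0, 1:]" for a :: 'k
    by (simp add: power2_eq_square)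
  show "[:-1, t, 1:] * [:-1, - t, 1:] * ([:-1, u, 1:] * [:-1, - u, 1:]) = monom 1 8 + 1"
    unfolding 1 u2 w_def[symmetric] using w'
    by (simp add: monom_altdef numeral_eq_Suc algebra_simps one_pCons)
qed

lemma trace16_dvd:
  fixes t :: "'k::field"
  assumes 2: "(2 :: 'k) \<noteq> 0" and t: "t ^ 4 + 4 * t\<^sup>2 + 2 = 0" and u: "u = t ^ 3 + 3 * t"
    and dvd: "[:-1, - t, 1:] dvd p" "[:-1, t, 1:] dvd p" "[:-1, - u, 1:] dvd p" "[:-1, u, 1:] dvd p"
  shows "monom 1 8 + 1 dvd p"
proof -
  note prods = trace16_products[OF t u]
  have "t \<noteq> 0" "u \<noteq> 0" using 2 t prods(3) by auto
  have A: "[:-1, t, 1:] * [:-1, - t, 1:] dvd p"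
    by (rule trace_quadratics_dvd[OF 2 \<open>t \<noteq> 0\<close> _ dvd(2,1)]) simp
  have B: "[:-1, u, 1:] * [:-1, - u, 1:] dvd p"
    by (rule trace_quadratics_dvd[OF 2 \<open>u \<noteq> 0\<close> _ dvd(4,3)]) simp
  have 1: "[:-1, a, 1:] * [:-1, - a, 1:] = [:1, 0, - 2 - a\<^sup>2, 0, 1:]" for a :: 'k
    by (simp add: power2_eq_square)
  have c: "u\<^sup>2 - t\<^sup>2 = - 2 * (t\<^sup>2 + 2)" by (simp add: prods(2))
  have "t\<^sup>2 + 2 \<noteq> 0" using prods(4) 2 by auto
  hence "u\<^sup>2 - t\<^sup>2 \<noteq> 0" unfolding c using 2 by (metis mult_eq_0_iff neg_equal_0_iff_equal)
  hence "[:-1, t, 1:] * [:-1, - t, 1:] * ([:-1, u, 1:] * [:-1, - u, 1:]) dvd p"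
    using 2 A B unfolding 1
    by (intro product_dvd_if_diff[where c = "u\<^sup>2 - t\<^sup>2" and a = 1 and R = "[:0, 0, 1:]" and S = "[:- 2 - t\<^sup>2, 0, 1:]"])
       auto
  thus ?thesis unfolding prods(1) .
qed

lemma sqrt2_product: "s\<^sup>2 = (2 :: 'k::field) \<Longrightarrow> [:1, s, 1:] * [:1, - s, 1:] = monom 1 4 + 1"
  by (simp add: monom_altdef numeral_eq_Suc one_pCons)

lemma sqrt2_dvd:
  assumes 2: "(2 :: 'k::field) \<noteq> 0" and s: "s\<^sup>2 = (2 :: 'k)"
    and dvd: "[:1, - s, 1:] dvd p" "[:1, s, 1:] dvd p"
  shows "monom 1 4 + 1 dvd p"
proof -
  have "s \<noteq> 0" using 2 s by auto
  hence "[:1, s, 1:] * [:1, - s, 1:] dvd p"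
    by (rule trace_quadratics_dvd[OF 2 _ _ dvd(2,1)]) simp
  thus ?thesis unfolding sqrt2_product[OF s] .
qed

lemma qd_block_trace16:
  fixes t :: "'e::field"
  assumes "field_hom \<iota>" "(2 :: 'e) \<noteq> 0" "t ^ 4 + 4 * t\<^sup>2 + 2 = 0"
  shows "qd_block \<iota> t (-1)"
proof -
  interpret field_hom \<iota> by fact
  show ?thesis
  proof
    have "[:- 1, - t, 1:] dvd monom 1 8 + 1"
      unfolding trace16_products(1)[OF assms(3) HOL.refl, symmetric] by (intro dvd_mult2 dvd_triv_right)
    moreover have "monom 1 8 - [:- 1:] = (monom 1 8 + 1 :: 'e poly)" by (simp add: one_pCons diff_conv_add_uminus del: add_uminus_conv_diff)
    ultimately show "[:- 1, - t, 1:] dvd monom 1 8 - [:- 1:]" by (simp only:)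
    show "t\<^sup>2 \<noteq> 4 * - 1"
    proof
      assume t2: "t\<^sup>2 = 4 * - 1"
      have "t ^ 4 + 4 * t\<^sup>2 + 2 = t\<^sup>2 * t\<^sup>2 + 4 * t\<^sup>2 + 2" by (simp add: numeral_eq_Suc)
      also have "\<dots> = 2" unfolding t2 by simp
      finally show False using assms by simp
    qed
  qed auto
qed

lemma qd_block_sqrt2:
  fixes s :: "'e::field"
  assumes "field_hom \<iota>" "(2 :: 'e) \<noteq> 0" "s\<^sup>2 = 2"
  shows "qd_block \<iota> s 1"
proof -
  interpret field_hom \<iota> by fact
  show ?thesis
  proof
    have "(monom 1 4 + 1) * (monom 1 4 - 1) = (monom 1 8 - [:1:] :: 'e poly)"
      by (simp add: algebra_simps mult_monom one_pCons)
    moreover have "[:1, - s, 1:] dvd (monom 1 4 + 1) * (monom 1 4 - 1)"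
      unfolding sqrt2_product[OF assms(3), symmetric] by (intro dvd_mult2 dvd_triv_right)
    ultimately show "[:1, - s, 1:] dvd monom 1 8 - [:1:]" by simp
    show "s\<^sup>2 \<noteq> 4 * 1"
    proof
      assume "s\<^sup>2 = 4 * 1"
      hence "(2 :: 'e) = 4" using assms(3) by (simp only: mult_1_right)
      also have "(4 :: 'e) = 2 + 2" by simp
      finally have "(2 :: 'e) = 0" by (rule add_cancel_right_right[THEN iffD1])
      thus False using assms(2) by contradiction
    qed
  qed auto
qed

lemma qd_block_zero:
  assumes "field_hom (\<iota> :: 'f::field \<Rightarrow> 'e::field)" "(2 :: 'e) \<noteq> 0"
  shows "qd_block \<iota> 0 1"
proof -
  interpret field_hom \<iota> by fact
  show ?thesis
  proof
    have "[:1, 0, 1:] * ((monom 1 2 - 1) * (monom 1 4 + 1)) = (monom 1 8 - [:1:] :: 'e poly)"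
      by (simp add: monom_altdef numeral_eq_Suc one_pCons)
    thus "[:1, - 0, 1:] dvd (monom 1 8 - [:1:] :: 'e poly)" by (metis dvd_triv_left minus_zero)
    show "0\<^sup>2 \<noteq> (4 * 1 :: 'e)"
    proof
      assume "0\<^sup>2 = (4 * 1 :: 'e)"
      hence "2 * 2 = (0 :: 'e)" by simp
      hence "(2 :: 'e) = 0 \<or> (2 :: 'e) = 0" by (rule mult_eq_0_iff[THEN iffD1])
      thus False using assms(2) by blast
    qed
  qed auto
qed

lemma frobenius_field_hom:
  assumes "CHAR('e::finite_field) = p" "prime p"
  shows "field_hom (\<lambda>y :: 'e. y ^ (p ^ n))"
proof
  show "(x + y) ^ p ^ n = x ^ p ^ n + y ^ p ^ n" for x y :: 'e by (rule frobenius_add(1)[OF assms(1) HOL.refl])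
qed (use assms in \<open>auto simp: power_mult_distrib prime_gt_0_nat\<close>)

text \<open>The coefficientwise \<open>q\<close>-th power map fixes polynomials over the ground field and moves \<open>t\<close> to \<open>t^q\<close>.\<close>

lemma conjugate_dvd:
  fixes \<iota> :: "'f::finite_field \<Rightarrow> 'e::finite_field"
  assumes "field_hom \<iota>" "CHAR('e) = p" "prime p" "CARD('f) = p ^ n"
    and "[:d, - t, 1:] dvd map_poly \<iota> P" "d = 1 \<or> d = -1"
  shows "[:d, - (t ^ CARD('f)), 1:] dvd map_poly \<iota> P"
proof -
  define \<phi> where "\<phi> = (\<lambda>y :: 'e. y ^ (p ^ n))"
  interpret \<iota>: field_hom \<iota> by fact
  interpret \<phi>: field_hom \<phi> unfolding \<phi>_def by (rule frobenius_field_hom[OF assms(2,3)])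
  interpret \<phi>p: map_poly_idom_hom \<phi> ..
  have fx: "\<phi> (\<iota> x) = \<iota> x" for x
    unfolding \<phi>_def assms(4)[symmetric] by (simp add: finite_field_power_card_eq_same flip: \<iota>.hom_power)
  obtain r where "map_poly \<iota> P = [:d, - t, 1:] * r" using assms(5) by (rule dvdE)
  hence "map_poly \<phi> (map_poly \<iota> P) = map_poly \<phi> [:d, - t, 1:] * map_poly \<phi> r"
    by (simp only: \<phi>p.hom_mult)
  moreover have "map_poly \<phi> (map_poly \<iota> P) = map_poly \<iota> P"
    by (rule poly_eqI) (simp add: fx)
  moreover have "map_poly \<phi> [:d, - t, 1:] = [:d, - \<phi> t, 1:]" using assms(6) by (auto simp: hom_distribs)
  ultimately have "map_poly \<iota> P = [:d, - \<phi> t, 1:] * map_poly \<phi> r" by (simp only:)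
  hence "[:d, - \<phi> t, 1:] dvd map_poly \<iota> P" by (rule dvdI)
  thus ?thesis by (simp add: \<phi>_def assms(4))
qed

lemma monom_1_dvd_descent:
  assumes "field_hom (\<iota> :: 'f::field \<Rightarrow> 'e::field)" "monom 1 k + 1 dvd map_poly \<iota> P"
  shows "monom 1 k + 1 dvd P"
proof -
  interpret field_hom \<iota> by fact
  interpret h: map_poly_idom_hom \<iota> ..
  have "map_poly \<iota> (monom 1 k + 1) = monom 1 k + 1" by (simp add: hom_distribs)
  thus ?thesis using assms(2) dvd_map_poly_hom_imp_dvd[of "monom 1 k + 1" P] by simp
qed

section \<open>Units of products\<close>

text \<open>The unit group depends on the multiplicative monoid only, so rings are compared as monoids.
Preservation of 1 has to be required, since it is automatic for groups only.\<close>

definition unital_hom :: "('a, 'm) monoid_scheme \<Rightarrow> ('b, 'n) monoid_scheme \<Rightarrow> ('a \<Rightarrow> 'b) set" where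
  "unital_hom G H = {h \<in> hom G H. h \<one>\<^bsub>G\<^esub> = \<one>\<^bsub>H\<^esub>}"

lemma unital_homI:
  assumes "\<And>x. x \<in> carrier G \<Longrightarrow> h x \<in> carrier H"
    "\<And>x y. x \<in> carrier G \<Longrightarrow> y \<in> carrier G \<Longrightarrow> h (x \<otimes>\<^bsub>G\<^esub> y) = h x \<otimes>\<^bsub>H\<^esub> h y"
    "h \<one>\<^bsub>G\<^esub> = \<one>\<^bsub>H\<^esub>"
  shows "h \<in> unital_hom G H"
  using assms by (auto simp: unital_hom_def hom_def)

lemma unital_homD:
  assumes "h \<in> unital_hom G H"
  shows "\<And>x. x \<in> carrier G \<Longrightarrow> h x \<in> carrier H"
    "\<And>x y. x \<in> carrier G \<Longrightarrow> y \<in> carrier G \<Longrightarrow> h (x \<otimes>\<^bsub>G\<^esub> y) = h x \<otimes>\<^bsub>H\<^esub> h y"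
    "h \<one>\<^bsub>G\<^esub> = \<one>\<^bsub>H\<^esub>"
  using assms by (auto simp: unital_hom_def hom_def)

lemma unital_hom_DirProd:
  assumes "f \<in> unital_hom G H" "g \<in> unital_hom G K"
  shows "(\<lambda>x. (f x, g x)) \<in> unital_hom G (H \<times>\<times> K)"
  by (rule unital_homI) (simp_all add: unital_homD[OF assms(1)] unital_homD[OF assms(2)])

lemma unital_hom_group_power:
  assumes "\<And>j. j < k \<Longrightarrow> f j \<in> unital_hom G H"
  shows "(\<lambda>x. \<lambda>j\<in>{..<k}. f j x) \<in> unital_hom G (group_power H k)"
proof (rule unital_homI)
  note D = unital_homD[OF assms]
  show "(\<lambda>j\<in>{..<k}. f j x) \<in> carrier (group_power H k)" if "x \<in> carrier G" for x
    using D(1) that by (auto simp: group_power_def)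
  show "(\<lambda>j\<in>{..<k}. f j (x \<otimes>\<^bsub>G\<^esub> y)) = (\<lambda>j\<in>{..<k}. f j x) \<otimes>\<^bsub>group_power H k\<^esub> (\<lambda>j\<in>{..<k}. f j y)"
    if "x \<in> carrier G" "y \<in> carrier G" for x y
    using D(2) that by (auto simp: group_power_def fun_eq_iff restrict_def)
  show "(\<lambda>j\<in>{..<k}. f j \<one>\<^bsub>G\<^esub>) = \<one>\<^bsub>group_power H k\<^esub>"
    using D(3) by (auto simp: group_power_def fun_eq_iff restrict_def)
qed

lemma units_of_iso:
  assumes h: "h \<in> unital_hom G H" and bij: "bij_betw h (carrier G) (carrier H)"
    and "monoid G"
  shows "units_of G \<cong> units_of H"
proof -
  interpret monoid G by fact
  note D = unital_homD[OF h]
  have inj: "h x = h y \<Longrightarrow> x = y" if "x \<in> carrier G" "y \<in> carrier G" for x y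
    using bij that by (auto simp: bij_betw_def inj_on_def)
  have surj: "\<exists>x\<in>carrier G. h x = y" if "y \<in> carrier H" for y
  proof -
    have "y \<in> h ` carrier G" using bij that by (simp add: bij_betw_def)
    thus ?thesis by auto
  qed
  have 1: "h x \<in> Units H" if x: "x \<in> Units G" for x
  proof -
    obtain y where y: "y \<in> carrier G" "y \<otimes>\<^bsub>G\<^esub> x = \<one>\<^bsub>G\<^esub>" "x \<otimes>\<^bsub>G\<^esub> y = \<one>\<^bsub>G\<^esub>"
      and x': "x \<in> carrier G" using x by (auto simp: Units_def)
    have "h y \<otimes>\<^bsub>H\<^esub> h x = \<one>\<^bsub>H\<^esub>" "h x \<otimes>\<^bsub>H\<^esub> h y = \<one>\<^bsub>H\<^esub>"
      using D(2)[OF y(1) x'] D(2)[OF x' y(1)] y D(3) by simp_all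
    thus ?thesis using D(1) x' y(1) by (auto simp: Units_def)
  qed
  have 2: "x \<in> Units G" if x: "x \<in> carrier G" "h x \<in> Units H" for x
  proof -
    obtain z where z: "z \<in> carrier H" "z \<otimes>\<^bsub>H\<^esub> h x = \<one>\<^bsub>H\<^esub>" "h x \<otimes>\<^bsub>H\<^esub> z = \<one>\<^bsub>H\<^esub>"
      using x by (auto simp: Units_def)
    obtain y where y: "y \<in> carrier G" "h y = z" using surj[OF z(1)] by blast
    have "h (y \<otimes>\<^bsub>G\<^esub> x) = h \<one>\<^bsub>G\<^esub>" "h (x \<otimes>\<^bsub>G\<^esub> y) = h \<one>\<^bsub>G\<^esub>"
      using D(2)[OF y(1) x(1)] D(2)[OF x(1) y(1)] z y(2) D(3) by simp_all
    hence "y \<otimes>\<^bsub>G\<^esub> x = \<one>\<^bsub>G\<^esub>" "x \<otimes>\<^bsub>G\<^esub> y = \<one>\<^bsub>G\<^esub>" using inj x(1) y(1) by simp_all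
    thus ?thesis using x(1) y(1) by (auto simp: Units_def)
  qed
  have "h ` Units G = Units H"
  proof (intro equalityI subsetI)
    fix y assume y: "y \<in> Units H"
    then obtain x where "x \<in> carrier G" "h x = y" using surj[of y] by (auto simp: Units_def)
    thus "y \<in> h ` Units G" using 2 y by auto
  qed (use 1 in auto)
  moreover have "inj_on h (Units G)" using inj by (auto simp: inj_on_def)
  ultimately have "h \<in> iso (units_of G) (units_of H)"
    using D(2) 1 by (auto simp: iso_def hom_def bij_betw_def units_of_def Units_closed)
  thus ?thesis by (auto simp: is_iso_def)
qed

lemma units_of_DirProd: "units_of (G \<times>\<times> H) = units_of G \<times>\<times> units_of H"
proof -
  have "Units (G \<times>\<times> H) = Units G \<times> Units H"
    by (auto simp: Units_def) blast+
  thus ?thesis by (simp add: units_of_def DirProd_def)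
qed

lemma units_of_group_power: "units_of (group_power G k) = group_power (units_of G) k"
proof -
  have "Units (group_power G k) = (\<Pi>\<^sub>E i\<in>{..<k}. Units G)"
  proof (intro equalityI subsetI)
    fix x assume "x \<in> Units (group_power G k)"
    then obtain y where x: "x \<in> carrier (group_power G k)" "y \<in> carrier (group_power G k)"
        and xy: "y \<otimes>\<^bsub>group_power G k\<^esub> x = \<one>\<^bsub>group_power G k\<^esub>" "x \<otimes>\<^bsub>group_power G k\<^esub> y = \<one>\<^bsub>group_power G k\<^esub>"
      by (auto simp: Units_def)
    have "x i \<in> Units G" if "i < k" for i
      using x that fun_cong[OF xy(1), of i] fun_cong[OF xy(2), of i]
      by (auto simp: group_power_def Units_def intro!: bexI[of _ "y i"])
    thus "x \<in> (\<Pi>\<^sub>E i\<in>{..<k}. Units G)" using x by (auto simp: group_power_def PiE_def)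
  next
    fix x assume x: "x \<in> (\<Pi>\<^sub>E i\<in>{..<k}. Units G)"
    hence "\<forall>i\<in>{..<k}. \<exists>y\<in>carrier G. y \<otimes>\<^bsub>G\<^esub> x i = \<one>\<^bsub>G\<^esub> \<and> x i \<otimes>\<^bsub>G\<^esub> y = \<one>\<^bsub>G\<^esub>"
      by (auto simp: Units_def PiE_def Pi_def)
    then obtain y where y: "\<forall>i\<in>{..<k}. y i \<in> carrier G \<and> y i \<otimes>\<^bsub>G\<^esub> x i = \<one>\<^bsub>G\<^esub> \<and> x i \<otimes>\<^bsub>G\<^esub> y i = \<one>\<^bsub>G\<^esub>"
      by (metis bchoice)
    have "restrict y {..<k} \<in> carrier (group_power G k)"
      "restrict y {..<k} \<otimes>\<^bsub>group_power G k\<^esub> x = \<one>\<^bsub>group_power G k\<^esub>"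
      "x \<otimes>\<^bsub>group_power G k\<^esub> restrict y {..<k} = \<one>\<^bsub>group_power G k\<^esub>"
      using y by (auto simp: group_power_def fun_eq_iff PiE_iff)
    moreover have "x \<in> carrier (group_power G k)"
      using x by (auto simp: group_power_def Units_def PiE_def Pi_def)
    ultimately show "x \<in> Units (group_power G k)" by (auto simp: Units_def)
  qed
  thus ?thesis by (simp add: units_of_def group_power_def product_group_def)
qed

lemma group_power_cong:
  assumes "G \<cong> H" "group G" "group H" shows "group_power G k \<cong> group_power H k"
  unfolding group_power_def using assms by (intro iso_product_groupI) auto

lemma DirProd_cong: "G \<cong> G' \<Longrightarrow> G \<times>\<times> K \<cong> G' \<times>\<times> K"
proof -
  assume "G \<cong> G'"
  then obtain h where "h \<in> iso G G'" by (auto simp: is_iso_def)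
  hence "(\<lambda>(x, y). (h x, y)) \<in> iso (G \<times>\<times> K) (G' \<times>\<times> K)"
    unfolding iso_def hom_def bij_betw_def by (auto simp: inj_on_def) (auto simp: image_iff)
  thus ?thesis by (auto simp: is_iso_def)
qed

text \<open>The multiplicative monoid of the whole field, 0 included, so that the algebra can be compared with
a product of monoids before passing to units.\<close>

abbreviation field_monoid :: "'f::field itself \<Rightarrow> 'f ring" where
  "field_monoid ty \<equiv> ring_of_type_algebra"

lemma field_monoid_simps [simp]:
  "carrier (field_monoid ty) = UNIV" "x \<otimes>\<^bsub>field_monoid ty\<^esub> y = x * y" "\<one>\<^bsub>field_monoid ty\<^esub> = 1"
  by (simp_all add: ring_of_type_algebra_def)

lemma Units_field_monoid: "Units (field_monoid TYPE('f::field)) = UNIV - {0}"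
proof -
  have "\<exists>y. y * x = 1 \<and> x * y = 1" if "x \<noteq> 0" for x :: 'f
    using that by (intro exI[of _ "inverse x"]) simp
  thus ?thesis by (auto simp: Units_def)
qed

lemma group_units_field: "group (units_of (field_monoid TYPE('f::field)))"
  by (intro monoid.units_group ring.is_monoid ring_from_type_algebra)

lemma units_field_cyclic:
  "units_of (field_monoid TYPE('f::finite_field)) \<cong> integer_mod_group (CARD('f) - 1)"
proof -
  let ?N = "CARD('f) - 1"
  have N: "?N > 0" using CARD_field_gt_1[where ?'e = 'f] by simp
  obtain g :: 'f where g: "g \<noteq> 0" "\<forall>x. x \<noteq> 0 \<longrightarrow> (\<exists>n. x = g ^ n)"
    using field_mult_generator[where ?'f = 'f] by (elim exE conjE)
  have "g * g ^ ?N = g * 1"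
    using finite_field_power_card_eq_same[of g] N by (simp flip: power_Suc)
  hence gN: "g ^ ?N = 1" using g(1) by simp
  have g_mod: "g ^ (k mod ?N) = g ^ k" for k
  proof -
    have "g ^ k = g ^ (?N * (k div ?N) + k mod ?N)" by simp
    also have "\<dots> = g ^ (k mod ?N)" by (simp only: power_add power_mult gN power_one mult_1)
    finally show ?thesis ..
  qed
  define h where "h = (\<lambda>k. g ^ nat k)"
  have "h ` {0..<int ?N} = UNIV - {0}"
  proof (intro equalityI subsetI)
    fix x assume "x \<in> UNIV - {0 :: 'f}"
    then obtain n where "x = g ^ n" using g(2) by auto
    hence "x = h (int (n mod ?N))" by (simp only: h_def g_mod nat_int)
    moreover have "int (n mod ?N) \<in> {0..<int ?N}"
      using mod_less_divisor[OF N, of n] by (simp only: atLeastLessThan_iff of_nat_less_iff of_nat_0_le_iff)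
    ultimately show "x \<in> h ` {0..<int ?N}" by (rule image_eqI)
  qed (use g(1) in \<open>auto simp: h_def\<close>)
  moreover have "card (UNIV - {0 :: 'f}) = card {0..<int ?N}" by (simp add: card_Diff_singleton)
  ultimately have "bij_betw h {0..<int ?N} (UNIV - {0})"
    by (auto simp: bij_betw_def intro!: eq_card_imp_inj_on)
  moreover have "h ((x + y) mod int ?N) = h x * h y" if "x \<in> {0..<int ?N}" "y \<in> {0..<int ?N}" for x y
  proof -
    have "nat ((x + y) mod int ?N) = (nat x + nat y) mod ?N"
      using that N by (simp only: atLeastLessThan_iff nat_mod_distrib nat_add_distrib nat_int
        of_nat_0_le_iff add_nonneg_nonneg)
    thus ?thesis by (simp only: h_def g_mod power_add)
  qed
  ultimately have "h \<in> iso (integer_mod_group ?N) (units_of (field_monoid TYPE('f)))"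
    using N by (auto simp: iso_def hom_def bij_betw_def units_of_def Units_field_monoid carrier_integer_mod_group)
  hence "integer_mod_group ?N \<cong> units_of (field_monoid TYPE('f))" by (auto simp: is_iso_def)
  thus ?thesis by (rule group.iso_sym[OF group_integer_mod_group])
qed

lemma card_carrier_mat_2: "finite (carrier_mat 2 2 :: 'e::finite mat set)"
  "card (carrier_mat 2 2 :: 'e::finite mat set) = CARD('e) ^ 4"
proof -
  let ?f = "\<lambda>M :: 'e mat. (M $$ (0,0), M $$ (0,1), M $$ (1,0), M $$ (1,1))"
  let ?g = "\<lambda>(a, b, c, d). mat 2 2 (\<lambda>(i, j). if i = 0 then if j = 0 then a else b else if j = 0 then c else (d :: 'e))"
  have b: "bij_betw ?f (carrier_mat 2 2) UNIV"
  proof (rule bij_betw_byWitness[where f' = ?g])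
    show "\<forall>M\<in>carrier_mat 2 2. ?g (?f M) = M"
    proof
      fix M :: "'e mat" assume M: "M \<in> carrier_mat 2 2"
      show "?g (?f M) = M"
      proof (rule eq_matI)
        fix i j assume "i < dim_row M" "j < dim_col M"
        hence "i = 0 \<or> i = 1" "j = 0 \<or> j = 1" using M by auto
        thus "?g (?f M) $$ (i, j) = M $$ (i, j)" by (elim disjE) simp_all
      qed (use M in auto)
    qed
  qed auto
  show "finite (carrier_mat 2 2 :: 'e mat set)" using bij_betw_finite[OF b] by simp
  have "CARD('e \<times> 'e \<times> 'e \<times> 'e) = CARD('e) ^ 4"
    by (simp add: numeral_eq_Suc flip: UNIV_Times_UNIV)
  thus "card (carrier_mat 2 2 :: 'e mat set) = CARD('e) ^ 4" using bij_betw_same_card[OF b] by simp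
qed

lemma card_group_power: "card (carrier (group_power G k)) = card (carrier G) ^ k"
  by (simp add: group_power_def card_PiE)

lemma finite_group_power: "finite (carrier G) \<Longrightarrow> finite (carrier (group_power G k))"
  by (auto simp: group_power_def intro: finite_PiE)

lemma units_of_iso_card:
  assumes "h \<in> unital_hom G H" "inj_on h (carrier G)" "monoid G" "finite (carrier H)"
    "card (carrier G) = card (carrier H)"
  shows "units_of G \<cong> units_of H"
proof (rule units_of_iso[OF assms(1) _ assms(3)])
  have "h ` carrier G \<subseteq> carrier H" using unital_homD(1)[OF assms(1)] by auto
  hence "h ` carrier G = carrier H"
    using assms by (intro card_subset_eq) (auto simp: card_image)
  thus "bij_betw h (carrier G) (carrier H)" using assms(2) by (simp add: bij_betw_def)
qed

section \<open>Odd characteristic\<close>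

text \<open>The four linear characters, indexed by the sign of the image of \<open>a\<close> (parity) and of \<open>x\<close>.\<close>

definition qd_characters :: "(qd_gen word set \<Rightarrow> 'k::field) \<Rightarrow> nat \<Rightarrow> 'k" where
  "qd_characters f = (\<lambda>i\<in>{..<4}. chi (if even i then 1 else -1) (if i < 2 then 1 else -1) f)"

lemma qd_characters_hom:
  "qd_characters \<in> unital_hom (qd_algebra TYPE('k::field)) (group_power (field_monoid TYPE('k)) 4)"
proof -
  have chi: "chi e d \<in> unital_hom (qd_algebra TYPE('k)) (field_monoid TYPE('k))"
    if "e = 1 \<or> e = -1" "d = 1 \<or> d = -1" for e d
    by (rule unital_homI) (simp_all only: field_monoid_simps UNIV_I chi_mult[OF that] chi_one)
  show ?thesis unfolding qd_characters_def[abs_def]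
    by (rule unital_hom_group_power, rule chi) simp_all
qed

lemma qd_characters_eq_imp:
  fixes f h :: "qd_gen word set \<Rightarrow> 'k::field"
  assumes 2: "(2 :: 'k) \<noteq> 0" and eq: "qd_characters f = qd_characters h"
  shows "poly (qd_poly b f - qd_poly b h) 1 = 0" "poly (qd_poly b f - qd_poly b h) (- 1) = 0"
proof -
  have chi: "chi e d f = chi e d h" if "e = 1 \<or> e = -1" "d = 1 \<or> d = -1" for e d
  proof -
    define i :: nat where "i = (if d = 1 then 0 else 2) + (if e = 1 then 0 else 1)"
    have "i < 4" "(if even i then 1 else -1) = e" "(if i < 2 then 1 else -1) = d"
      using that by (auto simp: i_def)
    moreover have "qd_characters f i = qd_characters h i" by (simp only: eq)
    ultimately show ?thesis by (simp only: qd_characters_def restrict_apply' lessThan_iff)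
  qed
  have ev: "poly (qd_poly b f - qd_poly b h) e = 0" if e: "e = 1 \<or> e = -1" for e
  proof -
    define x y where "x = poly (qd_poly False f - qd_poly False h) e"
      and "y = poly (qd_poly True f - qd_poly True h) e"
    have 1: "x + y = 0" using chi[OF e, of 1] by (simp add: chi_def x_def y_def algebra_simps)
    have m: "x - y = 0" using chi[OF e, of "-1"] by (simp add: chi_def x_def y_def algebra_simps)
    have "2 * x = (x + y) + (x - y)" by simp
    hence x: "x = 0" unfolding 1 m using 2 by simp
    have "y = 0" using 1 x by simp
    thus ?thesis using x by (cases b) (simp_all add: x_def y_def)
  qed
  show "poly (qd_poly b f - qd_poly b h) 1 = 0" by (rule ev) simp
  show "poly (qd_poly b f - qd_poly b h) (- 1) = 0" by (rule ev) simp
qed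

lemma block_hom:
  assumes "qd_block (\<iota> :: 'f::field \<Rightarrow> 'e::field) t d"
  shows "qd_block.block \<iota> t d \<in> unital_hom (qd_algebra TYPE('f)) (ring_mat TYPE('e) 2 ())"
proof -
  interpret qd_block \<iota> t d by fact
  show ?thesis by (rule unital_homI) (simp_all add: ring_mat_simps block_mult block_one)
qed

lemma card_qd_algebra: "card (carrier (qd_algebra TYPE('f::finite_field))) = CARD('f) ^ 32"
  using card_group_algebra[OF finite_QD32, where ?'k = 'f] by (simp add: card_QD32)

lemma monoid_qd_algebra: "monoid (qd_algebra TYPE('f::field))"
  by (rule ring.is_monoid[OF ring_qd_algebra])

text \<open>The polynomials of a difference of two elements have degree less than 16; once all factors of
\<open>X^16 - 1\<close> divide them, they vanish.\<close>

lemma inj_on_qd_algebraI: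
  fixes \<Phi> :: "(qd_gen word set \<Rightarrow> 'f::field) \<Rightarrow> 'b"
  assumes 2: "(2 :: 'f) \<noteq> 0"
    and chars: "\<And>f h. \<Phi> f = \<Phi> h \<Longrightarrow> qd_characters f = qd_characters h"
    and dvd: "\<And>f h b. \<Phi> f = \<Phi> h \<Longrightarrow> [:1, 0, 1:] dvd qd_poly b f - qd_poly b h"
      "\<And>f h b. \<Phi> f = \<Phi> h \<Longrightarrow> monom 1 4 + 1 dvd qd_poly b f - qd_poly b h"
      "\<And>f h b. \<Phi> f = \<Phi> h \<Longrightarrow> monom 1 8 + 1 dvd qd_poly b f - qd_poly b h"
  shows "inj_on \<Phi> (carrier (qd_algebra TYPE('f)))"
proof (rule inj_onI)
  fix f h assume fh: "f \<in> carrier (qd_algebra TYPE('f))" "h \<in> carrier (qd_algebra TYPE('f))" "\<Phi> f = \<Phi> h"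
  show "f = h"
  proof (rule qd_algebra_eqI[OF fh(1,2)])
    fix b
    have "degree (qd_poly b f - qd_poly b h) < 16"
      by (intro degree_diff_less degree_qd_poly)
    hence "qd_poly b f - qd_poly b h = 0"
      using eq_0_by_cyclotomic_factors[OF 2] qd_characters_eq_imp[OF 2 chars[OF fh(3)]] dvd[OF fh(3)]
      by blast
    thus "qd_poly b f = qd_poly b h" by simp
  qed
qed

text \<open>The blocks \<open>B\<close> contribute \<open>q^28\<close> elements and the characters \<open>q^4\<close>, which is the size \<open>q^32\<close> of the
algebra; so joint injectivity suffices for an isomorphism.\<close>

lemma units_qd_algebra_iso:
  fixes N :: "('b, 'n) monoid_scheme"
  assumes 2: "(2 :: 'f::finite_field) \<noteq> 0"
    and B: "B \<in> unital_hom (qd_algebra TYPE('f)) N" and fin: "finite (carrier N)"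
    and card: "card (carrier N) = CARD('f) ^ 28"
    and dvd: "\<And>f h b. B f = B h \<Longrightarrow> [:1, 0, 1:] dvd qd_poly b f - qd_poly b h"
      "\<And>f h b. B f = B h \<Longrightarrow> monom 1 4 + 1 dvd qd_poly b f - qd_poly b h"
      "\<And>f h b. B f = B h \<Longrightarrow> monom 1 8 + 1 dvd qd_poly b f - qd_poly b h"
  shows "units_of (qd_algebra TYPE('f)) \<cong> group_power (integer_mod_group (CARD('f) - 1)) 4 \<times>\<times> units_of N"
proof -
  let ?P = "group_power (field_monoid TYPE('f)) 4"
  have "units_of (qd_algebra TYPE('f)) \<cong> units_of (?P \<times>\<times> N)"
  proof (rule units_of_iso_card[OF unital_hom_DirProd[OF qd_characters_hom B]])
    show "inj_on (\<lambda>x. (qd_characters x, B x)) (carrier (qd_algebra TYPE('f)))"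
      by (rule inj_on_qd_algebraI[OF 2]) (use dvd in auto)
    show "card (carrier (qd_algebra TYPE('f))) = card (carrier (?P \<times>\<times> N))"
      by (simp add: card_qd_algebra card_cartesian_product card_group_power card flip: power_add)
  qed (use fin in \<open>simp_all add: monoid_qd_algebra finite_group_power\<close>)
  also have "units_of (?P \<times>\<times> N) = group_power (units_of (field_monoid TYPE('f))) 4 \<times>\<times> units_of N"
    by (simp only: units_of_DirProd units_of_group_power)
  also have "\<dots> \<cong> group_power (integer_mod_group (CARD('f) - 1)) 4 \<times>\<times> units_of N"
    by (intro DirProd_cong group_power_cong units_field_cyclic group_units_field group_integer_mod_group)
  finally show ?thesis .
qed

lemma two_nonzero: "CHAR('e::finite_field) = p \<Longrightarrow> p > 2 \<Longrightarrow> (2 :: 'e) \<noteq> 0"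
proof
  assume "CHAR('e) = p" "p > 2" "(2 :: 'e) = 0"
  hence "of_nat 2 = (0 :: 'e)" by simp
  hence "p dvd 2" using \<open>CHAR('e) = p\<close> by (simp only: of_nat_eq_0_iff_char_dvd)
  thus False using \<open>p > 2\<close> by (auto dest: dvd_imp_le)
qed

lemma block_eq_imp_dvd':
  assumes "qd_block (\<iota> :: 'f::field \<Rightarrow> 'e::field) t d" "qd_block.block \<iota> t d f = qd_block.block \<iota> t d h"
  shows "[:d, - t, 1:] dvd map_poly \<iota> (qd_poly b f - qd_poly b h)"
  by (rule qd_block.block_eq_imp_dvd[OF assms])

lemma field_hom_id: "field_hom (\<lambda>x :: 'f::field. x)"
  by unfold_locales auto

lemma map_poly_id': "map_poly (\<lambda>x. x) p = p"
  by (rule poly_eqI) (simp add: coeff_map_poly)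

lemma block_id_eq_imp_dvd:
  assumes "qd_block (\<lambda>x :: 'f::field. x) t d" "qd_block.block (\<lambda>x. x) t d f = qd_block.block (\<lambda>x. x) t d h"
  shows "[:d, - t, 1:] dvd qd_poly b f - qd_poly b h"
  using block_eq_imp_dvd'[OF assms, of b] by (simp only: map_poly_id')

text \<open>If \<open>t\<close> lies in the ground field, then so do the other three roots and \<open>s = t^2 + 2\<close>, and all seven blocks
are defined over the ground field.\<close>

lemma units_split:
  fixes t :: "'f::finite_field"
  assumes 2: "(2 :: 'f) \<noteq> 0" and t: "t ^ 4 + 4 * t\<^sup>2 + 2 = 0"
  shows "units_of (qd_algebra TYPE('f)) \<cong>
      group_power (integer_mod_group (CARD('f) - 1)) 4 \<times>\<times> group_power (GL 2 TYPE('f)) 7"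
proof -
  define u where "u = t ^ 3 + 3 * t"
  define s where "s = t\<^sup>2 + 2"
  note prods = trace16_products[OF t u_def]
  have s2: "s\<^sup>2 = 2" using prods(4) by (simp add: s_def)
  define T where "T = (\<lambda>j. [t, - t, u, - u, s, - s, 0] ! j)"
  define D where "D = (\<lambda>j. [-1, -1, -1, -1, 1, 1, 1 :: 'f] ! j)"
  let ?bl = "\<lambda>j. qd_block.block (\<lambda>x. x) (T j) (D j)"
  have "qd_block (\<lambda>x. x) t (-1)" "qd_block (\<lambda>x. x) (-t) (-1)"
       "qd_block (\<lambda>x. x) u (-1)" "qd_block (\<lambda>x. x) (-u) (-1)"
       "qd_block (\<lambda>x. x) s 1" "qd_block (\<lambda>x. x) (-s) 1" "qd_block (\<lambda>x :: 'f. x) 0 1"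
    using 2 t prods(3) s2
    by (auto intro!: qd_block_trace16 qd_block_sqrt2 qd_block_zero field_hom_id)
  hence bl: "qd_block (\<lambda>x. x) (T j) (D j)" if "j < 7" for j
    using that by (auto simp: T_def D_def less_Suc_eq numeral_eq_Suc)
  define B where "B = (\<lambda>f. \<lambda>j\<in>{..<7}. ?bl j f)"
  have B: "B \<in> unital_hom (qd_algebra TYPE('f)) (group_power (ring_mat TYPE('f) 2 ()) 7)"
    unfolding B_def by (intro unital_hom_group_power block_hom bl)
  have dvd: "[:D j, - T j, 1:] dvd qd_poly b f - qd_poly b h" if "B f = B h" "j < 7" for f h b j
    using fun_cong[OF that(1), of j] that(2) by (intro block_id_eq_imp_dvd[OF bl]) (auto simp: B_def)
  have "units_of (qd_algebra TYPE('f)) \<cong> group_power (integer_mod_group (CARD('f) - 1)) 4 \<times>\<times>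
      units_of (group_power (ring_mat TYPE('f) 2 ()) 7)"
  proof (rule units_qd_algebra_iso[OF 2 B])
    fix f h b assume fh: "B f = B h"
    note d = dvd[OF fh, of _ b, unfolded T_def D_def]
    show "[:1, 0, 1:] dvd qd_poly b f - qd_poly b h" using d[of 6] by simp
    show "monom 1 4 + 1 dvd qd_poly b f - qd_poly b h"
      using d[of 4] d[of 5] by (intro sqrt2_dvd[OF 2 s2]) simp_all
    show "monom 1 8 + 1 dvd qd_poly b f - qd_poly b h"
      using d[of 0] d[of 1] d[of 2] d[of 3] by (intro trace16_dvd[OF 2 t u_def]) simp_all
  qed (simp_all add: ring_mat_simps card_group_power card_carrier_mat_2 finite_group_power flip: power_mult)
  thus ?thesis by (simp only: units_of_group_power GL_def)
qed

text \<open>Here \<open>t^q = - t\<close>: the traces \<open>t\<close>, \<open>-t\<close>, \<open>u\<close>, \<open>-u\<close> form two orbits, represented by \<open>t\<close> and \<open>u\<close> in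
the quadratic extension, while the square root of 2 lies in the ground field.\<close>

lemma units_semi_split:
  fixes \<iota> :: "'f::finite_field \<Rightarrow> 'e::finite_field"
  assumes \<iota>: "field_hom \<iota>" and 2: "(2 :: 'f) \<noteq> 0" "(2 :: 'e) \<noteq> 0" and card: "CARD('e) = CARD('f)\<^sup>2"
    and p: "prime p" "CARD('f) = p ^ n" "CHAR('e) = p"
    and q: "CARD('f) mod 16 \<in> {9, 15}"
    and s: "s\<^sup>2 = (2 :: 'f)" and t: "t ^ 4 + 4 * t\<^sup>2 + 2 = (0 :: 'e)"
  shows "units_of (qd_algebra TYPE('f)) \<cong>
      group_power (integer_mod_group (CARD('f) - 1)) 4 \<times>\<times> group_power (GL 2 TYPE('f)) 3 \<times>\<times>
      group_power (GL 2 TYPE('e)) 2"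
proof -
  define u where "u = t ^ 3 + 3 * t"
  note prods = trace16_products[OF t u_def]
  define T where "T = (\<lambda>j. [s, - s, 0] ! j)"
  define R where "R = (\<lambda>j. [t, u] ! j)"
  have "qd_block (\<lambda>x. x) s 1" "qd_block (\<lambda>x. x) (-s) 1" "qd_block (\<lambda>x :: 'f. x) 0 1"
    using 2 s by (auto intro!: qd_block_sqrt2 qd_block_zero field_hom_id)
  hence bl: "qd_block (\<lambda>x. x) (T j) 1" if "j < 3" for j
    using that by (auto simp: T_def less_Suc_eq numeral_eq_Suc)
  have "qd_block \<iota> t (-1)" "qd_block \<iota> u (-1)"
    using 2 t prods(3) by (auto intro!: qd_block_trace16 \<iota>)
  hence bl': "qd_block \<iota> (R j) (-1)" if "j < 2" for j
    using that by (auto simp: R_def less_Suc_eq numeral_eq_Suc)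
  define B1 where "B1 = (\<lambda>f. \<lambda>j\<in>{..<3}. qd_block.block (\<lambda>x. x) (T j) 1 f)"
  define B2 where "B2 = (\<lambda>f. \<lambda>j\<in>{..<2}. qd_block.block \<iota> (R j) (-1) f)"
  have B1: "B1 \<in> unital_hom (qd_algebra TYPE('f)) (group_power (ring_mat TYPE('f) 2 ()) 3)"
    unfolding B1_def by (intro unital_hom_group_power block_hom bl)
  have B2: "B2 \<in> unital_hom (qd_algebra TYPE('f)) (group_power (ring_mat TYPE('e) 2 ()) 2)"
    unfolding B2_def by (intro unital_hom_group_power block_hom bl')
  have dvd1: "[:1, - T j, 1:] dvd qd_poly b f - qd_poly b h" if "B1 f = B1 h" "j < 3" for f h b j
    using fun_cong[OF that(1), of j] that(2) by (intro block_id_eq_imp_dvd[OF bl]) (auto simp: B1_def)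
  have dvd2: "[:-1, - R j, 1:] dvd map_poly \<iota> (qd_poly b f - qd_poly b h)" if "B2 f = B2 h" "j < 2" for f h b j
    using fun_cong[OF that(1), of j] that(2) by (intro block_eq_imp_dvd'[OF bl']) (auto simp: B2_def)
  have conj: "[:-1, r, 1:] dvd map_poly \<iota> P"
    if "[:-1, - r, 1:] dvd map_poly \<iota> P" "r ^ 4 + 4 * r\<^sup>2 + 2 = 0" for r P
  proof -
    have "r ^ CARD('f) = - r" by (rule trace16_frobenius(1)[OF that(2) p(3,2) q])
    thus ?thesis using conjugate_dvd[OF \<iota> p(3,1,2) that(1)] by simp
  qed
  have "units_of (qd_algebra TYPE('f)) \<cong> group_power (integer_mod_group (CARD('f) - 1)) 4 \<times>\<times>
      units_of (group_power (ring_mat TYPE('f) 2 ()) 3 \<times>\<times> group_power (ring_mat TYPE('e) 2 ()) 2)"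
  proof (rule units_qd_algebra_iso[OF 2(1) unital_hom_DirProd[OF B1 B2]])
    fix f h b assume "(B1 f, B2 f) = (B1 h, B2 h)"
    hence fh: "B1 f = B1 h" "B2 f = B2 h" by auto
    note d1 = dvd1[OF fh(1), of _ b, unfolded T_def]
    note d2 = dvd2[OF fh(2), of _ b, unfolded R_def]
    show "[:1, 0, 1:] dvd qd_poly b f - qd_poly b h" using d1[of 2] by simp
    show "monom 1 4 + 1 dvd qd_poly b f - qd_poly b h"
      using d1[of 0] d1[of 1] by (intro sqrt2_dvd[OF 2(1) s]) simp_all
    let ?P = "map_poly \<iota> (qd_poly b f - qd_poly b h)"
    have d: "[:-1, - t, 1:] dvd ?P" "[:-1, - u, 1:] dvd ?P" using d2[of 0] d2[of 1] by simp_all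
    have "monom 1 8 + 1 dvd ?P"
      by (rule trace16_dvd[OF 2(2) t u_def d(1) conj[OF d(1) t] d(2) conj[OF d(2) prods(3)]])
    thus "monom 1 8 + 1 dvd qd_poly b f - qd_poly b h" by (rule monom_1_dvd_descent[OF \<iota>])
  qed (simp_all add: ring_mat_simps card_cartesian_product card_group_power card_carrier_mat_2
        finite_group_power card flip: power_mult power_add)
  thus ?thesis by (simp only: units_of_DirProd units_of_group_power GL_def)
qed

text \<open>The \<open>q\<close>-th power map sends \<open>t\<close> to \<open>e u\<close>, with a sign \<open>e\<close> that depends on \<open>q\<close> only, so the four traces
form a single orbit. It also exchanges the two square roots of 2. Hence one block over each of the
three fields is enough.\<close>

lemma units_nonsplit:
  fixes \<iota> :: "'f::finite_field \<Rightarrow> 'e::finite_field" and \<kappa> :: "'f \<Rightarrow> 'l::finite_field"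
  assumes \<iota>: "field_hom \<iota>" and \<kappa>: "field_hom \<kappa>"
    and 2: "(2 :: 'f) \<noteq> 0" "(2 :: 'e) \<noteq> 0" "(2 :: 'l) \<noteq> 0"
    and card: "CARD('e) = CARD('f)\<^sup>2" "CARD('l) = CARD('f) ^ 4"
    and p: "prime p" "CARD('f) = p ^ n" "CHAR('e) = p" "CHAR('l) = p"
    and q: "CARD('f) mod 16 \<in> {3, 5, 11, 13}"
    and s: "s\<^sup>2 = (2 :: 'e)" and t: "t ^ 4 + 4 * t\<^sup>2 + 2 = (0 :: 'l)"
  shows "units_of (qd_algebra TYPE('f)) \<cong>
      group_power (integer_mod_group (CARD('f) - 1)) 4 \<times>\<times> GL 2 TYPE('f) \<times>\<times> GL 2 TYPE('e) \<times>\<times> GL 2 TYPE('l)"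
proof -
  define g where "g = (\<lambda>r :: 'l. r ^ 3 + 3 * r)"
  define u where "u = g t"
  note prods = trace16_products[OF t u_def[unfolded g_def]]
  note prods' = trace16_products[OF prods(3) HOL.refl]
  have uu: "g u = - t"
  proof -
    have tu: "t * u = t\<^sup>2 * (t\<^sup>2 + 3)" by (simp add: u_def g_def power2_eq_square numeral_eq_Suc algebra_simps)
    have "t \<noteq> 0" using t 2 by auto
    have "t * g u = (t * u) * (u\<^sup>2 + 3)" by (simp add: g_def numeral_eq_Suc algebra_simps)
    also have "\<dots> = - (t\<^sup>2 * ((t ^ 4 + 4 * t\<^sup>2 + 2) + 1))"
      unfolding tu prods(2) by (simp add: numeral_eq_Suc algebra_simps)
    also have "\<dots> = t * (- t)" unfolding t by (simp add: power2_eq_square)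
    finally have "t * g u = t * (- t)" .
    thus ?thesis using mult_left_cancel[OF \<open>t \<noteq> 0\<close>] by blast
  qed
  let ?B1 = "qd_block.block (\<lambda>x :: 'f. x) 0 1"
  let ?B2 = "qd_block.block \<iota> s 1"
  let ?B3 = "qd_block.block \<kappa> t (-1)"
  have bl: "qd_block (\<lambda>x :: 'f. x) 0 1" "qd_block \<iota> s 1" "qd_block \<kappa> t (-1)"
    using 2 s t by (auto intro!: qd_block_sqrt2 qd_block_zero qd_block_trace16 field_hom_id \<iota> \<kappa>)
  note B = bl[THEN block_hom]
  have "CARD('f) mod 8 = CARD('f) mod 16 mod 8" by (simp add: mod_mod_cancel)
  hence q8: "CARD('f) mod 8 \<in> {3, 5}" using q by auto
  obtain e :: 'l where e: "e = 1 \<or> e = -1"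
      and frob: "\<And>r. r ^ 4 + 4 * r\<^sup>2 + 2 = 0 \<Longrightarrow> r ^ CARD('f) = e * g r"
  proof (cases "CARD('f) mod 16 \<in> {3, 5}")
    case True
    show ?thesis by (rule that[of 1]) (use trace16_frobenius(2)[OF _ p(4,2) True] in \<open>auto simp: g_def\<close>)
  next
    case False
    hence q': "CARD('f) mod 16 \<in> {11, 13}" using q by auto
    show ?thesis
      by (rule that[of "-1"]) (use trace16_frobenius(3)[OF _ p(4,2) q'] in \<open>auto simp: g_def\<close>)
  qed
  have conj: "[:-1, - (e * g r), 1:] dvd map_poly \<kappa> P"
    if "[:-1, - r, 1:] dvd map_poly \<kappa> P" "r ^ 4 + 4 * r\<^sup>2 + 2 = 0" for r P
    using conjugate_dvd[OF \<kappa> p(4,1,2) that(1)] frob[OF that(2)] by simp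
  have "units_of (qd_algebra TYPE('f)) \<cong> group_power (integer_mod_group (CARD('f) - 1)) 4 \<times>\<times>
      units_of (ring_mat TYPE('f) 2 () \<times>\<times> ring_mat TYPE('e) 2 () \<times>\<times> ring_mat TYPE('l) 2 ())"
  proof (rule units_qd_algebra_iso[OF 2(1) unital_hom_DirProd[OF B(1) unital_hom_DirProd[OF B(2,3)]]])
    fix f h b assume "(?B1 f, ?B2 f, ?B3 f) = (?B1 h, ?B2 h, ?B3 h)"
    hence fh: "?B1 f = ?B1 h" "?B2 f = ?B2 h" "?B3 f = ?B3 h" by auto
    show "[:1, 0, 1:] dvd qd_poly b f - qd_poly b h"
      using block_id_eq_imp_dvd[OF bl(1) fh(1), of b] by simp
    let ?P = "map_poly \<iota> (qd_poly b f - qd_poly b h)"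
    have d: "[:1, - s, 1:] dvd ?P" by (rule block_eq_imp_dvd'[OF bl(2) fh(2)])
    have "[:1, s, 1:] dvd ?P"
      using conjugate_dvd[OF \<iota> p(3,1,2) d] sqrt2_frobenius[OF s p(3,2) q8] by simp
    hence "monom 1 4 + 1 dvd ?P" by (intro sqrt2_dvd[OF 2(2) s] d)
    thus "monom 1 4 + 1 dvd qd_poly b f - qd_poly b h" by (rule monom_1_dvd_descent[OF \<iota>])
    let ?R = "map_poly \<kappa> (qd_poly b f - qd_poly b h)"
    have all: "[:-1, - t, 1:] dvd ?R \<and> [:-1, t, 1:] dvd ?R \<and> [:-1, - u, 1:] dvd ?R \<and> [:-1, u, 1:] dvd ?R"
    proof -
      \<comment> \<open>follow the orbit of \<open>t\<close> under the \<open>q\<close>-th power map: \<open>t\<close>, \<open>e u\<close>, \<open>-t\<close>, \<open>-e u\<close>\<close>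
      have 0: "[:-1, - t, 1:] dvd ?R" by (rule block_eq_imp_dvd'[OF bl(3) fh(3)])
      have 1: "[:-1, - (e * u), 1:] dvd ?R" using conj[OF 0 t] by (simp only: u_def)
      have "(e * u) ^ 4 + 4 * (e * u)\<^sup>2 + 2 = 0" using e prods(3) by auto
      moreover have "e * g (e * u) = - t" using e uu by (auto simp: g_def add.commute)
      ultimately have 2: "[:-1, - (- t), 1:] dvd ?R" using conj[OF 1] by simp
      have gm: "g (- t) = - u" by (simp add: u_def g_def)
      have "e * g (- t) = - (e * u)" unfolding gm by simp
      hence 3: "[:-1, - (- (e * u)), 1:] dvd ?R" using conj[OF 2] t by simp
      show ?thesis using e 0 1 2 3 by auto
    qed
    hence "monom 1 8 + 1 dvd ?R" by (intro trace16_dvd[OF 2(3) t u_def[unfolded g_def]]) auto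
    thus "monom 1 8 + 1 dvd qd_poly b f - qd_poly b h" by (rule monom_1_dvd_descent[OF \<kappa>])
  qed (simp_all add: ring_mat_simps card_cartesian_product card_carrier_mat_2
        card flip: power_mult power_add)
  thus ?thesis by (simp only: units_of_DirProd units_of_group_power GL_def)
qed

section \<open>Characteristic two\<close>

lemma add_self_char2: "(2 :: 'k::field) = 0 \<Longrightarrow> p + p = (0 :: 'k poly)"
proof -
  assume "(2 :: 'k) = 0"
  have "p + p = smult (1 + 1) p" by (simp only: smult_add_left smult_1_left)
  also have "(1 + 1 :: 'k) = 0" using \<open>2 = 0\<close> by simp
  finally show "p + p = 0" by simp
qed

lemma minus_char2: "(2 :: 'k::field) = 0 \<Longrightarrow> - p = (p :: 'k poly)"
  using add_self_char2[of p] by (simp add: minus_unique)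

lemma square_add_char2: "(2 :: 'k::field) = 0 \<Longrightarrow> (p + r)\<^sup>2 = p\<^sup>2 + (r\<^sup>2 :: 'k poly)"
proof -
  assume 2: "(2 :: 'k) = 0"
  have "(p + r)\<^sup>2 = p\<^sup>2 + r\<^sup>2 + (p * r + p * r)" by (simp add: power2_eq_square algebra_simps)
  thus ?thesis by (simp add: add_self_char2[OF 2])
qed

definition X_minus_1 :: "'k::field poly" where "X_minus_1 = [:-1, 1:]"

lemma unity_poly_16_char2: "(2 :: 'k::field) = 0 \<Longrightarrow> X_minus_1 ^ 16 = (unity_poly 16 :: 'k poly)"
proof -
  assume 2: "(2 :: 'k) = 0"
  have "X_minus_1 ^ (2 ^ j) = (unity_poly (2 ^ j) :: 'k poly)" for j
  proof (induction j)
    case (Suc j)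
    have "X_minus_1 ^ (2 ^ Suc j) = (unity_poly (2 ^ j) :: 'k poly)\<^sup>2"
      by (simp add: Suc power_mult mult.commute[of 2])
    also have "\<dots> = (monom 1 (2 ^ j))\<^sup>2 + (- 1)\<^sup>2"
      unfolding unity_poly_def diff_conv_add_uminus by (rule square_add_char2[OF 2])
    also have "\<dots> = unity_poly (2 ^ Suc j)"
      using minus_char2[OF 2, of 1] by (simp add: unity_poly_def monom_power mult.commute)
    finally show ?case .
  qed (simp add: X_minus_1_def unity_poly_def monom_altdef one_pCons)
  from this[of 4] show ?thesis by simp
qed

lemma X_minus_1_dvd_iff: "X_minus_1 dvd (p :: 'k::field poly) \<longleftrightarrow> poly p 1 = 0"
  by (simp add: poly_eq_0_iff_dvd X_minus_1_def)

lemma poly_X_minus_1: "poly X_minus_1 1 = 0"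
  by (simp add: X_minus_1_def)

lemma twist_dvd_unity_poly_power:
  assumes "X_minus_1 ^ k dvd (p :: 'k::field poly)" shows "X_minus_1 ^ k dvd twist p"
proof -
  obtain r where p: "p = X_minus_1 ^ k * r" using assms by (rule dvdE)
  have "twist (X_minus_1 ^ k) = (twist X_minus_1 ^ k :: 'k poly)" by (induction k) simp_all
  moreover have "X_minus_1 dvd (twist (X_minus_1) :: 'k poly)" by (simp add: X_minus_1_dvd_iff poly_twist poly_X_minus_1)
  ultimately have "X_minus_1 ^ k dvd twist (X_minus_1 ^ k :: 'k poly)" by (simp only: dvd_power_same)
  thus ?thesis unfolding p twist_simps by (rule dvd_mult2)
qed

text \<open>On a monomial, \<open>X^(7i) - X^i = X^i (X^(6i) - 1) = X^i (X^(3i) - 1)^2\<close> in characteristic 2.\<close>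

lemma twist_diff_dvd:
  assumes 2: "(2 :: 'k::field) = 0" shows "X_minus_1 ^ 2 dvd (twist p - p :: 'k poly)"
proof -
  have mon: "X_minus_1 ^ 2 dvd (twist (monom c i) - monom c i :: 'k poly)" for c i
  proof -
    have "(unity_poly (3 * i))\<^sup>2 = (unity_poly (6 * i) :: 'k poly)"
    proof -
      have "(unity_poly (3 * i))\<^sup>2 = (monom 1 (3 * i))\<^sup>2 + ((- 1)\<^sup>2 :: 'k poly)"
        unfolding unity_poly_def diff_conv_add_uminus by (rule square_add_char2[OF 2])
      also have "\<dots> = unity_poly (6 * i)"
        using minus_char2[OF 2, of 1] by (simp add: unity_poly_def monom_power mult.commute)
      finally show ?thesis .
    qed
    moreover have "twist (monom c i) - monom c i = monom c i * unity_poly (6 * i)"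
      by (simp add: unity_poly_def algebra_simps mult_monom)
    ultimately have "twist (monom c i) - monom c i = monom c i * (unity_poly (3 * i))\<^sup>2" by simp
    moreover have "X_minus_1 dvd (unity_poly (3 * i) :: 'k poly)" by (simp add: X_minus_1_dvd_iff unity_poly_def poly_monom)
    ultimately show ?thesis by (simp add: dvd_power_same)
  qed
  have "twist p - p = (\<Sum>i\<le>degree p. twist (monom (coeff p i) i) - monom (coeff p i) i)"
    by (simp only: sum_subtractf twist_sum[symmetric] poly_as_sum_of_monoms)
  also have "X_minus_1 ^ 2 dvd \<dots>" by (intro dvd_sum mon)
  finally show ?thesis .
qed

text \<open>In characteristic 2 and for \<open>k \<le> 16\<close>, the two-sided ideal generated by \<open>(a - 1)^k\<close>.\<close>

definition in_power_ideal :: "nat \<Rightarrow> (qd_gen word set \<Rightarrow> 'k::field) \<Rightarrow> bool" where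
  "in_power_ideal k f \<longleftrightarrow> (\<forall>b. X_minus_1 ^ k dvd qd_poly b f)"

lemma in_power_ideal_square_aux:
  assumes 2: "(2 :: 'k::field) = 0" and k: "k \<le> 16"
    and "\<And>b. X_minus_1 ^ k dvd qd_poly False f * qd_poly b f + qd_poly True f * twist (qd_poly (\<not> b) f)"
  shows "in_power_ideal k (f \<otimes>\<^bsub>qd_algebra TYPE('k)\<^esub> f)"
  unfolding in_power_ideal_def
proof
  fix b
  have "X_minus_1 ^ k dvd (unity_poly 16 :: 'k poly)"
    unfolding unity_poly_16_char2[OF 2, symmetric] by (rule le_imp_power_dvd[OF k])
  from cong_dvd_modulus[OF qd_poly_mult this]
  show "X_minus_1 ^ k dvd qd_poly b (f \<otimes>\<^bsub>qd_algebra TYPE('k)\<^esub> f)"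
    using cong_dvd_iff assms(3)[of b] by blast
qed

lemma square_in_power_ideal:
  assumes 2: "(2 :: 'k::field) = 0" and k: "k \<le> 8" and f: "in_power_ideal k f"
  shows "in_power_ideal (k + k) (f \<otimes>\<^bsub>qd_algebra TYPE('k)\<^esub> f)"
proof (rule in_power_ideal_square_aux[OF 2])
  fix b
  have d: "X_minus_1 ^ k dvd qd_poly c f" for c using f by (simp add: in_power_ideal_def)
  show "X_minus_1 ^ (k + k) dvd qd_poly False f * qd_poly b f + qd_poly True f * twist (qd_poly (\<not> b) f)"
    unfolding power_add by (intro dvd_add mult_dvd_mono d twist_dvd_unity_poly_power)
qed (use k in simp)

text \<open>With \<open>u(1) = v(1)\<close>, the square has the components
\<open>u^2 + v \<sigma>(v) = (u + v)^2 + v (\<sigma>(v) - v)\<close> and \<open>u v + v \<sigma>(u) = v (\<sigma>(u) - u)\<close>, signs being irrelevant.\<close>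

lemma augmentation_zero_square:
  assumes 2: "(2 :: 'k::field) = 0" and f: "chi 1 1 f = 0"
  shows "in_power_ideal 2 (f \<otimes>\<^bsub>qd_algebra TYPE('k)\<^esub> f)"
proof (rule in_power_ideal_square_aux[OF 2])
  fix b
  let ?U = "qd_poly False f" and ?V = "qd_poly True f"
  show "X_minus_1 ^ 2 dvd ?U * qd_poly b f + ?V * twist (qd_poly (\<not> b) f)"
  proof (cases b)
    case False
    have "X_minus_1 dvd ?U + ?V" using f by (simp add: X_minus_1_dvd_iff chi_def)
    hence "X_minus_1 ^ 2 dvd (?U + ?V)\<^sup>2" by (rule dvd_power_same)
    hence "X_minus_1 ^ 2 dvd ?U\<^sup>2 + ?V\<^sup>2" by (simp only: square_add_char2[OF 2])
    moreover have "X_minus_1 ^ 2 dvd ?V * (twist ?V - ?V)" by (rule dvd_mult[OF twist_diff_dvd[OF 2]])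
    ultimately have "X_minus_1 ^ 2 dvd (?U\<^sup>2 + ?V\<^sup>2) + ?V * (twist ?V - ?V)" by (rule dvd_add)
    also have "\<dots> = ?U * ?U + ?V * twist ?V" by (simp add: power2_eq_square algebra_simps)
    finally show ?thesis using False by simp
  next
    case True
    have "X_minus_1 ^ 2 dvd ?V * (twist ?U - ?U)" by (rule dvd_mult[OF twist_diff_dvd[OF 2]])
    also have "?V * (twist ?U - ?U) = ?U * ?V + ?V * twist ?U"
      using minus_char2[OF 2, of "?U * ?V"] by (simp add: algebra_simps)
    finally show ?thesis using True by simp
  qed
qed simp

lemma in_power_ideal_16:
  assumes 2: "(2 :: 'k::field) = 0" and "in_power_ideal 16 f" "f \<in> carrier (qd_algebra TYPE('k))"
  shows "f = \<zero>\<^bsub>qd_algebra TYPE('k)\<^esub>"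
proof (rule qd_algebra_eqI)
  interpret ring "qd_algebra TYPE('k)" by (rule ring_qd_algebra)
  show "\<zero>\<^bsub>qd_algebra TYPE('k)\<^esub> \<in> carrier (qd_algebra TYPE('k))" by simp
  fix b
  have "unity_poly 16 dvd qd_poly b f" using assms(2) by (simp add: in_power_ideal_def unity_poly_16_char2[OF 2])
  hence "qd_poly b f = 0" by (rule unity_poly_dvd_imp_0[rotated]) (simp_all add: degree_qd_poly)
  thus "qd_poly b f = qd_poly b \<zero>\<^bsub>qd_algebra TYPE('k)\<^esub>" by (simp add: qd_poly_zero)
qed fact

lemma chi_add: "chi e d (f \<oplus>\<^bsub>qd_algebra TYPE('k::field)\<^esub> h) = chi e d f + chi e d h"
  by (simp add: chi_def qd_poly_add algebra_simps)

lemma qd_add_self: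
  assumes "(2 :: 'k::field) = 0"
  shows "f \<oplus>\<^bsub>qd_algebra TYPE('k)\<^esub> f = \<zero>\<^bsub>qd_algebra TYPE('k)\<^esub>"
  using assms by (simp add: group_algebra_simps flip: mult_2)

text \<open>Squaring commutes with adding 1 in characteristic 2, so with \<open>f = 1 + g\<close> the 16th power is
\<open>1 + g^16\<close>, and \<open>g^16 = 0\<close> by the filtration.\<close>

lemma augmentation_one_power_16:
  assumes 2: "(2 :: 'k::field) = 0"
    and f: "f \<in> carrier (qd_algebra TYPE('k))" "chi 1 1 f = 1"
  shows "f [^]\<^bsub>qd_algebra TYPE('k)\<^esub> (16 :: nat) = \<one>\<^bsub>qd_algebra TYPE('k)\<^esub>"
proof -
  let ?A = "qd_algebra TYPE('k)"
  interpret A: ring ?A by (rule ring_qd_algebra)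
  define sq where "sq = (\<lambda>g. g \<otimes>\<^bsub>?A\<^esub> g)"
  have sq_closed: "sq g \<in> carrier ?A" if "g \<in> carrier ?A" for g using that by (simp add: sq_def)
  have sq_one: "sq (\<one>\<^bsub>?A\<^esub> \<oplus>\<^bsub>?A\<^esub> g) = \<one>\<^bsub>?A\<^esub> \<oplus>\<^bsub>?A\<^esub> sq g" if g: "g \<in> carrier ?A" for g
  proof -
    have "sq (\<one>\<^bsub>?A\<^esub> \<oplus>\<^bsub>?A\<^esub> g) = \<one>\<^bsub>?A\<^esub> \<oplus>\<^bsub>?A\<^esub> ((g \<oplus>\<^bsub>?A\<^esub> g) \<oplus>\<^bsub>?A\<^esub> sq g)"
      using g by (simp add: sq_def A.l_distr A.r_distr A.a_ac)
    thus ?thesis using g sq_closed[OF g] by (simp add: qd_add_self[OF 2])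
  qed
  define g where "g = \<one>\<^bsub>?A\<^esub> \<oplus>\<^bsub>?A\<^esub> f"
  have g: "g \<in> carrier ?A" using f by (simp add: g_def)
  have "chi 1 1 g = 1 + 1" unfolding g_def chi_add chi_one f(2) ..
  hence "chi 1 1 g = 0" using 2 by simp
  hence "in_power_ideal 2 (sq g)" unfolding sq_def by (rule augmentation_zero_square[OF 2])
  hence "in_power_ideal (2 + 2) (sq (sq g))" unfolding sq_def by (intro square_in_power_ideal[OF 2]) auto
  hence "in_power_ideal 4 (sq (sq g))" by simp
  hence "in_power_ideal (4 + 4) (sq (sq (sq g)))" unfolding sq_def by (intro square_in_power_ideal[OF 2]) auto
  hence "in_power_ideal 8 (sq (sq (sq g)))" by simp
  hence "in_power_ideal (8 + 8) (sq (sq (sq (sq g))))" unfolding sq_def by (intro square_in_power_ideal[OF 2]) auto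
  hence "in_power_ideal 16 (sq (sq (sq (sq g))))" by simp
  hence 0: "sq (sq (sq (sq g))) = \<zero>\<^bsub>?A\<^esub>"
    by (rule in_power_ideal_16[OF 2]) (intro sq_closed g)
  have f_eq: "f = \<one>\<^bsub>?A\<^esub> \<oplus>\<^bsub>?A\<^esub> g"
  proof -
    have "\<one>\<^bsub>?A\<^esub> \<oplus>\<^bsub>?A\<^esub> g = (\<one>\<^bsub>?A\<^esub> \<oplus>\<^bsub>?A\<^esub> \<one>\<^bsub>?A\<^esub>) \<oplus>\<^bsub>?A\<^esub> f"
      using f by (simp add: g_def A.a_assoc)
    thus ?thesis using f by (simp add: qd_add_self[OF 2])
  qed
  have "f [^]\<^bsub>?A\<^esub> (16 :: nat) = sq (sq (sq (sq f)))"
  proof -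
    have p2: "x [^]\<^bsub>?A\<^esub> (k + k) = sq (x [^]\<^bsub>?A\<^esub> k)" if "x \<in> carrier ?A" for x and k :: nat
      using that by (simp add: sq_def A.nat_pow_mult)
    have "f [^]\<^bsub>?A\<^esub> (2 :: nat) = sq f" using f(1) by (simp add: sq_def numeral_2_eq_2)
    thus ?thesis using p2[OF f(1), of 8] p2[OF f(1), of 4] p2[OF f(1), of 2] by simp
  qed
  also have "\<dots> = \<one>\<^bsub>?A\<^esub> \<oplus>\<^bsub>?A\<^esub> sq (sq (sq (sq g)))"
    by (simp add: f_eq sq_one sq_closed g)
  finally show ?thesis unfolding 0 by simp
qed

definition qd_const :: "'k::field \<Rightarrow> qd_gen word set \<Rightarrow> 'k" where
  "qd_const c = (\<lambda>g. if g = \<one>\<^bsub>QD32\<^esub> then c else 0)"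

lemma qd_const_carrier: "qd_const c \<in> carrier (qd_algebra TYPE('k::field))"
  by (auto simp: qd_const_def carrier_qd_algebra one_QD32)

lemma qd_poly_const: "qd_poly b (qd_const c) = (if b then 0 else [:c:])"
  by (rule poly_eqI) (auto simp: coeff_qd_poly qd_const_def one_QD32 qd_elem_eq_iff coeff_pCons split: nat.splits)

lemma chi_const: "chi e d (qd_const c) = c"
  by (simp add: chi_def qd_poly_const)

lemma qd_poly_eqI:
  assumes "[qd_poly b f = p] (mod unity_poly 16)" "degree p < 16" shows "qd_poly b f = p"
proof -
  have "degree (qd_poly b f - p) < 16" by (intro degree_diff_less degree_qd_poly assms(2))
  hence "qd_poly b f - p = 0" using assms(1) by (intro unity_poly_dvd_imp_0[of 16]) (auto simp: cong_iff_dvd_diff)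
  thus ?thesis by simp
qed

lemma qd_const_mult: "qd_const c \<otimes>\<^bsub>qd_algebra TYPE('k::field)\<^esub> qd_const c' = qd_const (c * c')"
proof (rule qd_algebra_eqI)
  interpret ring "qd_algebra TYPE('k)" by (rule ring_qd_algebra)
  show "qd_const c \<otimes>\<^bsub>qd_algebra TYPE('k)\<^esub> qd_const c' \<in> carrier (qd_algebra TYPE('k))"
    by (simp add: qd_const_carrier)
  fix b
  show "qd_poly b (qd_const c \<otimes>\<^bsub>qd_algebra TYPE('k)\<^esub> qd_const c') = qd_poly b (qd_const (c * c'))"
    using qd_poly_mult[of b "qd_const c" "qd_const c'"] by (intro qd_poly_eqI) (auto simp: qd_poly_const)
qed (rule qd_const_carrier)

lemma qd_const_1: "qd_const 1 = \<one>\<^bsub>qd_algebra TYPE('k::field)\<^esub>"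
  by (simp add: qd_const_def group_algebra_simps)

text \<open>Elements of augmentation 1 have finite order; the general case follows by scaling.\<close>

lemma Units_qd_algebra_char2:
  assumes 2: "(2 :: 'k::field) = 0"
  shows "Units (qd_algebra TYPE('k)) = {f \<in> carrier (qd_algebra TYPE('k)). chi 1 1 f \<noteq> 0}"
proof -
  let ?A = "qd_algebra TYPE('k)"
  interpret A: ring ?A by (rule ring_qd_algebra)
  have 1: "f \<in> Units ?A" if f: "f \<in> carrier ?A" "chi 1 1 f = 1" for f
  proof -
    have "f [^]\<^bsub>?A\<^esub> (15 :: nat) \<otimes>\<^bsub>?A\<^esub> f = \<one>\<^bsub>?A\<^esub>" "f \<otimes>\<^bsub>?A\<^esub> f [^]\<^bsub>?A\<^esub> (15 :: nat) = \<one>\<^bsub>?A\<^esub>"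
      using A.nat_pow_mult[OF f(1), of 15 1] A.nat_pow_mult[OF f(1), of 1 15] f(1)
        augmentation_one_power_16[OF 2 f] by simp_all
    thus ?thesis using f(1) by (auto simp: Units_def intro!: bexI[of _ "f [^]\<^bsub>?A\<^esub> (15 :: nat)"])
  qed
  have const: "qd_const c \<in> Units ?A" if "c \<noteq> 0" for c
    using that unfolding Units_def
    by (auto simp: qd_const_carrier qd_const_mult qd_const_1 intro!: bexI[of _ "qd_const (inverse c)"])
  have "f \<in> Units ?A" if f: "f \<in> carrier ?A" "chi 1 1 f \<noteq> 0" for f
  proof -
    let ?c = "chi 1 1 f"
    have "f \<otimes>\<^bsub>?A\<^esub> qd_const (inverse ?c) \<in> Units ?A"
      using f by (intro 1) (simp_all add: qd_const_carrier chi_mult chi_const)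
    hence "f \<otimes>\<^bsub>?A\<^esub> qd_const (inverse ?c) \<otimes>\<^bsub>?A\<^esub> qd_const ?c \<in> Units ?A"
      using const[OF f(2)] by (rule A.Units_m_closed)
    thus ?thesis using f by (simp add: A.m_assoc qd_const_carrier qd_const_mult qd_const_1)
  qed
  moreover have "chi 1 1 f \<noteq> 0" if u: "f \<in> Units ?A" for f
  proof
    assume 0: "chi 1 1 f = 0"
    obtain h where "f \<otimes>\<^bsub>?A\<^esub> h = \<one>\<^bsub>?A\<^esub>" using A.Units_r_inv_ex[OF u] by blast
    hence "chi 1 1 (f \<otimes>\<^bsub>?A\<^esub> h) = 1" by (simp add: chi_one)
    thus False using 0 by (simp add: chi_mult)
  qed
  ultimately show ?thesis by (auto simp: A.Units_closed)
qed

definition augmentation_ideal :: "'k::field itself \<Rightarrow> (qd_gen word set \<Rightarrow> 'k) set" where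
  "augmentation_ideal ty = {f \<in> carrier (qd_algebra ty). chi 1 1 f = 0}"

lemma left_ideal_augmentation: "left_ideal (augmentation_ideal TYPE('k::field)) (qd_algebra TYPE('k))"
proof -
  let ?A = "qd_algebra TYPE('k)"
  interpret A: ring ?A by (rule ring_qd_algebra)
  have "subgroup (augmentation_ideal TYPE('k)) (add_monoid ?A)"
  proof (rule A.add.subgroupI)
    have "\<zero>\<^bsub>?A\<^esub> \<in> augmentation_ideal TYPE('k)"
      by (simp add: augmentation_ideal_def chi_def qd_poly_zero)
    thus "augmentation_ideal TYPE('k) \<noteq> {}" by blast
    fix f assume f: "f \<in> augmentation_ideal TYPE('k)"
    hence f': "f \<in> carrier ?A" "chi 1 1 f = 0" by (auto simp: augmentation_ideal_def)
    have "chi 1 1 (\<ominus>\<^bsub>?A\<^esub> f \<oplus>\<^bsub>?A\<^esub> f) = 0"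
      using f'(1) by (simp add: A.l_neg) (simp add: chi_def qd_poly_zero)
    hence "chi 1 1 (\<ominus>\<^bsub>?A\<^esub> f) = 0" using f' by (simp add: chi_add)
    thus "\<ominus>\<^bsub>?A\<^esub> f \<in> augmentation_ideal TYPE('k)" using f' by (simp add: augmentation_ideal_def)
  qed (auto simp: augmentation_ideal_def chi_add)
  hence "additive_subgroup (augmentation_ideal TYPE('k)) ?A" by (rule additive_subgroup.intro)
  moreover have "left_ideal_axioms (augmentation_ideal TYPE('k)) ?A"
    by (rule left_ideal_axioms.intro) (simp add: augmentation_ideal_def chi_mult)
  ultimately show ?thesis by (intro left_ideal.intro A.ring_axioms)
qed

lemma left_ideal_with_unit:
  assumes "left_ideal I R" "u \<in> I" "u \<in> Units R" "I \<subseteq> carrier R" shows "I = carrier R"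
proof -
  interpret left_ideal I R by fact
  have "inv\<^bsub>R\<^esub> u \<otimes>\<^bsub>R\<^esub> u \<in> I" using assms(2,3) by (intro I_l_closed) auto
  hence 1: "\<one>\<^bsub>R\<^esub> \<in> I" using assms(3) by simp
  have "r \<in> I" if "r \<in> carrier R" for r using I_l_closed[OF 1 that] that by simp
  thus ?thesis using assms(4) by auto
qed

text \<open>Everything outside the augmentation ideal is a unit, so a proper left ideal is contained in it, and
it is the only maximal one.\<close>

lemma jacobson_radical_char2:
  assumes 2: "(2 :: 'k::field) = 0"
  shows "jacobson_radical (qd_algebra TYPE('k)) = augmentation_ideal TYPE('k)"
proof -
  let ?A = "qd_algebra TYPE('k)" and ?D = "augmentation_ideal TYPE('k)"
  interpret A: ring ?A by (rule ring_qd_algebra)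
  have D: "?D \<subseteq> carrier ?A" by (auto simp: augmentation_ideal_def)
  have D1: "carrier ?A \<noteq> ?D"
  proof
    assume "carrier ?A = ?D"
    hence "\<one>\<^bsub>?A\<^esub> \<in> ?D" using A.one_closed by simp
    thus False by (simp add: augmentation_ideal_def chi_one)
  qed
  have big: "J = carrier ?A" if J: "left_ideal J ?A" "J \<subseteq> carrier ?A" "\<not> J \<subseteq> ?D" for J
  proof -
    obtain u where "u \<in> J" "u \<notin> ?D" using J by blast
    moreover from this have "u \<in> Units ?A"
      using J by (auto simp: Units_qd_algebra_char2[OF 2] augmentation_ideal_def)
    ultimately show ?thesis using left_ideal_with_unit[OF J(1) _ _ J(2)] by blast
  qed
  have "maximal_left_ideal ?D ?A"
    by (intro maximal_left_ideal.intro maximal_left_ideal_axioms.intro left_ideal_augmentation D1)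
       (use big in blast)
  moreover have "I = ?D" if "maximal_left_ideal I ?A" for I
  proof -
    interpret I: maximal_left_ideal I ?A by fact
    have "left_ideal I ?A" by (rule I.left_ideal_axioms)
    hence "I \<subseteq> ?D" using big[of I] I.I_notcarr I.a_subset by blast
    from I.I_maximal[OF left_ideal_augmentation this D] show ?thesis using D1 by auto
  qed
  ultimately have "{I. maximal_left_ideal I ?A} = {?D}" by blast
  thus ?thesis using D by (auto simp: jacobson_radical_def)
qed

definition one_units :: "'k::field itself \<Rightarrow> (qd_gen word set \<Rightarrow> 'k) set" where
  "one_units ty = {f \<in> carrier (qd_algebra ty). chi 1 1 f = 1}"

lemma coset_augmentation_ideal:
  "\<one>\<^bsub>qd_algebra TYPE('k::field)\<^esub> <+\<^bsub>qd_algebra TYPE('k)\<^esub> augmentation_ideal TYPE('k) = one_units TYPE('k)"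
proof -
  let ?A = "qd_algebra TYPE('k)"
  interpret A: ring ?A by (rule ring_qd_algebra)
  have "f \<in> \<one>\<^bsub>?A\<^esub> <+\<^bsub>?A\<^esub> augmentation_ideal TYPE('k)" if f: "f \<in> one_units TYPE('k)" for f
  proof -
    have f': "f \<in> carrier ?A" "chi 1 1 f = 1" using f by (auto simp: one_units_def)
    define h where "h = \<ominus>\<^bsub>?A\<^esub> \<one>\<^bsub>?A\<^esub> \<oplus>\<^bsub>?A\<^esub> f"
    have h: "h \<in> carrier ?A" "f = \<one>\<^bsub>?A\<^esub> \<oplus>\<^bsub>?A\<^esub> h"
      using f' by (simp_all add: h_def A.a_assoc[symmetric] A.r_neg)
    have "chi 1 1 f = 1 + chi 1 1 h" using h(2) by (simp only: chi_add chi_one)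
    hence "h \<in> augmentation_ideal TYPE('k)" using h(1) f'(2) by (simp add: augmentation_ideal_def)
    thus ?thesis using h(2) by (auto simp: a_l_coset_def')
  qed
  thus ?thesis by (auto simp: a_l_coset_def' one_units_def augmentation_ideal_def chi_add chi_one)
qed

text \<open>Adding a constant moves any augmentation to 1.\<close>

lemma card_one_units:
  "CARD('k::finite_field) * card (one_units TYPE('k)) = CARD('k) ^ 32"
proof -
  let ?A = "qd_algebra TYPE('k)"
  interpret A: ring ?A by (rule ring_qd_algebra)
  have "bij_betw (\<lambda>(c, f). f \<oplus>\<^bsub>?A\<^esub> qd_const c) (UNIV \<times> one_units TYPE('k)) (carrier ?A)"
  proof (rule bij_betw_byWitness[where f' = "\<lambda>f. (chi 1 1 f - 1, f \<oplus>\<^bsub>?A\<^esub> qd_const (1 - chi 1 1 f))"])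
    have cc: "qd_const c \<oplus>\<^bsub>?A\<^esub> qd_const c' = qd_const (c + c')" for c c' :: 'k
      by (auto simp: qd_const_def group_algebra_simps)
    have c0: "qd_const (0 :: 'k) = \<zero>\<^bsub>?A\<^esub>" by (auto simp: qd_const_def group_algebra_simps)
    show "\<forall>a\<in>UNIV \<times> one_units TYPE('k). (\<lambda>f. (chi 1 1 f - 1, f \<oplus>\<^bsub>?A\<^esub> qd_const (1 - chi 1 1 f)))
        ((\<lambda>(c, f). f \<oplus>\<^bsub>?A\<^esub> qd_const c) a) = a"
      by (auto simp: one_units_def chi_add chi_const qd_const_carrier A.a_assoc cc c0)
    show "\<forall>f\<in>carrier ?A. (\<lambda>(c, f). f \<oplus>\<^bsub>?A\<^esub> qd_const c) (chi 1 1 f - 1, f \<oplus>\<^bsub>?A\<^esub> qd_const (1 - chi 1 1 f)) = f"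
      by (auto simp: qd_const_carrier A.a_assoc cc c0)
  qed (auto simp: one_units_def qd_const_carrier chi_add chi_const)
  from bij_betw_same_card[OF this] show ?thesis by (simp add: card_cartesian_product card_qd_algebra)
qed

definition qd_basis :: "nat \<Rightarrow> qd_gen word set \<Rightarrow> 'k::field" where
  "qd_basis i = (\<lambda>g. if g = qd_elem i False then 1 else 0)"

lemma qd_basis_carrier: "qd_basis i \<in> carrier (qd_algebra TYPE('k::field))"
  by (auto simp: qd_basis_def carrier_qd_algebra)

lemma qd_poly_basis: "qd_poly b (qd_basis i) = (if b then 0 else monom 1 (i mod 16))"
  by (rule poly_eqI) (auto simp: coeff_qd_poly qd_basis_def qd_elem_eq_iff)

lemma qd_basis_power: "qd_basis 1 [^]\<^bsub>qd_algebra TYPE('k::field)\<^esub> k = qd_basis k"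
proof (induction k)
  case 0
  show ?case by (simp add: qd_basis_def group_algebra_simps one_QD32)
next
  case (Suc k)
  interpret ring "qd_algebra TYPE('k)" by (rule ring_qd_algebra)
  have "qd_basis k \<otimes>\<^bsub>qd_algebra TYPE('k)\<^esub> qd_basis 1 = qd_basis (Suc k)"
  proof (rule qd_algebra_eqI)
    fix b
    have "[qd_poly b (qd_basis k \<otimes>\<^bsub>qd_algebra TYPE('k)\<^esub> qd_basis 1) =
        qd_poly False (qd_basis k) * qd_poly b (qd_basis 1)] (mod unity_poly 16)"
      using qd_poly_mult[of b "qd_basis k" "qd_basis 1 :: _ \<Rightarrow> 'k"] by (simp add: qd_poly_basis)
    also have "qd_poly False (qd_basis k) * qd_poly b (qd_basis 1) = (if b then 0 else Polynomial.monom (1 :: 'k) (k mod 16 + 1))"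
      by (simp add: qd_poly_basis mult_monom)
    also have "[\<dots> = qd_poly b (qd_basis (Suc k))] (mod unity_poly 16)"
      by (auto simp: qd_poly_basis mod_Suc_eq intro!: cong_monom)
    finally show "qd_poly b (qd_basis k \<otimes>\<^bsub>qd_algebra TYPE('k)\<^esub> qd_basis 1) = qd_poly b (qd_basis (Suc k))"
      by (rule qd_poly_eqI) (rule degree_qd_poly)
  qed (simp_all add: qd_basis_carrier)
  thus ?case using Suc by simp
qed

lemma chi_basis: "chi 1 1 (qd_basis i) = 1"
  by (simp add: chi_def qd_poly_basis poly_monom)

section \<open>The unit group\<close>

lemma augmentation_group_hom:
  assumes 2: "(2 :: 'k::field) = 0"
  shows "group_hom (units_of (qd_algebra TYPE('k))) (units_of (field_monoid TYPE('k))) (chi 1 1)"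
proof -
  interpret A: ring "qd_algebra TYPE('k)" by (rule ring_qd_algebra)
  interpret U: group "units_of (qd_algebra TYPE('k))" by (rule A.units_group)
  interpret F: group "units_of (field_monoid TYPE('k))" by (rule group_units_field)
  show ?thesis
    by unfold_locales
       (auto simp: hom_def units_of_def Units_field_monoid Units_qd_algebra_char2[OF 2] chi_mult)
qed

lemma kernel_augmentation:
  assumes 2: "(2 :: 'k::field) = 0"
  shows "kernel (units_of (qd_algebra TYPE('k))) (units_of (field_monoid TYPE('k))) (chi 1 1) = one_units TYPE('k)"
  by (auto simp: kernel_def units_of_def Units_qd_algebra_char2[OF 2] one_units_def)

lemma units_mod_one_units:
  assumes 2: "(2 :: 'k::finite_field) = 0"
  shows "one_units TYPE('k) \<lhd> units_of (qd_algebra TYPE('k))"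
    and "units_of (qd_algebra TYPE('k)) Mod one_units TYPE('k) \<cong> integer_mod_group (CARD('k) - 1)"
proof -
  let ?U = "units_of (qd_algebra TYPE('k))" and ?F = "units_of (field_monoid TYPE('k))"
  interpret h: group_hom ?U ?F "chi 1 1" by (rule augmentation_group_hom[OF 2])
  show "one_units TYPE('k) \<lhd> ?U" using h.normal_kernel by (simp only: kernel_augmentation[OF 2])
  have "chi 1 1 ` carrier ?U = carrier ?F"
  proof (intro equalityI subsetI)
    fix c assume "c \<in> carrier ?F"
    hence "c \<noteq> 0" by (simp add: units_of_def Units_field_monoid)
    thus "c \<in> chi 1 1 ` carrier ?U"
      by (intro image_eqI[of _ _ "qd_const c"])
         (auto simp: chi_const units_of_def Units_qd_algebra_char2[OF 2] qd_const_carrier)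
  qed (auto simp: units_of_def Units_qd_algebra_char2[OF 2] Units_field_monoid)
  from h.FactGroup_iso_set[OF this] have "?U Mod one_units TYPE('k) \<cong> ?F"
    by (auto simp: is_iso_def kernel_augmentation[OF 2])
  from iso_trans[OF this units_field_cyclic]
  show "?U Mod one_units TYPE('k) \<cong> integer_mod_group (CARD('k) - 1)" .
qed

text \<open>The exponent is attained by \<open>a\<close>, whose powers are distinct basis elements.\<close>

lemma one_units_2_group:
  assumes 2: "(2 :: 'k::finite_field) = 0"
  defines "V \<equiv> units_of (qd_algebra TYPE('k)) \<lparr>carrier := one_units TYPE('k)\<rparr>"
  shows "p_group 2 V" and "group_exponent V = 16"
proof -
  let ?A = "qd_algebra TYPE('k)"
  interpret A: ring ?A by (rule ring_qd_algebra)
  interpret U: group "units_of ?A" by (rule A.units_group)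
  have pow: "g [^]\<^bsub>V\<^esub> k = g [^]\<^bsub>?A\<^esub> k" for g and k :: nat
    by (simp add: V_def units_of_def nat_pow_def)
  have one: "\<one>\<^bsub>V\<^esub> = \<one>\<^bsub>?A\<^esub>" by (simp add: V_def units_of_def)
  have carr: "carrier V = one_units TYPE('k)" by (simp add: V_def)
  have pow16: "g [^]\<^bsub>V\<^esub> (16 :: nat) = \<one>\<^bsub>V\<^esub>" if "g \<in> carrier V" for g
    using that augmentation_one_power_16[OF 2, of g] by (simp add: pow one carr one_units_def)
  have "group V" unfolding V_def
    by (intro U.subgroup_imp_group normal_imp_subgroup units_mod_one_units(1)[OF 2])
  moreover have "\<exists>k :: nat. g [^]\<^bsub>V\<^esub> ((2 :: nat) ^ k) = \<one>\<^bsub>V\<^esub>" if "g \<in> carrier V" for g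
    using pow16[OF that] by (intro exI[of _ 4]) simp
  ultimately show "p_group 2 V" by (simp add: p_group_def)
  show "group_exponent V = 16" unfolding group_exponent_def
  proof (rule Least_equality)
    fix m :: nat assume m: "0 < m \<and> (\<forall>g\<in>carrier V. g [^]\<^bsub>V\<^esub> m = \<one>\<^bsub>V\<^esub>)"
    have "qd_basis 1 \<in> carrier V" by (simp add: carr one_units_def qd_basis_carrier chi_basis)
    hence "qd_basis 1 [^]\<^bsub>?A\<^esub> m = \<one>\<^bsub>?A\<^esub>" using m by (simp only: pow one)
    hence "qd_basis m = (\<one>\<^bsub>?A\<^esub> :: _ \<Rightarrow> 'k)" by (simp only: qd_basis_power)
    from arg_cong[OF this, of "qd_poly False"]
    have "Polynomial.monom 1 (m mod 16) = (1 :: 'k poly)" by (simp add: qd_poly_basis qd_poly_one)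
    from arg_cong[OF this, of degree] have "m mod 16 = 0" by (simp add: degree_monom_eq)
    thus "16 \<le> m" using m by auto
  qed (use pow16 in auto)
qed

theorem theorem4p1:
  fixes p n q :: nat
  assumes "prime p" and "n \<ge> 1" and "q = p ^ n"
    and "CARD('f::finite_field) = q"
  shows
    "let A = group_algebra TYPE('f) QD32;
         U = units_of A;
         V1 = \<one>\<^bsub>A\<^esub> <+\<^bsub>A\<^esub> jacobson_radical A;
         C = integer_mod_group (q - 1)
     in
      (p = 2 \<longrightarrow>
         V1 \<lhd> U \<and>
         U Mod V1 \<cong> C \<and>
         p_group 2 (U\<lparr>carrier := V1\<rparr>) \<and>
         order (U\<lparr>carrier := V1\<rparr>) = 2 ^ (31 * n) \<and>
         group_exponent (U\<lparr>carrier := V1\<rparr>) = 16) \<and>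
      (p > 2 \<longrightarrow>
         ([int q = 1] (mod 16) \<or> [int q = 7] (mod 16) \<longrightarrow>
            U \<cong> group_power C 4 \<times>\<times> group_power (GL 2 TYPE('f)) 7) \<and>
         ([int q = - 1] (mod 16) \<or> [int q = - 7] (mod 16) \<longrightarrow>
            CARD('f2::finite_field) = q\<^sup>2 \<longrightarrow>
            U \<cong> group_power C 4 \<times>\<times> group_power (GL 2 TYPE('f)) 3 \<times>\<times>
                group_power (GL 2 TYPE('f2)) 2) \<and>
         ([int q = 3] (mod 16) \<or> [int q = - 3] (mod 16) \<or>
          [int q = 5] (mod 16) \<or> [int q = - 5] (mod 16) \<longrightarrow>
            CARD('f2) = q\<^sup>2 \<longrightarrow> CARD('f4::finite_field) = q ^ 4 \<longrightarrow>
            U \<cong> group_power C 4 \<times>\<times> GL 2 TYPE('f) \<times>\<times>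
                GL 2 TYPE('f2) \<times>\<times> GL 2 TYPE('f4)))"
proof -
  let ?A = "group_algebra TYPE('f) QD32"
  let ?U = "units_of ?A"
  let ?V1 = "\<one>\<^bsub>?A\<^esub> <+\<^bsub>?A\<^esub> jacobson_radical ?A"
  let ?C = "integer_mod_group (q - 1)"
  note card = assms(4)
  have cardp: "CARD('f) = p ^ n" using card assms(3) by simp
  have CHAR: "CHAR('f) = p" by (rule CHAR_eq_prime[OF assms(1) cardp])
  have res: "[int q = int r] (mod 16) \<longleftrightarrow> q mod 16 = r" if "r < 16" for r
  proof -
    have "[int q = int r] (mod int 16) \<longleftrightarrow> [q = r] (mod 16)" by (rule cong_int_iff)
    thus ?thesis using that by (simp add: cong_def)
  qed
  have neg: "[int q = - c] (mod 16) \<longleftrightarrow> [int q = 16 - c] (mod 16)" for c :: int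
    by (simp add: cong_def)
  have res': "[int q = 1] (mod 16) \<longleftrightarrow> q mod 16 = 1" "[int q = 7] (mod 16) \<longleftrightarrow> q mod 16 = 7"
    "[int q = 3] (mod 16) \<longleftrightarrow> q mod 16 = 3" "[int q = 5] (mod 16) \<longleftrightarrow> q mod 16 = 5"
    "[int q = - 1] (mod 16) \<longleftrightarrow> q mod 16 = 15" "[int q = - 7] (mod 16) \<longleftrightarrow> q mod 16 = 9"
    "[int q = - 3] (mod 16) \<longleftrightarrow> q mod 16 = 13" "[int q = - 5] (mod 16) \<longleftrightarrow> q mod 16 = 11"
    unfolding neg using res[of 1] res[of 7] res[of 3] res[of 5] res[of 15] res[of 9] res[of 13] res[of 11]
    by simp_all
  have pow_mod: "q ^ k mod 16 = (q mod 16) ^ k mod 16" for k by (simp add: power_mod)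
  have two: "?V1 \<lhd> ?U \<and> ?U Mod ?V1 \<cong> ?C \<and> p_group 2 (?U\<lparr>carrier := ?V1\<rparr>) \<and>
      order (?U\<lparr>carrier := ?V1\<rparr>) = 2 ^ (31 * n) \<and> group_exponent (?U\<lparr>carrier := ?V1\<rparr>) = 16" if "p = 2"
  proof -
    have "of_nat 2 = (0 :: 'f)" using CHAR \<open>p = 2\<close> by (simp only: of_nat_eq_0_iff_char_dvd dvd_refl)
    hence 2: "(2 :: 'f) = 0" by simp
    have V1: "?V1 = one_units TYPE('f)"
      by (simp only: jacobson_radical_char2[OF 2] coset_augmentation_ideal)
    have q0: "q > 0" using assms(1,3) by (simp add: prime_gt_0_nat)
    have "q * card (one_units TYPE('f)) = q * q ^ 31"
      using card_one_units[where ?'k = 'f] by (simp add: card flip: power_Suc)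
    hence "card (one_units TYPE('f)) = q ^ 31" using q0 by simp
    also have "\<dots> = 2 ^ (31 * n)" by (simp add: assms(3) \<open>p = 2\<close> mult.commute flip: power_mult)
    finally show ?thesis
      using units_mod_one_units[OF 2] one_units_2_group[OF 2] by (simp add: V1 Coset.order_def card)
  qed
  have odd: "([int q = 1] (mod 16) \<or> [int q = 7] (mod 16) \<longrightarrow>
            ?U \<cong> group_power ?C 4 \<times>\<times> group_power (GL 2 TYPE('f)) 7) \<and>
         ([int q = - 1] (mod 16) \<or> [int q = - 7] (mod 16) \<longrightarrow>
            CARD('f2::finite_field) = q\<^sup>2 \<longrightarrow>
            ?U \<cong> group_power ?C 4 \<times>\<times> group_power (GL 2 TYPE('f)) 3 \<times>\<times>
                group_power (GL 2 TYPE('f2)) 2) \<and>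
         ([int q = 3] (mod 16) \<or> [int q = - 3] (mod 16) \<or>
          [int q = 5] (mod 16) \<or> [int q = - 5] (mod 16) \<longrightarrow>
            CARD('f2) = q\<^sup>2 \<longrightarrow> CARD('f4::finite_field) = q ^ 4 \<longrightarrow>
            ?U \<cong> group_power ?C 4 \<times>\<times> GL 2 TYPE('f) \<times>\<times>
                GL 2 TYPE('f2) \<times>\<times> GL 2 TYPE('f4))" if p2: "p > 2"
  proof (intro conjI impI)
    have 2: "(2 :: 'f) \<noteq> 0" by (rule two_nonzero[OF CHAR p2])
    have card2: "CARD('f2) = p ^ (n * 2)" if "CARD('f2) = q\<^sup>2" using that by (simp add: assms(3) power_mult)
    have card4: "CARD('f4) = p ^ (n * 4)" if "CARD('f4) = q ^ 4" using that by (simp add: assms(3) power_mult)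
    {
      assume "[int q = 1] (mod 16) \<or> [int q = 7] (mod 16)"
      hence "q mod 16 \<in> {1, 7}" unfolding res' by auto
      hence "p ^ n mod 16 \<in> {1, 7}" unfolding assms(3) .
      then obtain t :: 'f where "t ^ 4 + 4 * t\<^sup>2 + 2 = 0" using ex_trace16[OF assms(1) cardp] by blast
      from units_split[OF 2 this]
      show "?U \<cong> group_power ?C 4 \<times>\<times> group_power (GL 2 TYPE('f)) 7" unfolding card .
    }
    {
      assume q: "[int q = - 1] (mod 16) \<or> [int q = - 7] (mod 16)" and c: "CARD('f2) = q\<^sup>2"
      have q': "q mod 16 \<in> {9, 15}" using q unfolding res' by auto
      note CHAR2 = CHAR_eq_prime[OF assms(1) card2[OF c]]
      obtain \<iota> :: "'f \<Rightarrow> 'f2" where \<iota>: "field_hom \<iota>"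
        using finite_field_embedding[where ?'f = 'f and ?'e = 'f2 and k = 2] CHAR CHAR2 c card by auto
      have "p ^ (n * 2) mod 16 = q\<^sup>2 mod 16" by (simp add: assms(3) power_mult)
      hence "p ^ (n * 2) mod 16 \<in> {1, 7}" using q' unfolding pow_mod by auto
      then obtain t :: 'f2 where t: "t ^ 4 + 4 * t\<^sup>2 + 2 = 0"
        using ex_trace16[OF assms(1) card2[OF c]] by blast
      have "p ^ n mod 8 = q mod 16 mod 8" by (simp add: assms(3) mod_mod_cancel)
      hence "p ^ n mod 8 \<in> {1, 7}" using q' by auto
      then obtain s :: 'f where s: "s\<^sup>2 = 2" using ex_sqrt2[OF assms(1) cardp] by blast
      have c': "CARD('f2) = CARD('f)\<^sup>2" using c card by simp
      have q'': "CARD('f) mod 16 \<in> {9, 15}" using q' card by simp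
      from units_semi_split[OF \<iota> 2 two_nonzero[OF CHAR2 p2] c' assms(1) cardp CHAR2 q'' s t]
      show "?U \<cong> group_power ?C 4 \<times>\<times> group_power (GL 2 TYPE('f)) 3 \<times>\<times> group_power (GL 2 TYPE('f2)) 2"
        unfolding card .
    }
    {
      assume q: "[int q = 3] (mod 16) \<or> [int q = - 3] (mod 16) \<or> [int q = 5] (mod 16) \<or> [int q = - 5] (mod 16)"
        and c: "CARD('f2) = q\<^sup>2" and d: "CARD('f4) = q ^ 4"
      have q': "q mod 16 \<in> {3, 5, 11, 13}" using q unfolding res' by auto
      note CHAR2 = CHAR_eq_prime[OF assms(1) card2[OF c]] and CHAR4 = CHAR_eq_prime[OF assms(1) card4[OF d]]
      obtain \<iota> :: "'f \<Rightarrow> 'f2" where \<iota>: "field_hom \<iota>"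
        using finite_field_embedding[where ?'f = 'f and ?'e = 'f2 and k = 2] CHAR CHAR2 c card by auto
      obtain \<kappa> :: "'f \<Rightarrow> 'f4" where \<kappa>: "field_hom \<kappa>"
        using finite_field_embedding[where ?'f = 'f and ?'e = 'f4 and k = 4] CHAR CHAR4 d card by auto
      have "p ^ (n * 4) mod 16 = q ^ 4 mod 16" by (simp add: assms(3) power_mult)
      hence "p ^ (n * 4) mod 16 \<in> {1, 7}" using q' unfolding pow_mod by auto
      then obtain t :: 'f4 where t: "t ^ 4 + 4 * t\<^sup>2 + 2 = 0"
        using ex_trace16[OF assms(1) card4[OF d]] by blast
      have "p ^ (n * 2) mod 8 = q\<^sup>2 mod 16 mod 8" by (simp add: assms(3) power_mult mod_mod_cancel)
      hence "p ^ (n * 2) mod 8 \<in> {1, 7}" using q' unfolding pow_mod by auto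
      then obtain s :: 'f2 where s: "s\<^sup>2 = 2" using ex_sqrt2[OF assms(1) card2[OF c]] by blast
      have c': "CARD('f2) = CARD('f)\<^sup>2" using c card by simp
      have d': "CARD('f4) = CARD('f) ^ 4" using d card by simp
      have q'': "CARD('f) mod 16 \<in> {3, 5, 11, 13}" using q' card by simp
      from units_nonsplit[OF \<iota> \<kappa> 2 two_nonzero[OF CHAR2 p2] two_nonzero[OF CHAR4 p2] c' d'
          assms(1) cardp CHAR2 CHAR4 q'' s t]
      show "?U \<cong> group_power ?C 4 \<times>\<times> GL 2 TYPE('f) \<times>\<times> GL 2 TYPE('f2) \<times>\<times> GL 2 TYPE('f4)"
        unfolding card .
    }
  qed
  show ?thesis unfolding Let_def using two odd by blast
qed

end
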